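(* Let $\mathcal C$ be a path category with weak (resp. strong) homotopy $\Pi$-types, i.e. every composable pair of fibrations has a weak (resp. strong) homotopy $\Pi$-type. Let $f:I\to J$ be a fibration in $\mathcal C$, let $p:X\to Y$ be a fibration in $\mathcal C(I)$ (so $X\to I$ and $Y\to I$ are fibrations and $p$ is a fibration over $I$), and let $(\Pi_fY,\varepsilon_Y)$ be a weak (resp. strong) homotopy $\Pi$-type for $Y\to I$ and $f$. Then there is a weak (resp. strong) homotopy $\Pi$-type $(\Pi_fX,\varepsilon_X)$ for $X\to I$ and $f$, and a fibration $\Pi_fp:\Pi_fX\to\Pi_fY$ in $\mathcal C(J)$, such that $$p\,\varepsilon_X=\varepsilon_Y\,((\Pi_fp)\times_J1_I):(\Pi_fX)\times_JI\to Y .$$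
   Context: A path category is a category $\mathcal C$ with two classes of maps, fibrations and weak equivalences (a map in both classes is an acyclic fibration), such that: (1) fibrations are closed under composition; (2) the pullback of a fibration along any map exists and is a fibration; (3) the pullback of an acyclic fibration along any map is an acyclic fibration; (4) weak equivalences satisfy 2-out-of-6: if $hg$ and $gf$ are weak equivalences, then so are $f,g,h,hgf$; (5) isomorphisms are acyclic fibrations and every acyclic fibration has a section; (6) there is a terminal object $1$ and every map $X\to 1$ is a fibration; (7) every object $X$ has a path object, i.e. a factorization $X\xrightarrow{r}PX\xrightarrow{(s,t)}X\times X$ of the diagonal with $r$ a weak equivalence and $(s,t)$ a fibration. For an object $I$, the full subcategory $\mathcal C(I)$ of $\mathcal C/I$ on the fibrations $Y\to I$ is again a path category (inherited fibrations and weak equivalences); $P_IY$ denotes a path object of $Y\to I$ in $\mathcal C(I)$, with $r:Y\to P_IY$ and $(s,t):P_IY\to Y\times_I Y$. For a fibration $p:Y\to I$, maps $f,g:X\to Y$ with $pf=pg$ are fiberwise homotopic, $f\simeq_I g$, if for some path object $P_IY$ there is $H:X\to P_IY$ with $sH=f$, $tH=g$. Hom-groupoids. For $T\to J$ any map and $Z\to J$ a fibration, $(\mathcal C/J)(T,Z)$ is the groupoid whose objects are the maps $T\to Z$ over $J$ and whose arrows $u\to v$ are $\simeq_{Z\times_JZ}$-classes of maps $H:T\to P_JZ$ with $sH=u$, $tH=v$; the identity on $u$ is $[ru]$, and the composite of $[H]:u\to v$ and $[K]:v\to w$ is $[\tau(H,K)]$, where $\tau:P_JZ\times_{t,Z,s}P_JZ\to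 P_JZ$ is any map with $(s,t)\tau=(s\pi_1,t\pi_2)$ and $\tau(r,r)\simeq_{Z\times_JZ}r$ (unique up to $\simeq_{Z\times_JZ}$). For $\varepsilon:A\to B$ a map over $J$ between fibrations over $J$, the functor $\varepsilon*-:(\mathcal C/J)(T,A)\to(\mathcal C/J)(T,B)$ sends $u\mapsto\varepsilon u$ and $[H]\mapsto[(P_J\varepsilon)H]$, where $P_J\varepsilon:P_JA\to P_JB$ is any map with $(s,t)P_J\varepsilon=(\varepsilon s,\varepsilon t)$ and $(P_J\varepsilon)r\simeq_{B\times_JB}r\varepsilon$ (exists, unique up to $\simeq_{B\times_JB}$). For a fibration $g:I\to J$, the functor $-\times_JI:(\mathcal C/J)(T,A)\to(\mathcal C/I)(T\times_JI,A\times_JI)$ sends $u\mapsto u\times_J1_I$ and $[H]\mapsto[H\times_J1_I]$, where $(P_JA)\times_JI$ is used as path object of $A\times_JI$ over $I$. A functor is e.s. if it is essentially surjective and e.s.f. if it is essentially surjective and full. A weak (resp. strong) homotopy $\Pi$-type for fibrations $f:X\to I$ and $g:I\to J$ is a fibration $\Pi_gf:\Pi_gX\to J$ with a map $\varepsilon_X:(\Pi_gX)\times_JI\to X$ over $I$ such that for every map $T\to J$ the functor $(\varepsilon_X*-)(-\times_JI):(\mathcal C/J)(T,\Pi_gX)\to(\mathcal C/I)(T\times_JI,X)$ is e.s. (resp. e.s.f.). *)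

theory Defs
  imports Main
begin

section \<open>Categories and functors\<close>

record ('o, 'a) cat =
  Obj :: "'o set"
  Arr :: "'a set"
  Dom :: "'a \<Rightarrow> 'o"
  Cod :: "'a \<Rightarrow> 'o"
  Idn :: "'o \<Rightarrow> 'a"
  Cmp :: "'a \<Rightarrow> 'a \<Rightarrow> 'a" (infixl "\<cdot>\<index>" 70)

definition hom :: "('o, 'a, 'z) cat_scheme \<Rightarrow> 'o \<Rightarrow> 'o \<Rightarrow> 'a set" where
  "hom C X Y = {h \<in> Arr C. Dom C h = X \<and> Cod C h = Y}"

locale category =
  fixes C :: "('o, 'a, 'z) cat_scheme" (structure)
  assumes Dom_in: "h \<in> Arr C \<Longrightarrow> Dom C h \<in> Obj C"
    and Cod_in: "h \<in> Arr C \<Longrightarrow> Cod C h \<in> Obj C"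
    and Idn_in: "X \<in> Obj C \<Longrightarrow> Idn C X \<in> hom C X X"
    and Cmp_in: "h \<in> hom C X Y \<Longrightarrow> k \<in> hom C Y Z \<Longrightarrow> k \<cdot> h \<in> hom C X Z"
    and Idn_left: "h \<in> Arr C \<Longrightarrow> Idn C (Cod C h) \<cdot> h = h"
    and Idn_right: "h \<in> Arr C \<Longrightarrow> h \<cdot> Idn C (Dom C h) = h"
    and Cmp_assoc: "h \<in> hom C W X \<Longrightarrow> k \<in> hom C X Y \<Longrightarrow> l \<in> hom C Y Z \<Longrightarrow>
          (l \<cdot> k) \<cdot> h = l \<cdot> (k \<cdot> h)"

definition isomorphism :: "('o, 'a, 'z) cat_scheme \<Rightarrow> 'a \<Rightarrow> bool" where
  "isomorphism C h \<longleftrightarrow> h \<in> Arr C \<and>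
     (\<exists>k \<in> hom C (Cod C h) (Dom C h).
        k \<cdot>\<^bsub>C\<^esub> h = Idn C (Dom C h) \<and> h \<cdot>\<^bsub>C\<^esub> k = Idn C (Cod C h))"

definition terminal :: "('o, 'a, 'z) cat_scheme \<Rightarrow> 'o \<Rightarrow> bool" where
  "terminal C X \<longleftrightarrow> X \<in> Obj C \<and> (\<forall>Y \<in> Obj C. \<exists>!h. h \<in> hom C Y X)"

definition is_product :: "('o, 'a, 'z) cat_scheme \<Rightarrow> 'o \<Rightarrow> 'o \<Rightarrow> 'a \<Rightarrow> 'a \<Rightarrow> bool" where
  "is_product C X Y p q \<longleftrightarrow>
     p \<in> hom C (Dom C p) X \<and> q \<in> hom C (Dom C p) Y \<and>
     (\<forall>W. \<forall>a \<in> hom C W X. \<forall>b \<in> hom C W Y.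
        \<exists>!m. m \<in> hom C W (Dom C p) \<and> p \<cdot>\<^bsub>C\<^esub> m = a \<and> q \<cdot>\<^bsub>C\<^esub> m = b)"

definition is_pullback ::
  "('o, 'a, 'z) cat_scheme \<Rightarrow> 'a \<Rightarrow> 'a \<Rightarrow> 'a \<Rightarrow> 'a \<Rightarrow> bool" where
  "is_pullback C u v p q \<longleftrightarrow>
     u \<in> Arr C \<and> v \<in> Arr C \<and> Cod C u = Cod C v \<and>
     p \<in> hom C (Dom C p) (Dom C u) \<and> q \<in> hom C (Dom C p) (Dom C v) \<and>
     u \<cdot>\<^bsub>C\<^esub> p = v \<cdot>\<^bsub>C\<^esub> q \<and>
     (\<forall>W. \<forall>a \<in> hom C W (Dom C u). \<forall>b \<in> hom C W (Dom C v). u \<cdot>\<^bsub>C\<^esub> a = v \<cdot>\<^bsub>C\<^esub> b \<longrightarrow>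
        (\<exists>!m. m \<in> hom C W (Dom C p) \<and> p \<cdot>\<^bsub>C\<^esub> m = a \<and> q \<cdot>\<^bsub>C\<^esub> m = b))"

record ('o, 'a, 'p, 'b) funct =
  on_obj :: "'o \<Rightarrow> 'p"
  on_arr :: "'a \<Rightarrow> 'b"

definition funct_comp ::
  "('p, 'b, 'q, 'c) funct \<Rightarrow> ('o, 'a, 'p, 'b) funct \<Rightarrow> ('o, 'a, 'q, 'c) funct" where
  "funct_comp G F = \<lparr> on_obj = on_obj G \<circ> on_obj F, on_arr = on_arr G \<circ> on_arr F \<rparr>"

definition essentially_surjective ::
  "('o, 'a, 'y) cat_scheme \<Rightarrow> ('p, 'b, 'z) cat_scheme \<Rightarrow> ('o, 'a, 'p, 'b) funct \<Rightarrow> bool" where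
  "essentially_surjective D E F \<longleftrightarrow>
     (\<forall>v \<in> Obj E. \<exists>u \<in> Obj D. \<exists>k \<in> hom E (on_obj F u) v. isomorphism E k)"

definition full ::
  "('o, 'a, 'y) cat_scheme \<Rightarrow> ('p, 'b, 'z) cat_scheme \<Rightarrow> ('o, 'a, 'p, 'b) funct \<Rightarrow> bool" where
  "full D E F \<longleftrightarrow>
     (\<forall>u \<in> Obj D. \<forall>u' \<in> Obj D. \<forall>k \<in> hom E (on_obj F u) (on_obj F u').
        \<exists>h \<in> hom D u u'. on_arr F h = k)"

section \<open>Path categories\<close>

record ('o, 'a) fib_cat = "('o, 'a) cat" +
  fib :: "'a set"
  weq :: "'a set"

locale path_category = category C
  for C :: "('o, 'a, 'z) fib_cat_scheme" (structure) +
  assumes fib_Arr: "fib C \<subseteq> Arr C"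
    and weq_Arr: "weq C \<subseteq> Arr C"
    and fib_Cmp: "h \<in> fib C \<Longrightarrow> k \<in> fib C \<Longrightarrow> Cod C h = Dom C k \<Longrightarrow> k \<cdot> h \<in> fib C"
    and pullback_exists: "u \<in> Arr C \<Longrightarrow> v \<in> fib C \<Longrightarrow> Cod C u = Cod C v \<Longrightarrow>
          \<exists>p q. is_pullback C u v p q"
    and pullback_fib: "is_pullback C u v p q \<Longrightarrow> v \<in> fib C \<Longrightarrow> p \<in> fib C"
    and pullback_acyclic_fib:
          "is_pullback C u v p q \<Longrightarrow> v \<in> fib C \<inter> weq C \<Longrightarrow> p \<in> fib C \<inter> weq C"
    and two_out_of_six: "f \<in> hom C W X \<Longrightarrow> g \<in> hom C X Y \<Longrightarrow> h \<in> hom C Y Z \<Longrightarrow>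
          h \<cdot> g \<in> weq C \<Longrightarrow> g \<cdot> f \<in> weq C \<Longrightarrow>
          f \<in> weq C \<and> g \<in> weq C \<and> h \<in> weq C \<and> h \<cdot> (g \<cdot> f) \<in> weq C"
    and iso_acyclic_fib: "isomorphism C h \<Longrightarrow> h \<in> fib C \<inter> weq C"
    and acyclic_fib_section: "h \<in> fib C \<inter> weq C \<Longrightarrow>
          \<exists>k \<in> hom C (Cod C h) (Dom C h). h \<cdot> k = Idn C (Cod C h)"
    and terminal_fib: "\<exists>T. terminal C T \<and> (\<forall>h \<in> Arr C. Cod C h = T \<longrightarrow> h \<in> fib C)"
    and path_object_exists: "X \<in> Obj C \<Longrightarrow>
          \<exists>p q r d. is_product C X X p q \<and>
            r \<in> weq C \<and> Dom C r = X \<and>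
            d \<in> fib C \<and> d \<in> hom C (Cod C r) (Dom C p) \<and>
            p \<cdot> (d \<cdot> r) = Idn C X \<and> q \<cdot> (d \<cdot> r) = Idn C X"

text \<open>
  Notations such as \<open>A \<times>\<^sub>J I\<close> and \<open>- \<times>\<^sub>J I\<close> presuppose a choice of pullbacks. It is carried along
  as extra data: \<open>prl u v\<close> and \<open>prr u v\<close> are the projections of the chosen pullback of
  \<open>u\<close> and \<open>v\<close>, where \<open>v\<close> is a fibration. The choice is arbitrary, subject to no coherence.
\<close>

record ('o, 'a) cloven_cat = "('o, 'a) fib_cat" +
  prl :: "'a \<Rightarrow> 'a \<Rightarrow> 'a"
  prr :: "'a \<Rightarrow> 'a \<Rightarrow> 'a"

definition chosen_pullbacks :: "('o, 'a, 'z) cloven_cat_scheme \<Rightarrow> bool" where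
  "chosen_pullbacks C \<longleftrightarrow>
     (\<forall>u \<in> Arr C. \<forall>v \<in> fib C. Cod C u = Cod C v \<longrightarrow> is_pullback C u v (prl C u v) (prr C u v))"

definition pb :: "('o, 'a, 'z) cloven_cat_scheme \<Rightarrow> 'a \<Rightarrow> 'a \<Rightarrow> 'o" where
  "pb C u v = Dom C (prl C u v)"

definition pair :: "('o, 'a, 'z) cloven_cat_scheme \<Rightarrow> 'a \<Rightarrow> 'a \<Rightarrow> 'a \<Rightarrow> 'a \<Rightarrow> 'a" where
  "pair C u v a b =
     (THE m. m \<in> hom C (Dom C a) (pb C u v) \<and>
        prl C u v \<cdot>\<^bsub>C\<^esub> m = a \<and> prr C u v \<cdot>\<^bsub>C\<^esub> m = b)"

section \<open>Fiberwise path objects and homotopies\<close>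

record 'a path_ob =
  rfl :: 'a
  src :: 'a
  tgt :: 'a

definition pob :: "('o, 'a, 'z) cloven_cat_scheme \<Rightarrow> 'a path_ob \<Rightarrow> 'o" where
  "pob C P = Dom C (src P)"

text \<open>The map \<open>(s, t)\<close> from \<open>P\<^sub>J Z\<close> to \<open>Z \<times>\<^sub>J Z\<close>, where \<open>z\<close> is the fibration from \<open>Z\<close> to \<open>J\<close>.\<close>

definition ends :: "('o, 'a, 'z) cloven_cat_scheme \<Rightarrow> 'a \<Rightarrow> 'a path_ob \<Rightarrow> 'a" where
  "ends C z P = pair C z z (src P) (tgt P)"

definition is_path_object :: "('o, 'a, 'z) cloven_cat_scheme \<Rightarrow> 'a \<Rightarrow> 'a path_ob \<Rightarrow> bool" where
  "is_path_object C z P \<longleftrightarrow>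
     z \<in> fib C \<and>
     rfl P \<in> hom C (Dom C z) (pob C P) \<and>
     src P \<in> hom C (pob C P) (Dom C z) \<and> tgt P \<in> hom C (pob C P) (Dom C z) \<and>
     z \<cdot>\<^bsub>C\<^esub> src P = z \<cdot>\<^bsub>C\<^esub> tgt P \<and>
     src P \<cdot>\<^bsub>C\<^esub> rfl P = Idn C (Dom C z) \<and> tgt P \<cdot>\<^bsub>C\<^esub> rfl P = Idn C (Dom C z) \<and>
     rfl P \<in> weq C \<and> ends C z P \<in> fib C"

text \<open>
  The relation \<open>\<simeq>\<^sub>I\<close> depends on the fibration \<open>z\<close> into \<open>I\<close> and not just on \<open>I\<close>, so \<open>z\<close> is the
  parameter. In particular, \<open>\<simeq>\<close> over \<open>Z \<times>\<^sub>J Z\<close> for maps into \<open>P\<^sub>J Z\<close> is \<open>homotopic C (ends C z P)\<close>.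
\<close>

definition homotopic :: "('o, 'a, 'z) cloven_cat_scheme \<Rightarrow> 'a \<Rightarrow> 'a \<Rightarrow> 'a \<Rightarrow> bool" where
  "homotopic C z h k \<longleftrightarrow>
     h \<in> hom C (Dom C h) (Dom C z) \<and> k \<in> hom C (Dom C h) (Dom C z) \<and>
     z \<cdot>\<^bsub>C\<^esub> h = z \<cdot>\<^bsub>C\<^esub> k \<and>
     (\<exists>P. is_path_object C z P \<and>
        (\<exists>H \<in> hom C (Dom C h) (pob C P). src P \<cdot>\<^bsub>C\<^esub> H = h \<and> tgt P \<cdot>\<^bsub>C\<^esub> H = k))"

definition hclass :: "('o, 'a, 'z) cloven_cat_scheme \<Rightarrow> 'a \<Rightarrow> 'a \<Rightarrow> 'a set" where
  "hclass C z h = {k. homotopic C z h k}"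

section \<open>Hom-groupoids\<close>

definition path_concat :: "('o, 'a, 'z) cloven_cat_scheme \<Rightarrow> 'a \<Rightarrow> 'a path_ob \<Rightarrow> 'a \<Rightarrow> bool" where
  "path_concat C z P c \<longleftrightarrow>
     c \<in> hom C (pb C (tgt P) (src P)) (pob C P) \<and>
     src P \<cdot>\<^bsub>C\<^esub> c = src P \<cdot>\<^bsub>C\<^esub> prl C (tgt P) (src P) \<and>
     tgt P \<cdot>\<^bsub>C\<^esub> c = tgt P \<cdot>\<^bsub>C\<^esub> prr C (tgt P) (src P) \<and>
     homotopic C (ends C z P) (c \<cdot>\<^bsub>C\<^esub> pair C (tgt P) (src P) (rfl P) (rfl P)) (rfl P)"

text \<open>
  \<open>hom_groupoid C a z P\<close> is \<open>(C/J)(T, Z)\<close> for \<open>a\<close> from \<open>T\<close> to \<open>J\<close>, \<open>z\<close> from \<open>Z\<close> to \<open>J\<close> and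
  \<open>P\<close> a path object of \<open>z\<close>. An arrow is a homotopy class \<open>F\<close>; all \<open>H \<in> F\<close> have
  the same composite with \<open>(s, t)\<close>, so the images defining domain and codomain are singletons.
  The composite does not depend on the representatives or on the concatenation map, so the set
  given here, which ranges over all of them, is a single class.
\<close>

definition hom_groupoid ::
  "('o, 'a, 'z) cloven_cat_scheme \<Rightarrow> 'a \<Rightarrow> 'a \<Rightarrow> 'a path_ob \<Rightarrow> ('a, 'a set) cat" where
  "hom_groupoid C a z P =
     \<lparr> Obj = {u \<in> hom C (Dom C a) (Dom C z). z \<cdot>\<^bsub>C\<^esub> u = a},
       Arr = hclass C (ends C z P) `
               {H \<in> hom C (Dom C a) (pob C P). z \<cdot>\<^bsub>C\<^esub> (src P \<cdot>\<^bsub>C\<^esub> H) = a},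
       Dom = (\<lambda>F. the_elem ((\<lambda>H. src P \<cdot>\<^bsub>C\<^esub> H) ` F)),
       Cod = (\<lambda>F. the_elem ((\<lambda>H. tgt P \<cdot>\<^bsub>C\<^esub> H) ` F)),
       Idn = (\<lambda>u. hclass C (ends C z P) (rfl P \<cdot>\<^bsub>C\<^esub> u)),
       Cmp = (\<lambda>G F. \<Union>{hclass C (ends C z P) (c \<cdot>\<^bsub>C\<^esub> pair C (tgt P) (src P) H K) | H K c.
               H \<in> F \<and> K \<in> G \<and> path_concat C z P c}) \<rparr>"

text \<open>\<open>path_map C P y Q e w\<close>: \<open>w\<close> is a possible \<open>P\<^sub>J e\<close>, where \<open>y\<close> is the structure map of the codomain of \<open>e\<close>.\<close>

definition path_map ::
  "('o, 'a, 'z) cloven_cat_scheme \<Rightarrow> 'a path_ob \<Rightarrow> 'a \<Rightarrow> 'a path_ob \<Rightarrow> 'a \<Rightarrow> 'a \<Rightarrow> bool" where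
  "path_map C P y Q e w \<longleftrightarrow>
     w \<in> hom C (pob C P) (pob C Q) \<and>
     src Q \<cdot>\<^bsub>C\<^esub> w = e \<cdot>\<^bsub>C\<^esub> src P \<and> tgt Q \<cdot>\<^bsub>C\<^esub> w = e \<cdot>\<^bsub>C\<^esub> tgt P \<and>
     homotopic C (ends C y Q) (w \<cdot>\<^bsub>C\<^esub> rfl P) (rfl Q \<cdot>\<^bsub>C\<^esub> e)"

definition postcomp ::
  "('o, 'a, 'z) cloven_cat_scheme \<Rightarrow> 'a path_ob \<Rightarrow> 'a \<Rightarrow> 'a path_ob \<Rightarrow> 'a \<Rightarrow>
     ('a, 'a set, 'a, 'a set) funct" where
  "postcomp C P y Q e =
     \<lparr> on_obj = (\<lambda>u. e \<cdot>\<^bsub>C\<^esub> u),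
       on_arr = (\<lambda>F. \<Union>{hclass C (ends C y Q) (w \<cdot>\<^bsub>C\<^esub> H) | H w. H \<in> F \<and> path_map C P y Q e w}) \<rparr>"

text \<open>
  \<open>base_change C g a z h\<close> is \<open>h \<times>\<^sub>J 1\<^sub>I\<close> for \<open>g\<close> from \<open>I\<close> to \<open>J\<close> and \<open>h\<close> a map over \<open>J\<close>
  from (the domain of) \<open>a\<close> to (the domain of) \<open>z\<close>.
\<close>

definition base_change :: "('o, 'a, 'z) cloven_cat_scheme \<Rightarrow> 'a \<Rightarrow> 'a \<Rightarrow> 'a \<Rightarrow> 'a \<Rightarrow> 'a" where
  "base_change C g a z h = pair C z g (h \<cdot>\<^bsub>C\<^esub> prl C a g) (prr C a g)"

definition base_change_path_ob ::
  "('o, 'a, 'z) cloven_cat_scheme \<Rightarrow> 'a \<Rightarrow> 'a \<Rightarrow> 'a path_ob \<Rightarrow> 'a path_ob" where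
  "base_change_path_ob C g z P =
     \<lparr> rfl = base_change C g z (z \<cdot>\<^bsub>C\<^esub> src P) (rfl P),
       src = base_change C g (z \<cdot>\<^bsub>C\<^esub> src P) z (src P),
       tgt = base_change C g (z \<cdot>\<^bsub>C\<^esub> src P) z (tgt P) \<rparr>"

definition pullback_functor ::
  "('o, 'a, 'z) cloven_cat_scheme \<Rightarrow> 'a \<Rightarrow> 'a \<Rightarrow> 'a \<Rightarrow> 'a path_ob \<Rightarrow>
     ('a, 'a set, 'a, 'a set) funct" where
  "pullback_functor C g a z P =
     \<lparr> on_obj = base_change C g a z,
       on_arr = (\<lambda>F. \<Union>{hclass C (ends C (prr C z g) (base_change_path_ob C g z P))
                          (base_change C g a (z \<cdot>\<^bsub>C\<^esub> src P) H) | H. H \<in> F}) \<rparr>"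

section \<open>Homotopy Pi-types\<close>

definition Pi_functor ::
  "('o, 'a, 'z) cloven_cat_scheme \<Rightarrow> 'a \<Rightarrow> 'a \<Rightarrow> 'a \<Rightarrow> 'a \<Rightarrow> 'a \<Rightarrow> 'a path_ob \<Rightarrow> 'a path_ob \<Rightarrow>
     ('a, 'a set, 'a, 'a set) funct" where
  "Pi_functor C f g pi e a P Q =
     funct_comp (postcomp C (base_change_path_ob C g pi P) f Q e) (pullback_functor C g a pi P)"

text \<open>
  For fibrations \<open>f\<close> from \<open>X\<close> to \<open>I\<close> and \<open>g\<close> from \<open>I\<close> to \<open>J\<close>, the pair \<open>(pi, e)\<close> consists of the
  fibration \<open>\<Pi>\<^sub>g f\<close> and the map \<open>\<epsilon>\<^sub>X\<close>. Hom-groupoids for different path objects of the same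
  fibration are canonically isomorphic; \<open>P\<close> and \<open>Q\<close> range over all of them.
\<close>

definition weak_Pi_type :: "('o, 'a, 'z) cloven_cat_scheme \<Rightarrow> 'a \<Rightarrow> 'a \<Rightarrow> 'a \<Rightarrow> 'a \<Rightarrow> bool" where
  "weak_Pi_type C f g pi e \<longleftrightarrow>
     pi \<in> fib C \<and> Cod C pi = Cod C g \<and>
     e \<in> hom C (pb C pi g) (Dom C f) \<and> f \<cdot>\<^bsub>C\<^esub> e = prr C pi g \<and>
     (\<forall>a \<in> Arr C. Cod C a = Cod C g \<longrightarrow>
       (\<forall>P Q. is_path_object C pi P \<longrightarrow> is_path_object C f Q \<longrightarrow>
         essentially_surjective (hom_groupoid C a pi P) (hom_groupoid C (prr C a g) f Q)
           (Pi_functor C f g pi e a P Q)))"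

definition strong_Pi_type :: "('o, 'a, 'z) cloven_cat_scheme \<Rightarrow> 'a \<Rightarrow> 'a \<Rightarrow> 'a \<Rightarrow> 'a \<Rightarrow> bool" where
  "strong_Pi_type C f g pi e \<longleftrightarrow>
     pi \<in> fib C \<and> Cod C pi = Cod C g \<and>
     e \<in> hom C (pb C pi g) (Dom C f) \<and> f \<cdot>\<^bsub>C\<^esub> e = prr C pi g \<and>
     (\<forall>a \<in> Arr C. Cod C a = Cod C g \<longrightarrow>
       (\<forall>P Q. is_path_object C pi P \<longrightarrow> is_path_object C f Q \<longrightarrow>
         essentially_surjective (hom_groupoid C a pi P) (hom_groupoid C (prr C a g) f Q)
           (Pi_functor C f g pi e a P Q) \<and>
         full (hom_groupoid C a pi P) (hom_groupoid C (prr C a g) f Q)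
           (Pi_functor C f g pi e a P Q)))"

definition has_weak_Pi_types :: "('o, 'a, 'z) cloven_cat_scheme \<Rightarrow> bool" where
  "has_weak_Pi_types C \<longleftrightarrow>
     (\<forall>f \<in> fib C. \<forall>g \<in> fib C. Cod C f = Dom C g \<longrightarrow> (\<exists>pi e. weak_Pi_type C f g pi e))"

definition has_strong_Pi_types :: "('o, 'a, 'z) cloven_cat_scheme \<Rightarrow> bool" where
  "has_strong_Pi_types C \<longleftrightarrow>
     (\<forall>f \<in> fib C. \<forall>g \<in> fib C. Cod C f = Dom C g \<longrightarrow> (\<exists>pi e. strong_Pi_type C f g pi e))"

end

theory Submission
  imports Defs
begin

text \<open>
  Write \<open>\<Pi>Y\<close> for \<open>\<Pi>\<^sub>f Y\<close>. Let \<open>X'\<close> be the pullback of \<open>p : X \<rightarrow> Y\<close> along \<open>\<epsilon>\<^sub>Y : \<Pi>Y \<times>\<^sub>J I \<rightarrow> Y\<close>, and let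
  \<open>q : \<Pi>X \<rightarrow> \<Pi>Y\<close>, with evaluation \<open>e'\<close>, be a homotopy \<open>\<Pi>\<close>-type of the fibration \<open>X' \<rightarrow> \<Pi>Y \<times>\<^sub>J I\<close>
  along the projection \<open>\<Pi>Y \<times>\<^sub>J I \<rightarrow> \<Pi>Y\<close>. Since \<open>\<Pi>X \<times>\<^sub>J I\<close> is also the pullback of \<open>\<Pi>Y \<times>\<^sub>J I\<close> along
  \<open>q\<close>, evaluation followed by \<open>X' \<rightarrow> X\<close> is a map \<open>\<epsilon>\<^sub>X : \<Pi>X \<times>\<^sub>J I \<rightarrow> X\<close>. It satisfies
  \<open>p \<epsilon>\<^sub>X = \<epsilon>\<^sub>Y (q \<times>\<^sub>J 1)\<close> strictly because \<open>e'\<close> is a map over \<open>\<Pi>Y \<times>\<^sub>J I\<close>. The work is to show that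
  \<open>\<Pi>X \<rightarrow> J\<close> with \<open>\<epsilon>\<^sub>X\<close> is a homotopy \<open>\<Pi>\<close>-type.

  Essential surjectivity (\<open>lifts_points_composite\<close>): for \<open>v : T \<times>\<^sub>J I \<rightarrow> X\<close> over \<open>I\<close> there is
  \<open>b : T \<rightarrow> \<Pi>Y\<close> with \<open>\<epsilon>\<^sub>Y (b \<times>\<^sub>J 1)\<close> homotopic to \<open>p v\<close>. As \<open>p\<close> is a fibration, \<open>v\<close> can be replaced by a
  homotopic map lying strictly over \<open>\<epsilon>\<^sub>Y (b \<times>\<^sub>J 1)\<close> (\<open>homotopy_lifting\<close>), that is, by a map into \<open>X'\<close>
  over \<open>b \<times>\<^sub>J 1\<close>, and the \<open>\<Pi>\<close>-type \<open>q\<close> provides \<open>T \<rightarrow> \<Pi>X\<close> over \<open>b\<close>.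

  Fullness (\<open>lifts_paths_composite\<close>): let \<open>H\<close> be a path in \<open>X\<close> from \<open>\<epsilon>\<^sub>X (u \<times>\<^sub>J 1)\<close> to \<open>\<epsilon>\<^sub>X (u' \<times>\<^sub>J 1)\<close>.
  Its image in \<open>Y\<close> comes from a path \<open>h\<^sub>0\<close> from \<open>q u\<close> to \<open>q u'\<close> in \<open>\<Pi>Y\<close>, which lifts to a path \<open>G\<close> in
  \<open>\<Pi>X\<close> starting at \<open>u\<close>. The path in \<open>X\<close> given by \<open>G\<close> and the path \<open>H\<close> have the same start and, up to
  homotopy, the same image in \<open>Y\<close>, so they differ by a path \<open>K\<close> inside the fibres of \<open>p\<close>
  (\<open>path_division\<close>). Fullness of the \<open>\<Pi>\<close>-type \<open>q\<close> gives a path in \<open>\<Pi>X\<close>, inside the fibres of \<open>q\<close>, that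
  realizes \<open>K\<close> (\<open>vertical_action\<close>). Its concatenation with \<open>G\<close> realizes \<open>H\<close>, because \<open>\<epsilon>\<^sub>X\<close> preserves
  concatenation with a path in a fibre (\<open>action_join\<close>).

  All constructions of paths rest on \<open>factorization\<close>, every map being a weak equivalence followed by a
  fibration, through the lemma \<open>filler\<close>: in a square with a weak equivalence on the left and a
  fibration on the right there is a diagonal for which the lower triangle commutes and the upper
  triangle commutes up to fibrewise homotopy. Applied to inclusions of constant paths this is path
  induction: \<open>path_extension\<close> constructs paths and \<open>path_unique\<close> shows that they are homotopic. The
  hom-groupoids enter only in \<open>essentially_surjective_iff\<close> and \<open>full_iff\<close>, which restate the two
  conditions as lifting properties of maps and paths.
\<close>

section \<open>Categories and pullbacks\<close>

context category
begin

lemma cmp_simps [simp]: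
  assumes "h \<in> Arr C" "k \<in> Arr C" "Cod C h = Dom C k"
  shows cmp_arr: "k \<cdot> h \<in> Arr C" and cmp_dom: "Dom C (k \<cdot> h) = Dom C h"
    and cmp_cod: "Cod C (k \<cdot> h) = Cod C k"
  using Cmp_in[of h "Dom C h" "Cod C h" k "Cod C k"] assms by (auto simp: hom_def)

lemma cmp_assoc [simp]:
  "h \<in> Arr C \<Longrightarrow> k \<in> Arr C \<Longrightarrow> l \<in> Arr C \<Longrightarrow> Cod C h = Dom C k \<Longrightarrow> Cod C k = Dom C l \<Longrightarrow>
     (l \<cdot> k) \<cdot> h = l \<cdot> (k \<cdot> h)"
  using Cmp_assoc[of h "Dom C h" "Cod C h" k "Cod C k" l "Cod C l"] by (auto simp: hom_def)

text \<open>Composites are kept bracketed to the right, so an equation about a composite of two arrows has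
  to be available with a third arrow appended.\<close>

lemma cmp_eq:
  "k \<cdot> h = c \<Longrightarrow> h \<in> Arr C \<Longrightarrow> k \<in> Arr C \<Longrightarrow> Cod C h = Dom C k \<Longrightarrow> x \<in> Arr C \<Longrightarrow>
     Cod C x = Dom C h \<Longrightarrow> k \<cdot> (h \<cdot> x) = c \<cdot> x"
  by (metis cmp_assoc)

lemma idn_left [simp]: "h \<in> Arr C \<Longrightarrow> Cod C h = X \<Longrightarrow> Idn C X \<cdot> h = h"
  using Idn_left by blast

lemma idn_right [simp]: "h \<in> Arr C \<Longrightarrow> Dom C h = X \<Longrightarrow> h \<cdot> Idn C X = h"
  using Idn_right by blast

lemma idn_simps [simp]:
  assumes "X \<in> Obj C"
  shows idn_arr: "Idn C X \<in> Arr C" and idn_dom: "Dom C (Idn C X) = X"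
    and idn_cod: "Cod C (Idn C X) = X"
  using Idn_in[OF assms] by (auto simp: hom_def)

lemma obj_simps [simp]:
  assumes "h \<in> Arr C"
  shows dom_obj: "Dom C h \<in> Obj C" and cod_obj: "Cod C h \<in> Obj C"
  using assms Dom_in Cod_in by auto

lemma is_pullbackI:
  assumes "u \<in> Arr C" "v \<in> Arr C" "Cod C u = Cod C v" "p \<in> Arr C" "Cod C p = Dom C u"
    "q \<in> Arr C" "Dom C q = Dom C p" "Cod C q = Dom C v" "u \<cdot> p = v \<cdot> q"
    and ex: "\<And>a b. a \<in> Arr C \<Longrightarrow> b \<in> Arr C \<Longrightarrow> Dom C b = Dom C a \<Longrightarrow> Cod C a = Dom C u \<Longrightarrow>
      Cod C b = Dom C v \<Longrightarrow> u \<cdot> a = v \<cdot> b \<Longrightarrow>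
      \<exists>m. m \<in> Arr C \<and> Dom C m = Dom C a \<and> Cod C m = Dom C p \<and> p \<cdot> m = a \<and> q \<cdot> m = b"
    and un: "\<And>m m'. m \<in> Arr C \<Longrightarrow> m' \<in> Arr C \<Longrightarrow> Dom C m' = Dom C m \<Longrightarrow> Cod C m = Dom C p \<Longrightarrow>
      Cod C m' = Dom C p \<Longrightarrow> p \<cdot> m' = p \<cdot> m \<Longrightarrow> q \<cdot> m' = q \<cdot> m \<Longrightarrow> m = m'"
  shows "is_pullback C u v p q"
proof -
  have *: "\<exists>!m. m \<in> hom C W (Dom C p) \<and> p \<cdot> m = a \<and> q \<cdot> m = b"
    if ab: "a \<in> hom C W (Dom C u)" "b \<in> hom C W (Dom C v)" "u \<cdot> a = v \<cdot> b" for W a b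
  proof -
    have a: "a \<in> Arr C" "Dom C a = W" "Cod C a = Dom C u"
      and b: "b \<in> Arr C" "Dom C b = W" "Cod C b = Dom C v"
      using ab by (auto simp: hom_def)
    obtain m where m: "m \<in> Arr C" "Dom C m = W" "Cod C m = Dom C p" "p \<cdot> m = a" "q \<cdot> m = b"
      using ex[of a b] a b ab(3) by auto
    show ?thesis
    proof (rule ex1I)
      show "m \<in> hom C W (Dom C p) \<and> p \<cdot> m = a \<and> q \<cdot> m = b"
        using m by (simp add: hom_def)
      show "n = m" if "n \<in> hom C W (Dom C p) \<and> p \<cdot> n = a \<and> q \<cdot> n = b" for n
        by (rule un) (use m that in \<open>simp_all add: hom_def\<close>)
    qed
  qed
  have "p \<in> hom C (Dom C p) (Dom C u)" "q \<in> hom C (Dom C p) (Dom C v)"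
    using assms(4-8) by (simp_all add: hom_def)
  with * assms(1-3,9) show ?thesis
    unfolding is_pullback_def by blast
qed

lemma is_pullbackD:
  assumes "is_pullback C u v p q"
  shows "u \<in> Arr C" "v \<in> Arr C" "Cod C u = Cod C v" "p \<in> Arr C" "Cod C p = Dom C u"
    "q \<in> Arr C" "Dom C q = Dom C p" "Cod C q = Dom C v" "v \<cdot> q = u \<cdot> p"
  using assms unfolding is_pullback_def hom_def by auto

lemma is_pullback_map:
  assumes "is_pullback C u v p q"
    and "a \<in> Arr C" "b \<in> Arr C" "Dom C b = Dom C a" "Cod C a = Dom C u"
      "Cod C b = Dom C v" "u \<cdot> a = v \<cdot> b"
  obtains m where "m \<in> Arr C" "Dom C m = Dom C a" "Cod C m = Dom C p" "p \<cdot> m = a" "q \<cdot> m = b"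
    "\<And>x. x \<in> Arr C \<Longrightarrow> Cod C x = Dom C a \<Longrightarrow> p \<cdot> (m \<cdot> x) = a \<cdot> x"
    "\<And>x. x \<in> Arr C \<Longrightarrow> Cod C x = Dom C a \<Longrightarrow> q \<cdot> (m \<cdot> x) = b \<cdot> x"
proof -
  note D = is_pullbackD[OF assms(1)]
  have "a \<in> hom C (Dom C a) (Dom C u)" "b \<in> hom C (Dom C a) (Dom C v)"
    using assms by (auto simp: hom_def)
  then obtain m where "m \<in> hom C (Dom C a) (Dom C p) \<and> p \<cdot> m = a \<and> q \<cdot> m = b"
    using assms(1,7) unfolding is_pullback_def by blast
  then have m: "m \<in> Arr C" "Dom C m = Dom C a" "Cod C m = Dom C p" "p \<cdot> m = a" "q \<cdot> m = b"
    by (auto simp: hom_def)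
  show thesis
    by (rule that[OF m]) (use m D cmp_eq in auto)
qed

lemma is_pullback_eqI:
  assumes "is_pullback C u v p q"
    and "m \<in> Arr C" "m' \<in> Arr C" "Dom C m' = Dom C m" "Cod C m = Dom C p" "Cod C m' = Dom C p"
    and eq: "p \<cdot> m = p \<cdot> m'" "q \<cdot> m = q \<cdot> m'"
  shows "m = m'"
proof -
  note D = is_pullbackD[OF assms(1)]
  have 1: "p \<cdot> m \<in> hom C (Dom C m) (Dom C u)" "q \<cdot> m \<in> hom C (Dom C m) (Dom C v)"
    using assms D by (auto simp: hom_def)
  have 2: "u \<cdot> (p \<cdot> m) = v \<cdot> (q \<cdot> m)"
    using D assms(2-6) cmp_eq[OF D(9), of m] by simp
  have "\<exists>!n. n \<in> hom C (Dom C m) (Dom C p) \<and> p \<cdot> n = p \<cdot> m \<and> q \<cdot> n = q \<cdot> m"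
    using assms(1) 1 2 unfolding is_pullback_def by blast
  moreover have "m \<in> hom C (Dom C m) (Dom C p)" "m' \<in> hom C (Dom C m) (Dom C p)"
    using assms by (auto simp: hom_def)
  ultimately show ?thesis using eq by (metis (no_types, lifting))
qed

lemma is_pullback_sym:
  assumes "is_pullback C u v p q"
  shows "is_pullback C v u q p"
proof -
  note D = is_pullbackD[OF assms]
  show ?thesis
  proof (rule is_pullbackI)
    fix a b
    assume "a \<in> Arr C" "b \<in> Arr C" "Dom C b = Dom C a" "Cod C a = Dom C v" "Cod C b = Dom C u"
      "v \<cdot> a = u \<cdot> b"
    then show "\<exists>m. m \<in> Arr C \<and> Dom C m = Dom C a \<and> Cod C m = Dom C q \<and> q \<cdot> m = a \<and> p \<cdot> m = b"
      using is_pullback_map[OF assms, of b a] D(7) by metis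
  next
    fix m m'
    assume "m \<in> Arr C" "m' \<in> Arr C" "Dom C m' = Dom C m" "Cod C m = Dom C q" "Cod C m' = Dom C q"
      "q \<cdot> m' = q \<cdot> m" "p \<cdot> m' = p \<cdot> m"
    then show "m = m'"
      using is_pullback_eqI[OF assms, of m m'] D(7) by simp
  qed (use D in simp_all)
qed

end

context path_category
begin

lemma fib_arr [simp]: "h \<in> fib C \<Longrightarrow> h \<in> Arr C"
  using fib_Arr by blast

lemma weq_arr: "h \<in> weq C \<Longrightarrow> h \<in> Arr C"
  using weq_Arr by blast

lemma isomorphismI:
  "h \<in> Arr C \<Longrightarrow> k \<in> Arr C \<Longrightarrow> Dom C k = Cod C h \<Longrightarrow> Cod C k = Dom C h \<Longrightarrow>
    k \<cdot> h = Idn C (Dom C h) \<Longrightarrow> h \<cdot> k = Idn C (Cod C h) \<Longrightarrow> isomorphism C h"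
  unfolding isomorphism_def hom_def by auto

lemma idn_weq: "X \<in> Obj C \<Longrightarrow> Idn C X \<in> weq C"
  using iso_acyclic_fib isomorphismI[of "Idn C X" "Idn C X"] by auto

text \<open>Two cases of 2-out-of-3, obtained from 2-out-of-6 by inserting an identity.\<close>

lemma weq_cancel_left:
  assumes "k \<cdot> h \<in> weq C" "k \<in> weq C" "h \<in> Arr C" "Cod C h = Dom C k"
  shows "h \<in> weq C"
  using two_out_of_six[of h "Dom C h" "Cod C h" k "Cod C k" "Idn C (Cod C k)" "Cod C k"] assms
  by (simp add: hom_def weq_arr)

lemma weq_cancel_right:
  assumes "k \<cdot> h \<in> weq C" "h \<in> weq C" "k \<in> Arr C" "Cod C h = Dom C k"
  shows "k \<in> weq C"
  using two_out_of_six[of "Idn C (Dom C h)" "Dom C h" "Dom C h" h "Cod C h" k "Cod C k"] assms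
  by (simp add: hom_def weq_arr)

lemma section_weq:
  assumes "p \<in> weq C" "s \<in> Arr C" "Cod C s = Dom C p" "p \<cdot> s = Idn C (Cod C p)"
  shows "s \<in> weq C"
  using weq_cancel_left[of p s] idn_weq assms weq_arr by simp

end

locale cloven_path_category = path_category C
  for C :: "('o, 'a, 'z) cloven_cat_scheme" (structure) +
  assumes chosen: "chosen_pullbacks C"
begin

lemma pb_is_pullback:
  "u \<in> Arr C \<Longrightarrow> v \<in> fib C \<Longrightarrow> Cod C u = Cod C v \<Longrightarrow> is_pullback C u v (prl C u v) (prr C u v)"
  using chosen unfolding chosen_pullbacks_def by blast

declare pb_def [simp] pob_def [simp]

lemma pr_simps [simp]:
  assumes "u \<in> Arr C" "v \<in> fib C" "Cod C u = Cod C v"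
  shows "prl C u v \<in> Arr C" "Cod C (prl C u v) = Dom C u" "prr C u v \<in> Arr C"
    "Dom C (prr C u v) = Dom C (prl C u v)" "Cod C (prr C u v) = Dom C v"
    "v \<cdot> prr C u v = u \<cdot> prl C u v"
    "\<And>x. x \<in> Arr C \<Longrightarrow> Cod C x = Dom C (prl C u v) \<Longrightarrow> v \<cdot> (prr C u v \<cdot> x) = u \<cdot> (prl C u v \<cdot> x)"
proof -
  note D = is_pullbackD[OF pb_is_pullback[OF assms]]
  show "prl C u v \<in> Arr C" "Cod C (prl C u v) = Dom C u" "prr C u v \<in> Arr C"
    "Dom C (prr C u v) = Dom C (prl C u v)" "Cod C (prr C u v) = Dom C v"
    "v \<cdot> prr C u v = u \<cdot> prl C u v" by (rule D)+
  show "v \<cdot> (prr C u v \<cdot> x) = u \<cdot> (prl C u v \<cdot> x)"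
    if "x \<in> Arr C" "Cod C x = Dom C (prl C u v)" for x
    using cmp_eq[OF D(9), of x] that D by simp
qed

lemma pb_eqI:
  assumes "u \<in> Arr C" "v \<in> fib C" "Cod C u = Cod C v"
    and "m \<in> Arr C" "m' \<in> Arr C" "Dom C m' = Dom C m" "Cod C m = pb C u v" "Cod C m' = pb C u v"
    and "prl C u v \<cdot> m = prl C u v \<cdot> m'" "prr C u v \<cdot> m = prr C u v \<cdot> m'"
  shows "m = m'"
  using is_pullback_eqI[OF pb_is_pullback[OF assms(1-3)]] assms by simp

lemma pair_simps:
  assumes "u \<in> Arr C" "v \<in> fib C" "Cod C u = Cod C v"
    and "a \<in> Arr C" "b \<in> Arr C" "Dom C b = Dom C a" "Cod C a = Dom C u"
      "Cod C b = Dom C v" "u \<cdot> a = v \<cdot> b"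
  shows "pair C u v a b \<in> Arr C" "Dom C (pair C u v a b) = Dom C a"
    "Cod C (pair C u v a b) = Dom C (prl C u v)"
    "prl C u v \<cdot> pair C u v a b = a" "prr C u v \<cdot> pair C u v a b = b"
    "\<And>x. x \<in> Arr C \<Longrightarrow> Cod C x = Dom C a \<Longrightarrow> prl C u v \<cdot> (pair C u v a b \<cdot> x) = a \<cdot> x"
    "\<And>x. x \<in> Arr C \<Longrightarrow> Cod C x = Dom C a \<Longrightarrow> prr C u v \<cdot> (pair C u v a b \<cdot> x) = b \<cdot> x"
proof -
  let ?m = "pair C u v a b"
  have "\<exists>!m. m \<in> hom C (Dom C a) (Dom C (prl C u v)) \<and> prl C u v \<cdot> m = a \<and> prr C u v \<cdot> m = b"
  proof -
    have "a \<in> hom C (Dom C a) (Dom C u)" "b \<in> hom C (Dom C a) (Dom C v)"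
      using assms by (simp_all add: hom_def)
    then show ?thesis
      using pb_is_pullback[OF assms(1-3)] assms(9) unfolding is_pullback_def by blast
  qed
  from theI'[OF this] have "?m \<in> hom C (Dom C a) (Dom C (prl C u v)) \<and> prl C u v \<cdot> ?m = a \<and>
      prr C u v \<cdot> ?m = b"
    unfolding pair_def pb_def .
  then show *: "?m \<in> Arr C" "Dom C ?m = Dom C a" "Cod C ?m = Dom C (prl C u v)"
    "prl C u v \<cdot> ?m = a" "prr C u v \<cdot> ?m = b" by (auto simp: hom_def)
  show "prl C u v \<cdot> (?m \<cdot> x) = a \<cdot> x" "prr C u v \<cdot> (?m \<cdot> x) = b \<cdot> x"
    if "x \<in> Arr C" "Cod C x = Dom C a" for x
    using cmp_eq[OF *(4), of x] cmp_eq[OF *(5), of x] * that assms by simp_all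
qed

lemma pair_cmp:
  assumes "u \<in> Arr C" "v \<in> fib C" "Cod C u = Cod C v"
    and "a \<in> Arr C" "b \<in> Arr C" "Dom C b = Dom C a" "Cod C a = Dom C u"
      "Cod C b = Dom C v" "u \<cdot> a = v \<cdot> b" and "x \<in> Arr C" "Cod C x = Dom C a"
  shows "pair C u v a b \<cdot> x = pair C u v (a \<cdot> x) (b \<cdot> x)"
proof -
  note p = pair_simps[OF assms(1-9)]
  have eq: "u \<cdot> (a \<cdot> x) = v \<cdot> (b \<cdot> x)"
    using cmp_eq[OF assms(9), of x] assms by simp
  have q: "pair C u v (a \<cdot> x) (b \<cdot> x) \<in> Arr C" "Dom C (pair C u v (a \<cdot> x) (b \<cdot> x)) = Dom C x"
    "Cod C (pair C u v (a \<cdot> x) (b \<cdot> x)) = Dom C (prl C u v)"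
    "prl C u v \<cdot> pair C u v (a \<cdot> x) (b \<cdot> x) = a \<cdot> x" "prr C u v \<cdot> pair C u v (a \<cdot> x) (b \<cdot> x) = b \<cdot> x"
    using pair_simps[OF assms(1-3), of "a \<cdot> x" "b \<cdot> x"] eq assms by simp_all
  show ?thesis
    by (rule pb_eqI[OF assms(1-3)]) (use p q assms in simp_all)
qed

lemma pr_fib:
  assumes "u \<in> Arr C" "v \<in> fib C" "Cod C u = Cod C v"
  shows "prl C u v \<in> fib C" and "u \<in> fib C \<Longrightarrow> prr C u v \<in> fib C"
    and "v \<in> weq C \<Longrightarrow> prl C u v \<in> weq C"
    and "u \<in> fib C \<Longrightarrow> u \<in> weq C \<Longrightarrow> prr C u v \<in> weq C"
  using pb_is_pullback[OF assms] is_pullback_sym pullback_fib pullback_acyclic_fib assms by blast+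

section \<open>Factorization and path objects\<close>

lemma pb_map:
  assumes "u \<in> Arr C" "v \<in> fib C" "Cod C u = Cod C v"
    and "a \<in> Arr C" "b \<in> Arr C" "Dom C b = Dom C a" "Cod C a = Dom C u"
      "Cod C b = Dom C v" "u \<cdot> a = v \<cdot> b"
  obtains m where "m \<in> Arr C" "Dom C m = Dom C a" "Cod C m = Dom C (prl C u v)"
    "prl C u v \<cdot> m = a" "prr C u v \<cdot> m = b"
    "\<And>x. x \<in> Arr C \<Longrightarrow> Cod C x = Dom C a \<Longrightarrow> prl C u v \<cdot> (m \<cdot> x) = a \<cdot> x"
    "\<And>x. x \<in> Arr C \<Longrightarrow> Cod C x = Dom C a \<Longrightarrow> prr C u v \<cdot> (m \<cdot> x) = b \<cdot> x"
  using is_pullback_map[OF pb_is_pullback[OF assms(1-3)] assms(4-)] by metis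

lemma ends_simps:
  assumes "z \<in> fib C" "src P \<in> Arr C" "tgt P \<in> Arr C" "Dom C (tgt P) = Dom C (src P)"
    "Cod C (src P) = Dom C z" "Cod C (tgt P) = Dom C z" "z \<cdot> tgt P = z \<cdot> src P"
  shows "ends C z P \<in> Arr C" "Dom C (ends C z P) = Dom C (src P)" "Cod C (ends C z P) = Dom C (prl C z z)"
    "prl C z z \<cdot> ends C z P = src P" "prr C z z \<cdot> ends C z P = tgt P"
    "\<And>x. x \<in> Arr C \<Longrightarrow> Cod C x = Dom C (src P) \<Longrightarrow> prl C z z \<cdot> (ends C z P \<cdot> x) = src P \<cdot> x"
    "\<And>x. x \<in> Arr C \<Longrightarrow> Cod C x = Dom C (src P) \<Longrightarrow> prr C z z \<cdot> (ends C z P \<cdot> x) = tgt P \<cdot> x"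
  unfolding ends_def by (rule pair_simps; use assms in simp)+

lemma path_ob_simps:
  assumes "is_path_object C z P"
  shows "z \<in> fib C" "rfl P \<in> Arr C" "Dom C (rfl P) = Dom C z" "Cod C (rfl P) = Dom C (src P)"
    "src P \<in> Arr C" "Cod C (src P) = Dom C z" "tgt P \<in> Arr C" "Dom C (tgt P) = Dom C (src P)"
    "Cod C (tgt P) = Dom C z" "z \<cdot> tgt P = z \<cdot> src P"
    "src P \<cdot> rfl P = Idn C (Dom C z)" "tgt P \<cdot> rfl P = Idn C (Dom C z)"
    "ends C z P \<in> fib C" "Dom C (ends C z P) = Dom C (src P)"
    "Cod C (ends C z P) = Dom C (prl C z z)"
    "prl C z z \<cdot> ends C z P = src P" "prr C z z \<cdot> ends C z P = tgt P"
    "\<And>x. x \<in> Arr C \<Longrightarrow> Cod C x = Dom C (src P) \<Longrightarrow> z \<cdot> (tgt P \<cdot> x) = z \<cdot> (src P \<cdot> x)"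
    "\<And>x. x \<in> Arr C \<Longrightarrow> Cod C x = Dom C z \<Longrightarrow> src P \<cdot> (rfl P \<cdot> x) = x"
    "\<And>x. x \<in> Arr C \<Longrightarrow> Cod C x = Dom C z \<Longrightarrow> tgt P \<cdot> (rfl P \<cdot> x) = x"
    "\<And>x. x \<in> Arr C \<Longrightarrow> Cod C x = Dom C (src P) \<Longrightarrow> prl C z z \<cdot> (ends C z P \<cdot> x) = src P \<cdot> x"
    "\<And>x. x \<in> Arr C \<Longrightarrow> Cod C x = Dom C (src P) \<Longrightarrow> prr C z z \<cdot> (ends C z P \<cdot> x) = tgt P \<cdot> x"
proof -
  show *: "z \<in> fib C" "rfl P \<in> Arr C" "Dom C (rfl P) = Dom C z" "Cod C (rfl P) = Dom C (src P)"
    "src P \<in> Arr C" "Cod C (src P) = Dom C z" "tgt P \<in> Arr C" "Dom C (tgt P) = Dom C (src P)"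
    "Cod C (tgt P) = Dom C z" "z \<cdot> tgt P = z \<cdot> src P"
    "src P \<cdot> rfl P = Idn C (Dom C z)" "tgt P \<cdot> rfl P = Idn C (Dom C z)"
    "ends C z P \<in> fib C"
    using assms unfolding is_path_object_def hom_def by auto
  note e = ends_simps[OF *(1,5,7,8,6,9,10)]
  show "Dom C (ends C z P) = Dom C (src P)" "Cod C (ends C z P) = Dom C (prl C z z)"
    "prl C z z \<cdot> ends C z P = src P" "prr C z z \<cdot> ends C z P = tgt P"
    "\<And>x. x \<in> Arr C \<Longrightarrow> Cod C x = Dom C (src P) \<Longrightarrow> prl C z z \<cdot> (ends C z P \<cdot> x) = src P \<cdot> x"
    "\<And>x. x \<in> Arr C \<Longrightarrow> Cod C x = Dom C (src P) \<Longrightarrow> prr C z z \<cdot> (ends C z P \<cdot> x) = tgt P \<cdot> x"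
    by (fact e)+
  fix x assume x: "x \<in> Arr C"
  show "Cod C x = Dom C (src P) \<Longrightarrow> z \<cdot> (tgt P \<cdot> x) = z \<cdot> (src P \<cdot> x)"
    using cmp_eq[OF *(10), of x] * x by simp
  show "Cod C x = Dom C z \<Longrightarrow> src P \<cdot> (rfl P \<cdot> x) = x"
    using cmp_eq[OF *(11), of x] * x by simp
  show "Cod C x = Dom C z \<Longrightarrow> tgt P \<cdot> (rfl P \<cdot> x) = x"
    using cmp_eq[OF *(12), of x] * x by simp
qed

lemma path_ob_rfl_weq: "is_path_object C z P \<Longrightarrow> rfl P \<in> weq C"
  unfolding is_path_object_def by simp

lemma path_ob_acyclic:
  assumes P: "is_path_object C z P"
  shows "src P \<in> fib C" "src P \<in> weq C" "tgt P \<in> fib C" "tgt P \<in> weq C"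
proof -
  note [simp] = path_ob_simps[OF P]
  show "src P \<in> fib C"
    using fib_Cmp[of "ends C z P" "prl C z z"] pr_fib(1)[of z z] by simp
  show "tgt P \<in> fib C"
    using fib_Cmp[of "ends C z P" "prr C z z"] pr_fib(2)[of z z] by simp
  show "src P \<in> weq C" "tgt P \<in> weq C"
    using weq_cancel_right[of "src P" "rfl P"] weq_cancel_right[of "tgt P" "rfl P"]
      path_ob_rfl_weq[OF P] idn_weq by simp_all
qed

lemma is_path_objectI:
  assumes z: "z \<in> fib C" and N: "N \<in> fib C" "Cod C N = pb C z z"
    and r: "r \<in> weq C" "Dom C r = Dom C z" "Cod C r = Dom C N"
    and eq: "prl C z z \<cdot> (N \<cdot> r) = Idn C (Dom C z)" "prr C z z \<cdot> (N \<cdot> r) = Idn C (Dom C z)"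
    and P: "P = \<lparr> rfl = r, src = prl C z z \<cdot> N, tgt = prr C z z \<cdot> N \<rparr>"
  shows "ends C z P = N" and "is_path_object C z P"
proof -
  have [simp]: "r \<in> Arr C" by (rule weq_arr[OF r(1)])
  note [simp] = z N r eq
  have P': "rfl P = r" "src P = prl C z z \<cdot> N" "tgt P = prr C z z \<cdot> N"
    using P by simp_all
  have zz: "z \<cdot> tgt P = z \<cdot> src P" by (simp add: P')
  note e = ends_simps[of z P, OF z]
  show *: "ends C z P = N"
    by (rule pb_eqI[of z z]) (use zz in \<open>simp_all add: e P'\<close>)
  show "is_path_object C z P"
    unfolding is_path_object_def * using zz by (simp add: P' hom_def)
qed

text \<open>The axiom on path objects concerns the fibrations to the terminal object only, and there it
  speaks of an arbitrary product, which is isomorphic to the chosen pullback over the terminal object.\<close>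

lemma terminal_path_objects:
  obtains T where "\<And>X. X \<in> Obj C \<Longrightarrow> \<exists>t P. t \<in> fib C \<and> Dom C t = X \<and> Cod C t = T \<and> is_path_object C t P"
    and "\<And>h k. h \<in> Arr C \<Longrightarrow> k \<in> Arr C \<Longrightarrow> Dom C h = Dom C k \<Longrightarrow> Cod C h = T \<Longrightarrow> Cod C k = T \<Longrightarrow> h = k"
proof -
  obtain T where T: "terminal C T" and Tfib: "\<And>h. h \<in> Arr C \<Longrightarrow> Cod C h = T \<Longrightarrow> h \<in> fib C"
    using terminal_fib by blast
  have un: "h = k" if "h \<in> Arr C" "k \<in> Arr C" "Dom C h = Dom C k" "Cod C h = T" "Cod C k = T" for h k
  proof -
    have "\<exists>!h'. h' \<in> hom C (Dom C k) T"
      using T that unfolding terminal_def by simp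
    moreover have "h \<in> hom C (Dom C k) T" "k \<in> hom C (Dom C k) T"
      using that by (simp_all add: hom_def)
    ultimately show ?thesis by blast
  qed
  have "\<exists>t P. t \<in> fib C \<and> Dom C t = X \<and> Cod C t = T \<and> is_path_object C t P" if X: "X \<in> Obj C" for X
  proof -
    obtain t where "t \<in> hom C X T" using T X unfolding terminal_def by blast
    then have t [simp]: "t \<in> fib C" "Dom C t = X" "Cod C t = T"
      using Tfib by (auto simp: hom_def)
    obtain p q r d where prod: "is_product C X X p q"
      and r: "r \<in> weq C" "Dom C r = X"
      and d: "d \<in> fib C" "d \<in> hom C (Cod C r) (Dom C p)"
      and eq: "p \<cdot> (d \<cdot> r) = Idn C X" "q \<cdot> (d \<cdot> r) = Idn C X"
      using path_object_exists[OF X] by blast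
    have [simp]: "p \<in> Arr C" "Cod C p = X" "q \<in> Arr C" "Dom C q = Dom C p" "Cod C q = X"
      using prod unfolding is_product_def hom_def by auto
    have [simp]: "r \<in> Arr C" "Dom C r = X" "d \<in> fib C" "Dom C d = Cod C r" "Cod C d = Dom C p"
      using r d weq_arr by (auto simp: hom_def)
    obtain th where [simp]: "th \<in> Arr C" "Dom C th = Dom C p" "Cod C th = Dom C (prl C t t)"
      "prl C t t \<cdot> th = p" "prr C t t \<cdot> th = q"
      "\<And>x. x \<in> Arr C \<Longrightarrow> Cod C x = Dom C p \<Longrightarrow> prl C t t \<cdot> (th \<cdot> x) = p \<cdot> x"
      "\<And>x. x \<in> Arr C \<Longrightarrow> Cod C x = Dom C p \<Longrightarrow> prr C t t \<cdot> (th \<cdot> x) = q \<cdot> x"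
      by (rule pb_map[of t t p q]) (auto intro: un)
    have uni: "\<exists>!m. m \<in> hom C W (Dom C p) \<and> p \<cdot> m = a \<and> q \<cdot> m = b"
      if "a \<in> hom C W X" "b \<in> hom C W X" for W a b
      using prod that unfolding is_product_def by blast
    have "\<exists>!m. m \<in> hom C (Dom C (prl C t t)) (Dom C p) \<and> p \<cdot> m = prl C t t \<and> q \<cdot> m = prr C t t"
      by (rule uni) (simp_all add: hom_def)
    then obtain m where [simp]: "m \<in> Arr C" "Dom C m = Dom C (prl C t t)" "Cod C m = Dom C p"
      and m: "p \<cdot> m = prl C t t" "q \<cdot> m = prr C t t"
      by (auto simp: hom_def)
    have mx [simp]: "p \<cdot> (m \<cdot> x) = prl C t t \<cdot> x" "q \<cdot> (m \<cdot> x) = prr C t t \<cdot> x"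
      if "x \<in> Arr C" "Cod C x = Dom C (prl C t t)" for x
      using cmp_eq[OF m(1), of x] cmp_eq[OF m(2), of x] that by simp_all
    have 1: "th \<cdot> m = Idn C (Dom C (prl C t t))"
      by (rule pb_eqI[of t t]) (simp_all add: m)
    have "\<exists>!n. n \<in> hom C (Dom C p) (Dom C p) \<and> p \<cdot> n = p \<and> q \<cdot> n = q"
      by (rule uni) (simp_all add: hom_def)
    moreover have "m \<cdot> th \<in> hom C (Dom C p) (Dom C p) \<and> p \<cdot> (m \<cdot> th) = p \<and> q \<cdot> (m \<cdot> th) = q"
      by (simp add: hom_def)
    moreover have "Idn C (Dom C p) \<in> hom C (Dom C p) (Dom C p) \<and> p \<cdot> Idn C (Dom C p) = p \<and>
        q \<cdot> Idn C (Dom C p) = q"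
      by (simp add: hom_def)
    ultimately have 2: "m \<cdot> th = Idn C (Dom C p)" by blast
    have "isomorphism C th"
      by (rule isomorphismI[of th m]) (simp_all add: 1 2)
    then have "th \<in> fib C" using iso_acyclic_fib by blast
    then have "th \<cdot> d \<in> fib C" using fib_Cmp[of d th] by simp
    then have "is_path_object C t \<lparr> rfl = r, src = prl C t t \<cdot> (th \<cdot> d), tgt = prr C t t \<cdot> (th \<cdot> d) \<rparr>"
      by (intro is_path_objectI(2)[of t "th \<cdot> d" r]) (use r eq in simp_all)
    then show ?thesis using t by blast
  qed
  then show thesis using that un by blast
qed

text \<open>The mapping path object \<open>A \<times>\<^sub>B PB\<close> of \<open>h\<close>: its projection to \<open>A\<close> is an acyclic fibration with
  the constant paths as a section, and evaluation at the end point is a fibration since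
  \<open>A \<times>\<^sub>B PB \<rightarrow> A \<times> B\<close> is a pullback of \<open>PB \<rightarrow> B \<times> B\<close>.\<close>

lemma factorization:
  assumes h: "h \<in> Arr C"
  obtains w m where "w \<in> weq C" "m \<in> fib C" "Dom C w = Dom C h" "Cod C w = Dom C m"
    "Cod C m = Cod C h" "m \<cdot> w = h"
proof -
  note [simp] = h
  obtain T where T: "\<And>X. X \<in> Obj C \<Longrightarrow> \<exists>t P. t \<in> fib C \<and> Dom C t = X \<and> Cod C t = T \<and> is_path_object C t P"
    and un: "\<And>h k. h \<in> Arr C \<Longrightarrow> k \<in> Arr C \<Longrightarrow> Dom C h = Dom C k \<Longrightarrow> Cod C h = T \<Longrightarrow> Cod C k = T \<Longrightarrow> h = k"
    using terminal_path_objects by blast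
  obtain a where [simp]: "a \<in> fib C" "Dom C a = Dom C h" "Cod C a = T"
    using T[of "Dom C h"] by auto
  obtain b P where [simp]: "b \<in> fib C" "Dom C b = Cod C h" "Cod C b = T"
    and P: "is_path_object C b P"
    using T[of "Cod C h"] by auto
  note [simp] = path_ob_simps(2-)[OF P] path_ob_acyclic[OF P]
  let ?pl = "prl C h (src P)" and ?pr = "prr C h (src P)"
  obtain w where w [simp]: "w \<in> Arr C" "Dom C w = Dom C h" "Cod C w = Dom C ?pl"
    "?pl \<cdot> w = Idn C (Dom C h)" "?pr \<cdot> w = rfl P \<cdot> h"
    by (rule pb_map[of h "src P" "Idn C (Dom C h)" "rfl P \<cdot> h"]) auto
  have "w \<in> weq C"
    using section_weq[of ?pl w] pr_fib(3)[of h "src P"] by simp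
  have ab: "b \<cdot> h = a" by (rule un) simp_all
  obtain e where [simp]: "e \<in> Arr C" "Dom C e = Dom C ?pl" "Cod C e = Dom C (prl C a b)"
    "prl C a b \<cdot> e = ?pl" "prr C a b \<cdot> e = tgt P \<cdot> ?pr"
    "\<And>x. x \<in> Arr C \<Longrightarrow> Cod C x = Dom C ?pl \<Longrightarrow> prl C a b \<cdot> (e \<cdot> x) = ?pl \<cdot> x"
    "\<And>x. x \<in> Arr C \<Longrightarrow> Cod C x = Dom C ?pl \<Longrightarrow> prr C a b \<cdot> (e \<cdot> x) = (tgt P \<cdot> ?pr) \<cdot> x"
    by (rule pb_map[of a b "?pl" "tgt P \<cdot> ?pr"]) (auto intro: un)
  obtain j where [simp]: "j \<in> Arr C" "Dom C j = Dom C (prl C a b)" "Cod C j = Dom C (prl C b b)"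
    "prl C b b \<cdot> j = h \<cdot> prl C a b" "prr C b b \<cdot> j = prr C a b"
    "\<And>x. x \<in> Arr C \<Longrightarrow> Cod C x = Dom C (prl C a b) \<Longrightarrow> prl C b b \<cdot> (j \<cdot> x) = (h \<cdot> prl C a b) \<cdot> x"
    "\<And>x. x \<in> Arr C \<Longrightarrow> Cod C x = Dom C (prl C a b) \<Longrightarrow> prr C b b \<cdot> (j \<cdot> x) = prr C a b \<cdot> x"
    by (rule pb_map[of b b "h \<cdot> prl C a b" "prr C a b"]) (auto intro: un)
  have "is_pullback C j (ends C b P) e ?pr"
  proof (rule is_pullbackI)
    show "j \<cdot> e = ends C b P \<cdot> ?pr"
      by (rule pb_eqI[of b b]) simp_all
  next
    fix c d
    assume cd: "c \<in> Arr C" "d \<in> Arr C" "Dom C d = Dom C c" "Cod C c = Dom C j"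
      "Cod C d = Dom C (ends C b P)" and eq: "j \<cdot> c = ends C b P \<cdot> d"
    note [simp] = cd
    have "prl C b b \<cdot> (j \<cdot> c) = prl C b b \<cdot> (ends C b P \<cdot> d)" using eq by simp
    then have 1: "h \<cdot> (prl C a b \<cdot> c) = src P \<cdot> d" by simp
    have "prr C b b \<cdot> (j \<cdot> c) = prr C b b \<cdot> (ends C b P \<cdot> d)" using eq by simp
    then have 2: "prr C a b \<cdot> c = tgt P \<cdot> d" by simp
    obtain m where [simp]: "m \<in> Arr C" "Dom C m = Dom C c" "Cod C m = Dom C ?pl"
      "?pl \<cdot> m = prl C a b \<cdot> c" "?pr \<cdot> m = d"
      by (rule pb_map[of h "src P" "prl C a b \<cdot> c" d]) (auto simp: 1)
    have "e \<cdot> m = c"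
      by (rule pb_eqI[of a b]) (simp_all add: 2)
    then show "\<exists>m. m \<in> Arr C \<and> Dom C m = Dom C c \<and> Cod C m = Dom C e \<and> e \<cdot> m = c \<and> ?pr \<cdot> m = d"
      by (intro exI[of _ m]) simp
  next
    fix m m'
    assume m: "m \<in> Arr C" "m' \<in> Arr C" "Dom C m' = Dom C m" "Cod C m = Dom C e" "Cod C m' = Dom C e"
      and eq: "e \<cdot> m' = e \<cdot> m" "?pr \<cdot> m' = ?pr \<cdot> m"
    have "prl C a b \<cdot> (e \<cdot> m) = prl C a b \<cdot> (e \<cdot> m')" using eq by simp
    then have 1: "?pl \<cdot> m = ?pl \<cdot> m'" using m by simp
    show "m = m'"
      by (rule pb_eqI[of h "src P"]) (use m eq 1 in simp_all)
  qed simp_all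
  then have "e \<in> fib C" by (rule pullback_fib) simp
  then have "prr C a b \<cdot> e \<in> fib C"
    using fib_Cmp[of e "prr C a b"] pr_fib(2)[of a b] by simp
  then have "tgt P \<cdot> ?pr \<in> fib C" by simp
  with \<open>w \<in> weq C\<close> show thesis
    by (rule that) simp_all
qed

lemma path_object_ex:
  assumes z: "z \<in> fib C"
  obtains P where "is_path_object C z P"
proof -
  note [simp] = z
  obtain d where [simp]: "d \<in> Arr C" "Dom C d = Dom C z" "Cod C d = Dom C (prl C z z)"
    "prl C z z \<cdot> d = Idn C (Dom C z)" "prr C z z \<cdot> d = Idn C (Dom C z)"
    by (rule pb_map[of z z "Idn C (Dom C z)" "Idn C (Dom C z)"]) auto
  obtain r N where "r \<in> weq C" "N \<in> fib C" "Dom C r = Dom C z" "Cod C r = Dom C N"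
    "Cod C N = Dom C (prl C z z)" "N \<cdot> r = d"
    using factorization[of d] by (metis \<open>d \<in> Arr C\<close> \<open>Dom C d = Dom C z\<close> \<open>Cod C d = Dom C (prl C z z)\<close>)
  then show thesis
    by (intro that[of "\<lparr> rfl = r, src = prl C z z \<cdot> N, tgt = prr C z z \<cdot> N \<rparr>"]
        is_path_objectI(2)[of z N r]) simp_all
qed

text \<open>Pull \<open>p\<close> back along \<open>k\<close> and replace the induced map by a weak equivalence followed by a
  fibration; the composite fibration over \<open>Cod l\<close> is acyclic by 2-out-of-3 and its section is the filler.\<close>

lemma filler_factor:
  assumes l: "l \<in> weq C" and p: "p \<in> fib C" and ak: "a \<in> Arr C" "k \<in> Arr C" "Dom C a = Dom C l"
    "Dom C k = Cod C l" "Cod C a = Dom C p" "Cod C k = Cod C p" "p \<cdot> a = k \<cdot> l"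
  obtains n v e where "n \<in> Arr C" "v \<in> Arr C" "Dom C n = Cod C v" "Cod C n = Dom C p" "Dom C v = Dom C l"
    "n \<cdot> v = a" "e \<in> fib C" "e \<in> weq C" "Dom C e = Cod C v" "Cod C e = Cod C l" "e \<cdot> v = l"
      "k \<cdot> e = p \<cdot> n"
proof -
  have [simp]: "l \<in> Arr C" by (rule weq_arr[OF l])
  note [simp] = p ak
  let ?pl = "prl C k p" and ?pr = "prr C k p"
  obtain m where m [simp]: "m \<in> Arr C" "Dom C m = Dom C l" "Cod C m = Dom C ?pl" "?pl \<cdot> m = l"
    "?pr \<cdot> m = a"
    by (rule pb_map[of k p l a]) auto
  obtain v n where v: "v \<in> weq C" and [simp]: "n \<in> fib C" "Dom C v = Dom C m" "Cod C v = Dom C n"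
    "Cod C n = Cod C m" and nv: "n \<cdot> v = m"
    using factorization[OF m(1)] by blast
  have [simp]: "v \<in> Arr C" by (rule weq_arr[OF v])
  have e: "?pl \<cdot> n \<in> fib C" using fib_Cmp[of n ?pl] pr_fib(1)[of k p] by simp
  have ev: "(?pl \<cdot> n) \<cdot> v = l" by (simp add: nv)
  have e': "?pl \<cdot> n \<in> weq C"
    by (rule weq_cancel_right[of _ v]) (use ev l v in simp_all)
  show thesis
    by (rule that[of "?pr \<cdot> n" v "?pl \<cdot> n", OF _ _ _ _ _ _ e e' _ _ ev]) (simp_all add: nv)
qed

lemma weak_filler:
  assumes "l \<in> weq C" "p \<in> fib C" "a \<in> Arr C" "k \<in> Arr C" "Dom C a = Dom C l"
    "Dom C k = Cod C l" "Cod C a = Dom C p" "Cod C k = Cod C p" "p \<cdot> a = k \<cdot> l"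
  obtains d where "d \<in> Arr C" "Dom C d = Cod C l" "Cod C d = Dom C p" "p \<cdot> d = k"
proof -
  obtain n v e where *: "n \<in> Arr C" "v \<in> Arr C" "Dom C n = Cod C v" "Cod C n = Dom C p"
    "e \<in> fib C" "e \<in> weq C" "Dom C e = Cod C v" "Cod C e = Cod C l" and eq: "k \<cdot> e = p \<cdot> n"
    using filler_factor[OF assms] by metis
  obtain s where s: "s \<in> Arr C" "Dom C s = Cod C e" "Cod C s = Dom C e" and es: "e \<cdot> s = Idn C (Cod C e)"
    using acyclic_fib_section[of e] * by (auto simp: hom_def)
  have "p \<cdot> (n \<cdot> s) = k"
    using cmp_eq[OF eq[symmetric], of s] * s es assms by simp
  then show thesis
    by (intro that[of "n \<cdot> s"]) (use * s in simp_all)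
qed

section \<open>Fibrewise homotopy and path induction\<close>

lemma ends_eqI:
  assumes "is_path_object C z P" "H \<in> Arr C" "K \<in> Arr C" "Dom C K = Dom C H" "Cod C H = pob C P"
    "Cod C K = pob C P" "src P \<cdot> H = src P \<cdot> K" "tgt P \<cdot> H = tgt P \<cdot> K"
  shows "ends C z P \<cdot> H = ends C z P \<cdot> K"
proof -
  note [simp] = path_ob_simps[OF assms(1)] assms(2-)
  show ?thesis by (rule pb_eqI[of z z]) simp_all
qed

lemma ends_eqD:
  assumes "is_path_object C z P" "H \<in> Arr C" "K \<in> Arr C" "Cod C H = pob C P"
    "Cod C K = pob C P" "ends C z P \<cdot> H = ends C z P \<cdot> K"
  shows "src P \<cdot> H = src P \<cdot> K" "tgt P \<cdot> H = tgt P \<cdot> K"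
proof -
  note [simp] = path_ob_simps[OF assms(1)] assms(2-5)
  have "prl C z z \<cdot> (ends C z P \<cdot> H) = prl C z z \<cdot> (ends C z P \<cdot> K)"
    "prr C z z \<cdot> (ends C z P \<cdot> H) = prr C z z \<cdot> (ends C z P \<cdot> K)" by (simp_all only: assms(6))
  then show "src P \<cdot> H = src P \<cdot> K" "tgt P \<cdot> H = tgt P \<cdot> K" by simp_all
qed

lemma homotopicI:
  assumes P: "is_path_object C z P" and "H \<in> Arr C" "Cod C H = pob C P" "src P \<cdot> H = h" "tgt P \<cdot> H = k"
  shows "homotopic C z h k"
proof -
  note [simp] = path_ob_simps[OF P] assms(2,3) assms(4,5)[symmetric]
  show ?thesis
    unfolding homotopic_def
    by (intro conjI exI[of _ P] bexI[of _ H]) (use P in \<open>simp_all add: hom_def\<close>)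
qed

lemma homotopicD:
  assumes "homotopic C z h k"
  shows "z \<in> fib C" "h \<in> Arr C" "k \<in> Arr C" "Dom C k = Dom C h" "Cod C h = Dom C z" "Cod C k = Dom C z"
    "z \<cdot> k = z \<cdot> h"
  using assms path_ob_simps(1) unfolding homotopic_def hom_def by auto

lemma homotopic_endsD:
  assumes "homotopic C (ends C z P) H K" "is_path_object C z P"
  shows "H \<in> Arr C" "K \<in> Arr C" "Dom C K = Dom C H" "Cod C H = pob C P" "Cod C K = pob C P"
    "src P \<cdot> K = src P \<cdot> H" "tgt P \<cdot> K = tgt P \<cdot> H"
proof -
  note [simp] = path_ob_simps[OF assms(2)]
  note D = homotopicD[OF assms(1)]
  show "H \<in> Arr C" "K \<in> Arr C" "Dom C K = Dom C H" "Cod C H = pob C P" "Cod C K = pob C P"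
    using D by simp_all
  show "src P \<cdot> K = src P \<cdot> H" "tgt P \<cdot> K = tgt P \<cdot> H"
    using ends_eqD[OF assms(2), of K H] D by simp_all
qed

text \<open>A path between \<open>f0\<close> and \<open>f1\<close> whose restriction along \<open>l\<close> is \<open>H\<close> is a diagonal of this square.\<close>

lemma ends_square:
  assumes l: "l \<in> Arr C" and P: "is_path_object C z P"
    and f: "f0 \<in> Arr C" "f1 \<in> Arr C" "Dom C f0 = Cod C l" "Dom C f1 = Cod C l"
      "Cod C f0 = Dom C z" "Cod C f1 = Dom C z" "z \<cdot> f0 = z \<cdot> f1"
    and H: "H \<in> Arr C" "Dom C H = Dom C l" "Cod C H = pob C P" "src P \<cdot> H = f0 \<cdot> l" "tgt P \<cdot> H = f1 \<cdot> l"
  obtains m where "m \<in> Arr C" "Dom C m = Cod C l" "Cod C m = Cod C (ends C z P)" "ends C z P \<cdot> H = m \<cdot> l"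
    "\<And>w. w \<in> Arr C \<Longrightarrow> Cod C w = Dom C (ends C z P) \<Longrightarrow> ends C z P \<cdot> w = m \<Longrightarrow> src P \<cdot> w = f0 \<and> tgt P \<cdot> w = f1"
proof -
  note [simp] = l path_ob_simps[OF P] f(1-6) H
  obtain m where m [simp]: "m \<in> Arr C" "Dom C m = Cod C l" "Cod C m = Dom C (prl C z z)"
    "prl C z z \<cdot> m = f0" "prr C z z \<cdot> m = f1"
    "\<And>x. x \<in> Arr C \<Longrightarrow> Cod C x = Cod C l \<Longrightarrow> prl C z z \<cdot> (m \<cdot> x) = f0 \<cdot> x"
    "\<And>x. x \<in> Arr C \<Longrightarrow> Cod C x = Cod C l \<Longrightarrow> prr C z z \<cdot> (m \<cdot> x) = f1 \<cdot> x"
    by (rule pb_map[of z z f0 f1]) (use f in auto)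
  have 1: "ends C z P \<cdot> H = m \<cdot> l"
    by (rule pb_eqI[of z z]) simp_all
  have 2: "src P \<cdot> w = f0 \<and> tgt P \<cdot> w = f1"
    if "w \<in> Arr C" "Cod C w = Dom C (ends C z P)" and w: "ends C z P \<cdot> w = m" for w
  proof -
    have "prl C z z \<cdot> (ends C z P \<cdot> w) = f0" "prr C z z \<cdot> (ends C z P \<cdot> w) = f1"
      by (simp_all only: w m)
    then show ?thesis using that(1,2) by simp
  qed
  show thesis by (rule that[of m]) (use 1 2 in simp_all)
qed

text \<open>A first form of path induction. The path object is fixed beforehand because the lemma serves to
  derive that homotopy does not depend on the path object.\<close>

lemma path_extension_weak:
  assumes l: "l \<in> weq C" and P: "is_path_object C z P"
    and f: "f0 \<in> Arr C" "f1 \<in> Arr C" "Dom C f0 = Cod C l" "Dom C f1 = Cod C l"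
      "Cod C f0 = Dom C z" "Cod C f1 = Dom C z" "z \<cdot> f0 = z \<cdot> f1"
    and H: "H \<in> Arr C" "Dom C H = Dom C l" "Cod C H = pob C P" "src P \<cdot> H = f0 \<cdot> l" "tgt P \<cdot> H = f1 \<cdot> l"
  obtains w where "w \<in> Arr C" "Dom C w = Cod C l" "Cod C w = pob C P" "src P \<cdot> w = f0" "tgt P \<cdot> w = f1"
proof -
  obtain m where m: "m \<in> Arr C" "Dom C m = Cod C l" "Cod C m = Cod C (ends C z P)"
    "ends C z P \<cdot> H = m \<cdot> l"
    "\<And>w. w \<in> Arr C \<Longrightarrow> Cod C w = Dom C (ends C z P) \<Longrightarrow> ends C z P \<cdot> w = m \<Longrightarrow> src P \<cdot> w = f0 \<and> tgt P \<cdot> w = f1"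
    using ends_square[OF weq_arr[OF l] P f H] by metis
  obtain w where w: "w \<in> Arr C" "Dom C w = Cod C l" "Cod C w = Dom C (ends C z P)" "ends C z P \<cdot> w = m"
    by (rule weak_filler[OF l _ H(1) m(1), of "ends C z P"]) (use m path_ob_simps[OF P] H in simp_all)
  show thesis
    by (rule that[of w]) (use w m(5)[OF w(1,3,4)] path_ob_simps[OF P] in simp_all)
qed

lemma homotopicE:
  assumes hk: "homotopic C z h k" and P: "is_path_object C z P"
  obtains H where "H \<in> Arr C" "Dom C H = Dom C h" "Cod C H = pob C P" "src P \<cdot> H = h" "tgt P \<cdot> H = k"
proof -
  obtain P' H' where P': "is_path_object C z P'" and H': "H' \<in> Arr C" "Dom C H' = Dom C h"
    "Cod C H' = pob C P'" "src P' \<cdot> H' = h" "tgt P' \<cdot> H' = k"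
    using hk unfolding homotopic_def hom_def by auto
  note [simp] = path_ob_simps[OF P] path_ob_simps(2-)[OF P'] H'
  obtain w where [simp]: "w \<in> Arr C" "Dom C w = pob C P'" "Cod C w = pob C P" and w: "src P \<cdot> w = src P'"
    "tgt P \<cdot> w = tgt P'"
    by (rule path_extension_weak[OF path_ob_rfl_weq[OF P'] P, of "src P'" "tgt P'" "rfl P"]) auto
  show thesis
    by (rule that[of "w \<cdot> H'"]) (simp_all add: cmp_eq[OF w(1)] cmp_eq[OF w(2)])
qed

lemma homotopic_extension:
  assumes l: "l \<in> weq C"
    and f: "f0 \<in> Arr C" "f1 \<in> Arr C" "Dom C f0 = Cod C l" "Dom C f1 = Cod C l"
      "Cod C f0 = Dom C z" "Cod C f1 = Dom C z" "z \<cdot> f0 = z \<cdot> f1"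
    and h: "homotopic C z (f0 \<cdot> l) (f1 \<cdot> l)"
  shows "homotopic C z f0 f1"
proof -
  obtain P where P: "is_path_object C z P" using path_object_ex homotopicD[OF h] by blast
  obtain H where "H \<in> Arr C" "Dom C H = Dom C (f0 \<cdot> l)" "Cod C H = pob C P" "src P \<cdot> H = f0 \<cdot> l"
    "tgt P \<cdot> H = f1 \<cdot> l"
    using homotopicE[OF h P] by metis
  then obtain w where "w \<in> Arr C" "Cod C w = pob C P" "src P \<cdot> w = f0" "tgt P \<cdot> w = f1"
    using path_extension_weak[OF l P f, of H] weq_arr[OF l] f by auto
  then show ?thesis using homotopicI[OF P] by blast
qed

lemma homotopic_refl:
  assumes "z \<in> fib C" "h \<in> Arr C" "Cod C h = Dom C z"
  shows "homotopic C z h h"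
proof -
  obtain P where P: "is_path_object C z P" using path_object_ex assms by blast
  show ?thesis
    by (rule homotopicI[OF P, of "rfl P \<cdot> h"]) (use path_ob_simps[OF P] assms in simp_all)
qed

lemma homotopic_sym:
  assumes hk: "homotopic C z h k"
  shows "homotopic C z k h"
proof -
  obtain P where P: "is_path_object C z P" using path_object_ex homotopicD[OF hk] by blast
  note [simp] = path_ob_simps[OF P]
  obtain H where [simp]: "H \<in> Arr C" "Dom C H = Dom C h" "Cod C H = pob C P" "src P \<cdot> H = h"
    "tgt P \<cdot> H = k"
    using homotopicE[OF hk P] by metis
  obtain w where [simp]: "w \<in> Arr C" "Dom C w = pob C P" "Cod C w = pob C P" and w: "src P \<cdot> w = tgt P"
    "tgt P \<cdot> w = src P"
    by (rule path_extension_weak[OF path_ob_rfl_weq[OF P] P, of "tgt P" "src P" "rfl P"]) auto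
  show ?thesis
    by (rule homotopicI[OF P, of "w \<cdot> H"]) (simp_all add: cmp_eq[OF w(1)] cmp_eq[OF w(2)])
qed

text \<open>The first projection from the composable pairs of paths is an acyclic fibration, so whatever concerns
  a pair can be tested on a section of it, in practice on pairs with a constant second path.\<close>

lemma composable_section_weq:
  assumes P: "is_path_object C z P" and R: "is_path_object C y R" and zy: "Dom C z = Dom C y"
    and l: "l \<in> Arr C" "Dom C l = pob C P" "Cod C l = pb C (tgt P) (src R)"
      "prl C (tgt P) (src R) \<cdot> l = Idn C (pob C P)"
  shows "l \<in> weq C"
proof -
  note [simp] = path_ob_simps[OF P] path_ob_simps[OF R] path_ob_acyclic[OF P] path_ob_acyclic[OF R] zy l
  show ?thesis
    by (rule section_weq[of "prl C (tgt P) (src R)"]) (simp_all add: pr_fib)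
qed

lemma homotopic_trans [trans]:
  assumes hk: "homotopic C z h k" and kl: "homotopic C z k l"
  shows "homotopic C z h l"
proof -
  obtain P where P: "is_path_object C z P" using path_object_ex homotopicD[OF hk] by blast
  note [simp] = path_ob_simps[OF P] path_ob_acyclic[OF P]
  obtain H where [simp]: "H \<in> Arr C" "Dom C H = Dom C h" "Cod C H = pob C P" "src P \<cdot> H = h"
    "tgt P \<cdot> H = k"
    using homotopicE[OF hk P] by metis
  obtain K where [simp]: "K \<in> Arr C" "Dom C K = Dom C k" "Cod C K = pob C P" "src P \<cdot> K = k"
    "tgt P \<cdot> K = l"
    using homotopicE[OF kl P] by metis
  have [simp]: "Dom C k = Dom C h" using homotopicD[OF hk] by simp
  let ?pl = "prl C (tgt P) (src P)" and ?pr = "prr C (tgt P) (src P)"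
  obtain n where n [simp]: "n \<in> Arr C" "Dom C n = pob C P" "Cod C n = Dom C ?pl"
    "?pl \<cdot> n = Idn C (pob C P)" "?pr \<cdot> n = rfl P \<cdot> tgt P"
    "\<And>x. x \<in> Arr C \<Longrightarrow> Cod C x = Dom C (src P) \<Longrightarrow> ?pl \<cdot> (n \<cdot> x) = Idn C (pob C P) \<cdot> x"
    "\<And>x. x \<in> Arr C \<Longrightarrow> Cod C x = Dom C (src P) \<Longrightarrow> ?pr \<cdot> (n \<cdot> x) = (rfl P \<cdot> tgt P) \<cdot> x"
    by (rule pb_map[of "tgt P" "src P" "Idn C (pob C P)" "rfl P \<cdot> tgt P"]) auto
  have nw: "n \<in> weq C" by (rule composable_section_weq[OF P P]) simp_all
  obtain c where [simp]: "c \<in> Arr C" "Dom C c = Dom C ?pl" "Cod C c = pob C P"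
    and c: "src P \<cdot> c = src P \<cdot> ?pl" "tgt P \<cdot> c = tgt P \<cdot> ?pr"
    by (rule path_extension_weak[OF nw P, of "src P \<cdot> ?pl" "tgt P \<cdot> ?pr" "Idn C (pob C P)"]) auto
  obtain m where m [simp]: "m \<in> Arr C" "Dom C m = Dom C h" "Cod C m = Dom C ?pl" "?pl \<cdot> m = H"
    "?pr \<cdot> m = K"
    by (rule pb_map[of "tgt P" "src P" H K]) auto
  show ?thesis
    by (rule homotopicI[OF P, of "c \<cdot> m"]) (simp_all add: cmp_eq[OF c(1)] cmp_eq[OF c(2)])
qed

lemma homotopic_pre:
  assumes hk: "homotopic C z h k" and x: "x \<in> Arr C" "Cod C x = Dom C h"
  shows "homotopic C z (h \<cdot> x) (k \<cdot> x)"
proof -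
  obtain P where P: "is_path_object C z P" using path_object_ex homotopicD[OF hk] by blast
  obtain H where H: "H \<in> Arr C" "Dom C H = Dom C h" "Cod C H = pob C P" "src P \<cdot> H = h" "tgt P \<cdot> H = k"
    using homotopicE[OF hk P] by metis
  show ?thesis
    by (rule homotopicI[OF P, of "H \<cdot> x"])
      (use H x path_ob_simps[OF P] in \<open>simp_all add: cmp_eq[OF H(4)] cmp_eq[OF H(5)]\<close>)
qed

lemma homotopic_post:
  assumes hk: "homotopic C z h k" and z': "z' \<in> fib C"
    and e: "e \<in> Arr C" "Dom C e = Dom C z" "Cod C e = Dom C z'"
    and b: "b \<in> Arr C" "Dom C b = Cod C z" "Cod C b = Cod C z'" "z' \<cdot> e = b \<cdot> z"
  shows "homotopic C z' (e \<cdot> h) (e \<cdot> k)"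
proof -
  obtain P where P: "is_path_object C z P" using path_object_ex homotopicD[OF hk] by blast
  obtain P' where P': "is_path_object C z' P'" using path_object_ex z' by blast
  obtain H where [simp]: "H \<in> Arr C" "Dom C H = Dom C h" "Cod C H = pob C P" "src P \<cdot> H = h"
    "tgt P \<cdot> H = k"
    using homotopicE[OF hk P] by metis
  note [simp] = path_ob_simps[OF P] path_ob_simps[OF P'] e b cmp_eq[OF b(4)]
  obtain w where [simp]: "w \<in> Arr C" "Dom C w = pob C P" "Cod C w = pob C P'"
    and w: "src P' \<cdot> w = e \<cdot> src P" "tgt P' \<cdot> w = e \<cdot> tgt P"
    by (rule path_extension_weak[OF path_ob_rfl_weq[OF P] P', of "e \<cdot> src P" "e \<cdot> tgt P"
      "rfl P' \<cdot> e"]) auto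
  show ?thesis
    by (rule homotopicI[OF P', of "w \<cdot> H"]) (simp_all add: cmp_eq[OF w(1)] cmp_eq[OF w(2)])
qed

lemma homotopic_base:
  assumes hk: "homotopic C p h k" and y: "y \<in> fib C" "Cod C p = Dom C y"
  shows "homotopic C (y \<cdot> p) h k"
proof -
  note D = homotopicD[OF hk]
  have "homotopic C (y \<cdot> p) (Idn C (Dom C p) \<cdot> h) (Idn C (Dom C p) \<cdot> k)"
    by (rule homotopic_post[OF hk fib_Cmp[of p y], of _ y]) (use D y in simp_all)
  then show ?thesis using D by simp
qed

text \<open>If \<open>m : E \<rightarrow> B\<close> is acyclic then so is \<open>P\<^sub>B E \<rightarrow> E \<times>\<^sub>B E\<close>, and a section of the latter chooses a
  path between any two points of a fibre.\<close>

lemma homotopic_acyclic: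
  assumes m: "m \<in> fib C" "m \<in> weq C" and hk: "h \<in> Arr C" "k \<in> Arr C" "Dom C k = Dom C h"
    "Cod C h = Dom C m" "Cod C k = Dom C m" "m \<cdot> h = m \<cdot> k"
  shows "homotopic C m h k"
proof -
  obtain P where P: "is_path_object C m P" using path_object_ex m by blast
  note [simp] = path_ob_simps[OF P] path_ob_acyclic[OF P] m hk
  have "ends C m P \<in> weq C"
    by (rule weq_cancel_left[of "prl C m m"]) (use pr_fib(3)[of m m] in simp_all)
  then obtain s where [simp]: "s \<in> Arr C" "Dom C s = Dom C (prl C m m)" "Cod C s = pob C P"
    and s: "ends C m P \<cdot> s = Idn C (Dom C (prl C m m))"
    using acyclic_fib_section[of "ends C m P"] by (auto simp: hom_def)
  obtain n where n [simp]: "n \<in> Arr C" "Dom C n = Dom C h" "Cod C n = Dom C (prl C m m)"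
    "prl C m m \<cdot> n = h" "prr C m m \<cdot> n = k"
    by (rule pb_map[of m m h k]) (use m hk in auto)
  have *: "ends C m P \<cdot> (s \<cdot> n) = n"
    by (simp add: cmp_eq[OF s])
  have "prl C m m \<cdot> (ends C m P \<cdot> (s \<cdot> n)) = h" "prr C m m \<cdot> (ends C m P \<cdot> (s \<cdot> n)) = k"
    by (simp_all only: * n)
  then show ?thesis
    by (intro homotopicI[OF P, of "s \<cdot> n"]) simp_all
qed

text \<open>The upper triangle commutes up to fibrewise homotopy because the filler is built from a section
  of an acyclic fibration, and any two maps into an acyclic fibration over the same base map are
  fibrewise homotopic.\<close>

lemma filler:
  assumes l: "l \<in> weq C" and p: "p \<in> fib C" and ak: "a \<in> Arr C" "k \<in> Arr C" "Dom C a = Dom C l"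
    "Dom C k = Cod C l" "Cod C a = Dom C p" "Cod C k = Cod C p" "p \<cdot> a = k \<cdot> l"
  obtains d where "d \<in> Arr C" "Dom C d = Cod C l" "Cod C d = Dom C p" "p \<cdot> d = k"
    "homotopic C p (d \<cdot> l) a"
proof -
  obtain n v e where *: "n \<in> Arr C" "v \<in> Arr C" "Dom C n = Cod C v" "Cod C n = Dom C p"
    "Dom C v = Dom C l" "n \<cdot> v = a"
    "e \<in> fib C" "e \<in> weq C" "Dom C e = Cod C v" "Cod C e = Cod C l" and ev: "e \<cdot> v = l"
      and eq: "k \<cdot> e = p \<cdot> n"
    using filler_factor[OF l p ak] by metis
  note [simp] = * l p ak(1-6) weq_arr[OF l]
  obtain s where [simp]: "s \<in> Arr C" "Dom C s = Cod C l" "Cod C s = Cod C v"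
    and es: "e \<cdot> s = Idn C (Cod C l)"
    using acyclic_fib_section[of e] by (auto simp: hom_def)
  have 1: "p \<cdot> (n \<cdot> s) = k"
    using cmp_eq[OF eq[symmetric], of s] es by simp
  have "homotopic C e (s \<cdot> l) v"
    by (rule homotopic_acyclic) (simp_all add: ev cmp_eq[OF es])
  then have "homotopic C p (n \<cdot> (s \<cdot> l)) (n \<cdot> v)"
    by (rule homotopic_post[where b = k]) (simp_all add: eq)
  with 1 show thesis by (intro that[of "n \<cdot> s"]) simp_all
qed

text \<open>Path induction: when \<open>l\<close> is the inclusion of constant paths, a map \<open>w\<close> to a path object with
  prescribed end points may be given by its values \<open>H\<close> on constant paths. By \<open>path_unique\<close> it is
  determined up to homotopy.\<close>

lemma path_extension:
  assumes l: "l \<in> weq C" and P: "is_path_object C z P"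
    and f: "f0 \<in> Arr C" "f1 \<in> Arr C" "Dom C f0 = Cod C l" "Dom C f1 = Cod C l"
      "Cod C f0 = Dom C z" "Cod C f1 = Dom C z" "z \<cdot> f0 = z \<cdot> f1"
    and H: "H \<in> Arr C" "Dom C H = Dom C l" "Cod C H = pob C P" "src P \<cdot> H = f0 \<cdot> l" "tgt P \<cdot> H = f1 \<cdot> l"
  obtains w where "w \<in> Arr C" "Dom C w = Cod C l" "Cod C w = Dom C (src P)" "src P \<cdot> w = f0"
    "tgt P \<cdot> w = f1"
    "homotopic C (ends C z P) (w \<cdot> l) H"
proof -
  obtain m where m: "m \<in> Arr C" "Dom C m = Cod C l" "Cod C m = Cod C (ends C z P)"
    "ends C z P \<cdot> H = m \<cdot> l"
    "\<And>w. w \<in> Arr C \<Longrightarrow> Cod C w = Dom C (ends C z P) \<Longrightarrow> ends C z P \<cdot> w = m \<Longrightarrow> src P \<cdot> w = f0 \<and> tgt P \<cdot> w = f1"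
    using ends_square[OF weq_arr[OF l] P f H] by metis
  obtain w where w: "w \<in> Arr C" "Dom C w = Cod C l" "Cod C w = Dom C (ends C z P)" "ends C z P \<cdot> w = m"
    "homotopic C (ends C z P) (w \<cdot> l) H"
    by (rule filler[OF l _ H(1) m(1), of "ends C z P"]) (use m path_ob_simps[OF P] H in simp_all)
  show thesis
    by (rule that[of w]) (use w m(5)[OF w(1,3,4)] path_ob_simps[OF P] in simp_all)
qed

lemma path_unique:
  assumes "l \<in> weq C" "is_path_object C z P"
    and "w \<in> Arr C" "w' \<in> Arr C" "Dom C w = Cod C l" "Dom C w' = Cod C l" "Cod C w = pob C P"
      "Cod C w' = pob C P" "src P \<cdot> w = src P \<cdot> w'" "tgt P \<cdot> w = tgt P \<cdot> w'"
    and "homotopic C (ends C z P) (w \<cdot> l) (w' \<cdot> l)"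
  shows "homotopic C (ends C z P) w w'"
proof (rule homotopic_extension[OF assms(1)])
  show "ends C z P \<cdot> w = ends C z P \<cdot> w'"
    by (rule ends_eqI[OF assms(2)]) (use assms in simp_all)
qed (use assms path_ob_simps[OF assms(2)] in simp_all)

section \<open>Maps of paths and concatenation\<close>

lemma ends_fun:
  assumes P: "is_path_object C z P" and Q: "is_path_object C y Q"
    and e: "e \<in> Arr C" "Dom C e = Dom C z" "Cod C e = Dom C y"
    and b: "b \<in> Arr C" "Dom C b = Cod C z" "Cod C b = Cod C y" "y \<cdot> e = b \<cdot> z"
    and w: "w \<in> Arr C" "Dom C w = pob C P" "Cod C w = pob C Q" "src Q \<cdot> w = e \<cdot> src P"
      "tgt Q \<cdot> w = e \<cdot> tgt P"
  obtains m where "m \<in> Arr C" "Dom C m = pb C z z" "Cod C m = pb C y y" "ends C y Q \<cdot> w = m \<cdot> ends C z P"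
proof -
  note [simp] = path_ob_simps[OF P] path_ob_simps[OF Q] e b cmp_eq[OF b(4)] w
  obtain m where [simp]: "m \<in> Arr C" "Dom C m = Dom C (prl C z z)" "Cod C m = Dom C (prl C y y)"
    "prl C y y \<cdot> m = e \<cdot> prl C z z" "prr C y y \<cdot> m = e \<cdot> prr C z z"
    "\<And>x. x \<in> Arr C \<Longrightarrow> Cod C x = Dom C (prl C z z) \<Longrightarrow> prl C y y \<cdot> (m \<cdot> x) = (e \<cdot> prl C z z) \<cdot> x"
    "\<And>x. x \<in> Arr C \<Longrightarrow> Cod C x = Dom C (prl C z z) \<Longrightarrow> prr C y y \<cdot> (m \<cdot> x) = (e \<cdot> prr C z z) \<cdot> x"
    by (rule pb_map[of y y "e \<cdot> prl C z z" "e \<cdot> prr C z z"]) auto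
  have "ends C y Q \<cdot> w = m \<cdot> ends C z P"
    by (rule pb_eqI[of y y]) simp_all
  then show thesis by (intro that[of m]) simp_all
qed

lemma path_map_simps:
  assumes "path_map C P y Q e w" "is_path_object C z P" "is_path_object C y Q" "e \<in> Arr C"
    "Cod C e = Dom C y" "Dom C e = Dom C z"
  shows "w \<in> Arr C" "Dom C w = Dom C (src P)" "Cod C w = Dom C (src Q)"
    "src Q \<cdot> w = e \<cdot> src P" "tgt Q \<cdot> w = e \<cdot> tgt P"
    "\<And>x. x \<in> Arr C \<Longrightarrow> Cod C x = Dom C (src P) \<Longrightarrow> src Q \<cdot> (w \<cdot> x) = e \<cdot> (src P \<cdot> x)"
    "\<And>x. x \<in> Arr C \<Longrightarrow> Cod C x = Dom C (src P) \<Longrightarrow> tgt Q \<cdot> (w \<cdot> x) = e \<cdot> (tgt P \<cdot> x)"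
proof -
  note [simp] = path_ob_simps[OF assms(2)] path_ob_simps[OF assms(3)] assms(4-)
  show [simp]: "w \<in> Arr C" "Dom C w = Dom C (src P)" "Cod C w = Dom C (src Q)"
    and *: "src Q \<cdot> w = e \<cdot> src P" "tgt Q \<cdot> w = e \<cdot> tgt P"
    using assms(1) unfolding path_map_def hom_def by auto
  show "src Q \<cdot> (w \<cdot> x) = e \<cdot> (src P \<cdot> x)" "tgt Q \<cdot> (w \<cdot> x) = e \<cdot> (tgt P \<cdot> x)"
    if "x \<in> Arr C" "Cod C x = Dom C (src P)" for x
    using cmp_eq[OF *(1), of x] cmp_eq[OF *(2), of x] that by simp_all
qed

lemma path_map_rfl: "path_map C P y Q e w \<Longrightarrow> homotopic C (ends C y Q) (w \<cdot> rfl P) (rfl Q \<cdot> e)"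
  unfolding path_map_def by simp

lemma path_map_ex:
  assumes P: "is_path_object C z P" and Q: "is_path_object C y Q"
    and e: "e \<in> Arr C" "Dom C e = Dom C z" "Cod C e = Dom C y"
    and b: "b \<in> Arr C" "Dom C b = Cod C z" "Cod C b = Cod C y" "y \<cdot> e = b \<cdot> z"
  obtains w where "path_map C P y Q e w"
proof -
  note [simp] = path_ob_simps[OF P] path_ob_simps[OF Q] e b cmp_eq[OF b(4)]
  obtain w where "w \<in> Arr C" "Dom C w = Cod C (rfl P)" "Cod C w = Dom C (src Q)" "src Q \<cdot> w = e \<cdot> src P"
    "tgt Q \<cdot> w = e \<cdot> tgt P"
    "homotopic C (ends C y Q) (w \<cdot> rfl P) (rfl Q \<cdot> e)"
    by (rule path_extension[OF path_ob_rfl_weq[OF P] Q, of "e \<cdot> src P" "e \<cdot> tgt P" "rfl Q \<cdot> e"]) auto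
  then show thesis by (intro that[of w]) (simp add: path_map_def hom_def)
qed

lemma path_map_unique:
  assumes P: "is_path_object C z P" and Q: "is_path_object C y Q"
    and e: "e \<in> Arr C" "Dom C e = Dom C z" "Cod C e = Dom C y"
    and w: "path_map C P y Q e w" and w': "path_map C P y Q e w'"
  shows "homotopic C (ends C y Q) w w'"
proof -
  note [simp] = path_ob_simps[OF P] path_ob_simps[OF Q] e path_map_simps[OF w P Q]
    path_map_simps[OF w' P Q]
  show ?thesis
    by (rule path_unique[OF path_ob_rfl_weq[OF P] Q])
      (use homotopic_trans[OF path_map_rfl[OF w] homotopic_sym[OF path_map_rfl[OF w']]] in simp_all)
qed

lemma path_map_homotopic:
  assumes P: "is_path_object C z P" and Q: "is_path_object C y Q"
    and e: "e \<in> Arr C" "Dom C e = Dom C z" "Cod C e = Dom C y"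
    and b: "b \<in> Arr C" "Dom C b = Cod C z" "Cod C b = Cod C y" "y \<cdot> e = b \<cdot> z"
    and w: "path_map C P y Q e w" and HK: "homotopic C (ends C z P) H K"
  shows "homotopic C (ends C y Q) (w \<cdot> H) (w \<cdot> K)"
proof -
  note w' = path_map_simps[OF w P Q e(1,3,2)]
  obtain m where "m \<in> Arr C" "Dom C m = pb C z z" "Cod C m = pb C y y" "ends C y Q \<cdot> w = m \<cdot> ends C z P"
    using ends_fun[OF P Q e b] w' pob_def by metis
  then show ?thesis
    by (intro homotopic_post[OF HK, of _ w m])
      (use path_ob_simps[OF P] path_ob_simps[OF Q] w' in simp_all)
qed

lemma path_map_cmp:
  assumes P: "is_path_object C z P" and Q: "is_path_object C y Q" and R: "is_path_object C x R"
    and e: "e \<in> Arr C" "Dom C e = Dom C z" "Cod C e = Dom C y"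
    and d: "d \<in> Arr C" "Dom C d = Dom C y" "Cod C d = Dom C x"
    and b: "b \<in> Arr C" "Dom C b = Cod C y" "Cod C b = Cod C x" "x \<cdot> d = b \<cdot> y"
    and w: "path_map C P y Q e w" and v: "path_map C Q x R d v"
  shows "path_map C P x R (d \<cdot> e) (v \<cdot> w)"
proof -
  note [simp] = path_ob_simps[OF P] path_ob_simps[OF Q] path_ob_simps[OF R] e d
    path_map_simps[OF w P Q] path_map_simps[OF v Q R]
  have "homotopic C (ends C x R) (v \<cdot> (w \<cdot> rfl P)) (v \<cdot> (rfl Q \<cdot> e))"
    by (rule path_map_homotopic[OF Q R d b v path_map_rfl[OF w]])
  also have "homotopic C (ends C x R) (v \<cdot> (rfl Q \<cdot> e)) ((rfl R \<cdot> d) \<cdot> e)"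
    using homotopic_pre[OF path_map_rfl[OF v], of e] by simp
  finally show ?thesis unfolding path_map_def by (simp add: hom_def)
qed

text \<open>Paths in a pulled back fibration \<open>p1\<close> are the paths in \<open>p\<close> between points of the pullback: the
  object \<open>D\<close> of such paths, together with their start points, receives a weak equivalence from the
  constant paths, so path induction maps it to any path object of \<open>p1\<close>.\<close>

lemma pullback_path:
  assumes pbk: "is_pullback C k p p1 p2" and P: "is_path_object C p P" and P1: "is_path_object C p1 P1"
    and rho: "path_map C P1 p P p2 rho"
    and h: "h \<in> Arr C" "h' \<in> Arr C" "Dom C h' = Dom C h" "Cod C h = Dom C p1" "Cod C h' = Dom C p1"
      "p1 \<cdot> h = p1 \<cdot> h'"
    and K: "K \<in> Arr C" "Dom C K = Dom C h" "Cod C K = pob C P" "src P \<cdot> K = p2 \<cdot> h" "tgt P \<cdot> K = p2 \<cdot> h'"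
  obtains K1 where "K1 \<in> Arr C" "Dom C K1 = Dom C h" "Cod C K1 = Dom C (src P1)" "src P1 \<cdot> K1 = h"
    "tgt P1 \<cdot> K1 = h'"
    "homotopic C (ends C p P) (rho \<cdot> K1) K"
proof -
  note D = is_pullbackD[OF pbk]
  note [simp] = path_ob_simps[OF P] path_ob_simps[OF P1] path_ob_acyclic[OF P] path_ob_acyclic[OF P1] D
    cmp_eq[OF D(9)] h(1-5) K path_map_simps[OF rho P1 P]
  let ?pl = "prl C p2 (src P)" and ?pr = "prr C p2 (src P)"
  have src_pr: "src P \<cdot> ?pr = p2 \<cdot> ?pl" by simp
  obtain t where t [simp]: "t \<in> Arr C" "Dom C t = Dom C ?pl" "Cod C t = Dom C p1" "p1 \<cdot> t = p1 \<cdot> ?pl"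
    "p2 \<cdot> t = tgt P \<cdot> ?pr"
    "\<And>x. x \<in> Arr C \<Longrightarrow> Cod C x = Dom C ?pl \<Longrightarrow> p1 \<cdot> (t \<cdot> x) = (p1 \<cdot> ?pl) \<cdot> x"
    "\<And>x. x \<in> Arr C \<Longrightarrow> Cod C x = Dom C ?pl \<Longrightarrow> p2 \<cdot> (t \<cdot> x) = (tgt P \<cdot> ?pr) \<cdot> x"
    by (rule is_pullback_map[OF pbk, of "p1 \<cdot> ?pl" "tgt P \<cdot> ?pr"]) auto
  obtain r where r [simp]: "r \<in> Arr C" "Dom C r = Dom C p1" "Cod C r = Dom C ?pl"
    "?pl \<cdot> r = Idn C (Dom C p1)" "?pr \<cdot> r = rfl P \<cdot> p2"
    by (rule pb_map[of p2 "src P" "Idn C (Dom C p1)" "rfl P \<cdot> p2"]) auto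
  have rw: "r \<in> weq C"
    by (rule section_weq[of ?pl]) (use pr_fib(3)[of p2 "src P"] in simp_all)
  have tr [simp]: "t \<cdot> r = Idn C (Dom C p1)"
    by (rule is_pullback_eqI[OF pbk]) simp_all
  obtain mu where [simp]: "mu \<in> Arr C" "Dom C mu = Dom C ?pl" "Cod C mu = Dom C (src P1)"
    and mu: "src P1 \<cdot> mu = ?pl" "tgt P1 \<cdot> mu = t" and mur: "homotopic C (ends C p1 P1) (mu \<cdot> r) (rfl P1)"
    by (rule path_extension[OF rw P1, of ?pl t "rfl P1"]) auto
  have "homotopic C (ends C p P) (rho \<cdot> (mu \<cdot> r)) (rho \<cdot> rfl P1)"
    by (rule path_map_homotopic[OF P1 P _ _ _ _ _ _ _ rho mur, where b = k]) simp_all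
  also have "homotopic C (ends C p P) (rho \<cdot> rfl P1) (rfl P \<cdot> p2)"
    by (rule path_map_rfl[OF rho])
  finally have "homotopic C (ends C p P) (rho \<cdot> (mu \<cdot> r)) (rfl P \<cdot> p2)" .
  then have "homotopic C (ends C p P) (rho \<cdot> mu) ?pr"
    by - (rule path_unique[OF rw P], simp_all add: mu)
  note rm = homotopic_pre[OF this]
  obtain m where m [simp]: "m \<in> Arr C" "Dom C m = Dom C h" "Cod C m = Dom C ?pl" "?pl \<cdot> m = h"
    "?pr \<cdot> m = K"
    by (rule pb_map[of p2 "src P" h K]) auto
  have tm: "t \<cdot> m = h'"
    by (rule is_pullback_eqI[OF pbk]) (simp_all add: h(6))
  have "homotopic C (ends C p P) (rho \<cdot> (mu \<cdot> m)) K"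
    using rm[of m] by simp
  then show thesis
    by (intro that[of "mu \<cdot> m"]) (simp_all add: tm cmp_eq[OF mu(1)] cmp_eq[OF mu(2)])
qed

lemma homotopic_pullback:
  assumes pbk: "is_pullback C k p p1 p2"
    and h: "h \<in> Arr C" "h' \<in> Arr C" "Dom C h' = Dom C h" "Cod C h = Dom C p1" "Cod C h' = Dom C p1"
      "p1 \<cdot> h = p1 \<cdot> h'"
    and hh: "homotopic C p (p2 \<cdot> h) (p2 \<cdot> h')"
  shows "homotopic C p1 h h'"
proof -
  have p: "p \<in> fib C" by (rule homotopicD(1)[OF hh])
  then obtain P where P: "is_path_object C p P" using path_object_ex by blast
  have "p1 \<in> fib C" by (rule pullback_fib[OF pbk p])
  then obtain P1 where P1: "is_path_object C p1 P1" using path_object_ex by blast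
  note D = is_pullbackD[OF pbk]
  obtain rho where rho: "path_map C P1 p P p2 rho"
    by (rule path_map_ex[OF P1 P, of p2 k]) (use D in simp_all)
  obtain K where K: "K \<in> Arr C" "Dom C K = Dom C (p2 \<cdot> h)" "Cod C K = pob C P" "src P \<cdot> K = p2 \<cdot> h"
    "tgt P \<cdot> K = p2 \<cdot> h'"
    using homotopicE[OF hh P] by metis
  have "Dom C K = Dom C h" using K(2) D h by simp
  then obtain K1 where "K1 \<in> Arr C" "Cod C K1 = Dom C (src P1)" "src P1 \<cdot> K1 = h" "tgt P1 \<cdot> K1 = h'"
    using pullback_path[OF pbk P P1 rho h K(1) _ K(3-)] by metis
  then show ?thesis using homotopicI[OF P1] by simp
qed

text \<open>Homotopic maps may be substituted into a construction \<open>e\<close> that depends on further data over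
  the source \<open>T\<close>: pull \<open>p\<close> back to a fibration over \<open>T\<close>, where \<open>h\<close> and \<open>k\<close> become homotopic sections.\<close>

lemma homotopic_context:
  assumes hk: "homotopic C p h k" and p': "p' \<in> fib C" and b: "b \<in> Arr C" "p \<cdot> h = b"
    and e: "e \<in> Arr C" "Dom C e = pb C b p" "Cod C e = Dom C p'"
    and b': "b' \<in> Arr C" "Dom C b' = Dom C h" "Cod C b' = Cod C p'" "p' \<cdot> e = b' \<cdot> prl C b p"
    and m: "m \<in> Arr C" "Dom C m = Dom C h" "Cod C m = pb C b p" "prl C b p \<cdot> m = Idn C (Dom C h)"
      "prr C b p \<cdot> m = h"
    and n: "n \<in> Arr C" "Dom C n = Dom C h" "Cod C n = pb C b p" "prl C b p \<cdot> n = Idn C (Dom C h)"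
      "prr C b p \<cdot> n = k"
  shows "homotopic C p' (e \<cdot> m) (e \<cdot> n)"
proof -
  note D = homotopicD[OF hk]
  have bD: "Dom C b = Dom C h" "Cod C b = Cod C p" using b D by auto
  note [simp] = D(1-6) b(1) bD p' e b' m n
  have "homotopic C (prl C b p) m n"
    by (rule homotopic_pullback[OF pb_is_pullback[of b p]]) (use hk in simp_all)
  then show ?thesis
    by (rule homotopic_post[where b = b']) simp_all
qed

text \<open>Concatenation of paths of \<open>P\<close> with paths of \<open>R\<close>, the result being a path of \<open>S\<close>. The three path
  objects are those of three fibrations with the same total object but possibly different bases, so
  that a path can be concatenated with a path inside a fibre.\<close>

definition is_concat :: "'a path_ob \<Rightarrow> 'a path_ob \<Rightarrow> 'a path_ob \<Rightarrow> 'a \<Rightarrow> bool" where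
  "is_concat P R S c \<longleftrightarrow> c \<in> Arr C \<and> Dom C c = pb C (tgt P) (src R) \<and> Cod C c = pob C S \<and>
     src S \<cdot> c = src P \<cdot> prl C (tgt P) (src R) \<and> tgt S \<cdot> c = tgt R \<cdot> prr C (tgt P) (src R)"

definition join :: "'a path_ob \<Rightarrow> 'a path_ob \<Rightarrow> 'a \<Rightarrow> 'a \<Rightarrow> 'a \<Rightarrow> 'a" where
  "join P R c G K = c \<cdot> pair C (tgt P) (src R) G K"

lemma join_simps:
  assumes c: "is_concat P R S c" and P: "is_path_object C z P" and R: "is_path_object C y R"
    and S: "is_path_object C x S"
    and d: "Dom C z = Dom C y"
    and GK: "G \<in> Arr C" "K \<in> Arr C" "Dom C K = Dom C G" "Cod C G = Dom C (src P)"
      "Cod C K = Dom C (src R)" "tgt P \<cdot> G = src R \<cdot> K"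
  shows "join P R c G K \<in> Arr C" "Dom C (join P R c G K) = Dom C G"
    "Cod C (join P R c G K) = Dom C (src S)"
    "src S \<cdot> join P R c G K = src P \<cdot> G" "tgt S \<cdot> join P R c G K = tgt R \<cdot> K"
    "\<And>t. t \<in> Arr C \<Longrightarrow> Cod C t = Dom C G \<Longrightarrow> join P R c G K \<cdot> t = join P R c (G \<cdot> t) (K \<cdot> t)"
proof -
  note [simp] = path_ob_simps[OF P] path_ob_simps[OF R] path_ob_simps[OF S] path_ob_acyclic[OF P]
    path_ob_acyclic[OF R] d
    GK(1-5)
  have c' [simp]: "c \<in> Arr C" "Dom C c = Dom C (prl C (tgt P) (src R))" "Cod C c = Dom C (src S)"
    and cs: "src S \<cdot> c = src P \<cdot> prl C (tgt P) (src R)" "tgt S \<cdot> c = tgt R \<cdot> prr C (tgt P) (src R)"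
    using c unfolding is_concat_def by simp_all
  note [simp] = pair_simps[of "tgt P" "src R" G K, OF _ _ _ _ _ _ _ _ GK(6)]
  show "join P R c G K \<in> Arr C" "Dom C (join P R c G K) = Dom C G"
    "Cod C (join P R c G K) = Dom C (src S)"
    "src S \<cdot> join P R c G K = src P \<cdot> G" "tgt S \<cdot> join P R c G K = tgt R \<cdot> K"
    unfolding join_def by (simp_all add: cmp_eq[OF cs(1)] cmp_eq[OF cs(2)])
  show "join P R c G K \<cdot> t = join P R c (G \<cdot> t) (K \<cdot> t)" if "t \<in> Arr C" "Cod C t = Dom C G" for t
    unfolding join_def using that pair_cmp[of "tgt P" "src R" G K t, OF _ _ _ _ _ _ _ _ GK(6)] by simp
qed

text \<open>This and the next lemma are instances of \<open>homotopic_context\<close>, the fixed path being the further data.\<close>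

lemma join_cong_right:
  assumes c: "is_concat P R S c" and P: "is_path_object C z P" and R: "is_path_object C y R"
    and S: "is_path_object C x S"
    and d: "Dom C z = Dom C y"
    and G: "G \<in> Arr C" "Dom C G = Dom C K" "Cod C G = pob C P" "tgt P \<cdot> G = src R \<cdot> K"
    and K: "homotopic C (ends C y R) K K'"
  shows "homotopic C (ends C x S) (join P R c G K) (join P R c G K')"
proof -
  note KD = homotopic_endsD[OF K R]
  note [simp] = path_ob_simps[OF P] path_ob_simps[OF R] path_ob_simps[OF S] path_ob_acyclic[OF P]
    path_ob_acyclic[OF R] d
    G(1-3) KD(1-5)
  note j = join_simps[OF c P R S d]
  let ?b = "ends C y R \<cdot> K"
  let ?pl = "prl C ?b (ends C y R)" and ?pr = "prr C ?b (ends C y R)"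
  have 1: "src R \<cdot> ?pr = src R \<cdot> (K \<cdot> ?pl)"
    using ends_eqD(1)[OF R, of ?pr "K \<cdot> ?pl"] by simp
  have 2: "tgt R \<cdot> ?pr = tgt R \<cdot> (K \<cdot> ?pl)"
    using ends_eqD(2)[OF R, of ?pr "K \<cdot> ?pl"] by simp
  have 3: "tgt P \<cdot> (G \<cdot> ?pl) = src R \<cdot> ?pr"
    unfolding 1 using cmp_eq[OF G(4), of ?pl] by simp
  note j0 = j[of G K, OF _ _ _ _ _ G(4)]
  note j1 = j[of "G \<cdot> ?pl" ?pr, OF _ _ _ _ _ 3]
  have 4: "ends C x S \<cdot> join P R c (G \<cdot> ?pl) ?pr = (ends C x S \<cdot> join P R c G K) \<cdot> ?pl"
    by (rule pb_eqI[of x x])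
      (simp_all add: j0(1-5) j1(1-5) 2 cmp_eq[OF j0(4)] cmp_eq[OF j0(5)])
  obtain m where m: "m \<in> Arr C" "Dom C m = Dom C K" "Cod C m = Dom C ?pl" "?pl \<cdot> m = Idn C (Dom C K)"
    "?pr \<cdot> m = K"
    by (rule pb_map[of ?b "ends C y R" "Idn C (Dom C K)" K]) auto
  have 5: "?b = ends C y R \<cdot> K'"
    by (rule ends_eqI[OF R]) (simp_all add: KD)
  obtain n where n: "n \<in> Arr C" "Dom C n = Dom C K" "Cod C n = Dom C ?pl" "?pl \<cdot> n = Idn C (Dom C K)"
    "?pr \<cdot> n = K'"
    by (rule pb_map[of ?b "ends C y R" "Idn C (Dom C K)" K']) (auto simp: 5)
  have "homotopic C (ends C x S) (join P R c (G \<cdot> ?pl) ?pr \<cdot> m) (join P R c (G \<cdot> ?pl) ?pr \<cdot> n)"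
    by (rule homotopic_context[OF K, where b = ?b and b' = "ends C x S \<cdot> join P R c G K"])
      (use 4 m n in \<open>simp_all add: j0(1-5) j1(1-5)\<close>)
  then show ?thesis using m n by (simp add: j1)
qed

lemma join_cong_left:
  assumes c: "is_concat P R S c" and P: "is_path_object C z P" and R: "is_path_object C y R"
    and S: "is_path_object C x S"
    and d: "Dom C z = Dom C y"
    and K: "K \<in> Arr C" "Dom C K = Dom C G" "Cod C K = pob C R" "tgt P \<cdot> G = src R \<cdot> K"
    and G: "homotopic C (ends C z P) G G'"
  shows "homotopic C (ends C x S) (join P R c G K) (join P R c G' K)"
proof -
  note GD = homotopic_endsD[OF G P]
  note [simp] = path_ob_simps[OF P] path_ob_simps[OF R] path_ob_simps[OF S] path_ob_acyclic[OF P]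
    path_ob_acyclic[OF R] d
    K(1-3) GD(1-5)
  note j = join_simps[OF c P R S d]
  let ?b = "ends C z P \<cdot> G"
  let ?pl = "prl C ?b (ends C z P)" and ?pr = "prr C ?b (ends C z P)"
  have 1: "src P \<cdot> ?pr = src P \<cdot> (G \<cdot> ?pl)"
    using ends_eqD(1)[OF P, of ?pr "G \<cdot> ?pl"] by simp
  have 2: "tgt P \<cdot> ?pr = tgt P \<cdot> (G \<cdot> ?pl)"
    using ends_eqD(2)[OF P, of ?pr "G \<cdot> ?pl"] by simp
  have 3: "tgt P \<cdot> ?pr = src R \<cdot> (K \<cdot> ?pl)"
    unfolding 2 using cmp_eq[OF K(4), of ?pl] by simp
  note j0 = j[of G K, OF _ _ _ _ _ K(4)]
  note j1 = j[of ?pr "K \<cdot> ?pl", OF _ _ _ _ _ 3]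
  have 4: "ends C x S \<cdot> join P R c ?pr (K \<cdot> ?pl) = (ends C x S \<cdot> join P R c G K) \<cdot> ?pl"
    by (rule pb_eqI[of x x])
      (simp_all add: j0(1-5) j1(1-5) 1 cmp_eq[OF j0(4)] cmp_eq[OF j0(5)])
  obtain m where m: "m \<in> Arr C" "Dom C m = Dom C G" "Cod C m = Dom C ?pl" "?pl \<cdot> m = Idn C (Dom C G)"
    "?pr \<cdot> m = G"
    by (rule pb_map[of ?b "ends C z P" "Idn C (Dom C G)" G]) auto
  have 5: "?b = ends C z P \<cdot> G'"
    by (rule ends_eqI[OF P]) (simp_all add: GD)
  obtain n where n: "n \<in> Arr C" "Dom C n = Dom C G" "Cod C n = Dom C ?pl" "?pl \<cdot> n = Idn C (Dom C G)"
    "?pr \<cdot> n = G'"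
    by (rule pb_map[of ?b "ends C z P" "Idn C (Dom C G)" G']) (auto simp: 5)
  have "homotopic C (ends C x S) (join P R c ?pr (K \<cdot> ?pl) \<cdot> m) (join P R c ?pr (K \<cdot> ?pl) \<cdot> n)"
    by (rule homotopic_context[OF G, where b = ?b and b' = "ends C x S \<cdot> join P R c G K"])
      (use 4 m n in \<open>simp_all add: j0(1-5) j1(1-5)\<close>)
  then show ?thesis using m n by (simp add: j1)
qed

text \<open>The concatenation is defined by path induction on the second path, which runs inside the fibres of
  \<open>p\<close>; for \<open>y\<close> an identity it is the ordinary concatenation of two paths.\<close>

lemma concat_ex:
  assumes Q: "is_path_object C x Q" and R: "is_path_object C p R"
    and xp: "x = y \<cdot> p" "y \<in> Arr C" "Cod C p = Dom C y"
  obtains c where "is_concat Q R Q c"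
    "\<And>G. G \<in> Arr C \<Longrightarrow> Cod C G = pob C Q \<Longrightarrow> homotopic C (ends C x Q) (join Q R c G (rfl R \<cdot> (tgt Q \<cdot> G))) G"
proof -
  have [simp]: "p \<in> fib C" by (rule path_ob_simps(1)[OF R])
  have Dx [simp]: "Dom C x = Dom C p" "Cod C x = Cod C y" using xp by simp_all
  note [simp] = path_ob_simps[OF Q] path_ob_simps[OF R] path_ob_acyclic[OF Q]
    path_ob_acyclic[OF R] xp(2,3)
  let ?pl = "prl C (tgt Q) (src R)" and ?pr = "prr C (tgt Q) (src R)"
  obtain n where n [simp]: "n \<in> Arr C" "Dom C n = Dom C (src Q)" "Cod C n = Dom C ?pl"
    "?pl \<cdot> n = Idn C (Dom C (src Q))" "?pr \<cdot> n = rfl R \<cdot> tgt Q"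
    by (rule pb_map[of "tgt Q" "src R" "Idn C (pob C Q)" "rfl R \<cdot> tgt Q"]) auto
  have nw: "n \<in> weq C"
    by (rule composable_section_weq[OF Q R]) (simp_all)
  have "x \<cdot> (src Q \<cdot> ?pl) = x \<cdot> (tgt Q \<cdot> ?pl)" by simp
  also have "\<dots> = x \<cdot> (src R \<cdot> ?pr)" by simp
  also have "\<dots> = y \<cdot> (p \<cdot> (src R \<cdot> ?pr))" using xp by simp
  also have "\<dots> = y \<cdot> (p \<cdot> (tgt R \<cdot> ?pr))" by simp
  also have "\<dots> = x \<cdot> (tgt R \<cdot> ?pr)" using xp by simp
  finally have 1: "x \<cdot> (src Q \<cdot> ?pl) = x \<cdot> (tgt R \<cdot> ?pr)" .
  obtain c where c [simp]: "c \<in> Arr C" "Dom C c = Dom C ?pl" "Cod C c = Dom C (src Q)"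
    "src Q \<cdot> c = src Q \<cdot> ?pl" "tgt Q \<cdot> c = tgt R \<cdot> ?pr"
    and cn: "homotopic C (ends C x Q) (c \<cdot> n) (Idn C (pob C Q))"
    by (rule path_extension[OF nw Q, of "src Q \<cdot> ?pl" "tgt R \<cdot> ?pr" "Idn C (pob C Q)"]) (simp_all add: 1)
  have cc: "is_concat Q R Q c" unfolding is_concat_def by simp
  show thesis
  proof (rule that[OF cc])
    fix G assume G [simp]: "G \<in> Arr C" "Cod C G = pob C Q"
    have "n \<cdot> G = pair C (tgt Q) (src R) G (rfl R \<cdot> (tgt Q \<cdot> G))"
      by (rule pb_eqI[of "tgt Q" "src R"])
        (simp_all add: pair_simps cmp_eq[OF n(4)] cmp_eq[OF n(5)])
    moreover have "homotopic C (ends C x Q) (c \<cdot> (n \<cdot> G)) G"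
      using homotopic_pre[OF cn, of G] by simp
    ultimately show "homotopic C (ends C x Q) (join Q R c G (rfl R \<cdot> (tgt Q \<cdot> G))) G"
      unfolding join_def by simp
  qed
qed

section \<open>Path objects fibred over path objects\<close>

lemma pr_cmp:
  assumes "y \<in> fib C" "p \<in> fib C" "Cod C p = Dom C y"
  shows "y \<cdot> (p \<cdot> prr C (y \<cdot> p) (y \<cdot> p)) = y \<cdot> (p \<cdot> prl C (y \<cdot> p) (y \<cdot> p))"
    and "t \<in> Arr C \<Longrightarrow> Cod C t = Dom C (prl C (y \<cdot> p) (y \<cdot> p)) \<Longrightarrow>
      y \<cdot> (p \<cdot> (prr C (y \<cdot> p) (y \<cdot> p) \<cdot> t)) = y \<cdot> (p \<cdot> (prl C (y \<cdot> p) (y \<cdot> p) \<cdot> t))"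
proof -
  have x: "y \<cdot> p \<in> fib C" using fib_Cmp[of p y] assms by simp
  note [simp] = assms x
  let ?pl = "prl C (y \<cdot> p) (y \<cdot> p)" and ?pr = "prr C (y \<cdot> p) (y \<cdot> p)"
  have "y \<cdot> (p \<cdot> ?pr) = (y \<cdot> p) \<cdot> ?pr" by (rule cmp_assoc[symmetric]) simp_all
  also have "\<dots> = (y \<cdot> p) \<cdot> ?pl" by (rule pr_simps(6)) simp_all
  also have "\<dots> = y \<cdot> (p \<cdot> ?pl)" by (rule cmp_assoc) simp_all
  finally show *: "y \<cdot> (p \<cdot> ?pr) = y \<cdot> (p \<cdot> ?pl)" .
  show "y \<cdot> (p \<cdot> (?pr \<cdot> t)) = y \<cdot> (p \<cdot> (?pl \<cdot> t))" if "t \<in> Arr C" "Cod C t = Dom C ?pl"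
    using cmp_eq[OF *, of t] that by simp
qed

text \<open>The map \<open>p \<times> p\<close> from \<open>X \<times>\<^sub>I X\<close> to \<open>Y \<times>\<^sub>I Y\<close>.\<close>

definition square_map :: "'a \<Rightarrow> 'a \<Rightarrow> 'a" where
  "square_map y p = pair C y y (p \<cdot> prl C (y \<cdot> p) (y \<cdot> p)) (p \<cdot> prr C (y \<cdot> p) (y \<cdot> p))"

lemma square_map_simps:
  assumes "y \<in> fib C" "p \<in> fib C" "Cod C p = Dom C y"
  shows "square_map y p \<in> Arr C" "Dom C (square_map y p) = Dom C (prl C (y \<cdot> p) (y \<cdot> p))"
    "Cod C (square_map y p) = Dom C (prl C y y)"
    "prl C y y \<cdot> square_map y p = p \<cdot> prl C (y \<cdot> p) (y \<cdot> p)"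
    "prr C y y \<cdot> square_map y p = p \<cdot> prr C (y \<cdot> p) (y \<cdot> p)"
    "\<And>t. t \<in> Arr C \<Longrightarrow> Cod C t = Dom C (prl C (y \<cdot> p) (y \<cdot> p)) \<Longrightarrow>
      prl C y y \<cdot> (square_map y p \<cdot> t) = p \<cdot> (prl C (y \<cdot> p) (y \<cdot> p) \<cdot> t)"
    "\<And>t. t \<in> Arr C \<Longrightarrow> Cod C t = Dom C (prl C (y \<cdot> p) (y \<cdot> p)) \<Longrightarrow>
      prr C y y \<cdot> (square_map y p \<cdot> t) = p \<cdot> (prr C (y \<cdot> p) (y \<cdot> p) \<cdot> t)"
proof -
  have x: "y \<cdot> p \<in> fib C" using fib_Cmp[of p y] assms by simp
  note [simp] = assms x
  have eq: "y \<cdot> (p \<cdot> prl C (y \<cdot> p) (y \<cdot> p)) = y \<cdot> (p \<cdot> prr C (y \<cdot> p) (y \<cdot> p))"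
    by (rule pr_cmp(1)[symmetric]) simp_all
  note s = pair_simps[of y y "p \<cdot> prl C (y \<cdot> p) (y \<cdot> p)"
    "p \<cdot> prr C (y \<cdot> p) (y \<cdot> p)", folded square_map_def]
  show "square_map y p \<in> Arr C" "Dom C (square_map y p) = Dom C (prl C (y \<cdot> p) (y \<cdot> p))"
    "Cod C (square_map y p) = Dom C (prl C y y)"
    "prl C y y \<cdot> square_map y p = p \<cdot> prl C (y \<cdot> p) (y \<cdot> p)"
    "prr C y y \<cdot> square_map y p = p \<cdot> prr C (y \<cdot> p) (y \<cdot> p)"
    by (simp_all add: s eq)
  show
    "\<And>t. t \<in> Arr C \<Longrightarrow> Cod C t = Dom C (prl C (y \<cdot> p) (y \<cdot> p)) \<Longrightarrow>
      prl C y y \<cdot> (square_map y p \<cdot> t) = p \<cdot> (prl C (y \<cdot> p) (y \<cdot> p) \<cdot> t)"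
    "\<And>t. t \<in> Arr C \<Longrightarrow> Cod C t = Dom C (prl C (y \<cdot> p) (y \<cdot> p)) \<Longrightarrow>
      prr C y y \<cdot> (square_map y p \<cdot> t) = p \<cdot> (prr C (y \<cdot> p) (y \<cdot> p) \<cdot> t)"
    by (simp_all add: s eq)
qed

text \<open>For a fibration \<open>p\<close> from \<open>X\<close> to \<open>Y\<close> over \<open>I\<close>, a path object of \<open>X\<close> that is fibred over the
  paths in \<open>Y\<close> between the images of the end points. Its map \<open>phi\<close> to the path object of \<open>Y\<close> then
  preserves constant paths strictly, and paths of \<open>Y\<close> can be lifted strictly.\<close>

definition fibred_path_ob :: "'a \<Rightarrow> 'a \<Rightarrow> 'a path_ob \<Rightarrow> 'a path_ob \<Rightarrow> 'a \<Rightarrow> bool" where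
  "fibred_path_ob y p R Q phi \<longleftrightarrow> is_path_object C (y \<cdot> p) Q \<and>
     phi \<in> Arr C \<and> Dom C phi = pob C Q \<and> Cod C phi = pob C R \<and>
     src R \<cdot> phi = p \<cdot> src Q \<and> tgt R \<cdot> phi = p \<cdot> tgt Q \<and> phi \<cdot> rfl Q = rfl R \<cdot> p \<and>
     (\<exists>N \<in> fib C. Dom C N = pob C Q \<and> Cod C N = pb C (square_map y p) (ends C y R) \<and>
        prl C (square_map y p) (ends C y R) \<cdot> N = ends C (y \<cdot> p) Q \<and>
        prr C (square_map y p) (ends C y R) \<cdot> N = phi)"

lemma fibred_path_ob_ex:
  assumes y: "y \<in> fib C" and p: "p \<in> fib C" "Cod C p = Dom C y" and R: "is_path_object C y R"
  obtains Q phi where "fibred_path_ob y p R Q phi"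
proof -
  have x: "y \<cdot> p \<in> fib C" using fib_Cmp[of p y] y p by simp
  note [simp] = y p x path_ob_simps[OF R] square_map_simps[OF y p]
  let ?s = "square_map y p"
  let ?pl = "prl C ?s (ends C y R)" and ?pr = "prr C ?s (ends C y R)"
  obtain d where d [simp]: "d \<in> Arr C" "Dom C d = Dom C p" "Cod C d = Dom C (prl C (y \<cdot> p) (y \<cdot> p))"
    "prl C (y \<cdot> p) (y \<cdot> p) \<cdot> d = Idn C (Dom C p)" "prr C (y \<cdot> p) (y \<cdot> p) \<cdot> d = Idn C (Dom C p)"
    by (rule pb_map[of "y \<cdot> p" "y \<cdot> p" "Idn C (Dom C p)" "Idn C (Dom C p)"]) auto
  have eq: "?s \<cdot> d = ends C y R \<cdot> (rfl R \<cdot> p)"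
    by (rule pb_eqI[of y y]) simp_all
  obtain n where [simp]: "n \<in> Arr C" "Dom C n = Dom C p" "Cod C n = Dom C ?pl" "?pl \<cdot> n = d"
    "?pr \<cdot> n = rfl R \<cdot> p"
    by (rule pb_map[of ?s "ends C y R" d "rfl R \<cdot> p"]) (simp_all add: eq)
  obtain r N where r: "r \<in> weq C" and N: "N \<in> fib C" and [simp]: "Dom C r = Dom C p" "Cod C r = Dom C N"
    "Cod C N = Dom C ?pl"
    and Nr: "N \<cdot> r = n"
    using factorization[of n] by (metis \<open>n \<in> Arr C\<close> \<open>Dom C n = Dom C p\<close> \<open>Cod C n = Dom C ?pl\<close>)
  have [simp]: "r \<in> Arr C" by (rule weq_arr[OF r])
  note [simp] = N Nr
  let ?N = "?pl \<cdot> N"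
  define Q where "Q = \<lparr> rfl = r, src = prl C (y \<cdot> p) (y \<cdot> p) \<cdot> ?N, tgt = prr C (y \<cdot> p) (y \<cdot> p) \<cdot> ?N \<rparr>"
  have "?N \<in> fib C" using fib_Cmp[of N ?pl] pr_fib(1)[of ?s "ends C y R"] by simp
  then have eQ: "ends C (y \<cdot> p) Q = ?N" and Q: "is_path_object C (y \<cdot> p) Q"
    by (rule is_path_objectI[OF x _ _ r]; simp add: Q_def)+
  have Q' [simp]: "rfl Q = r" "src Q = prl C (y \<cdot> p) (y \<cdot> p) \<cdot> ?N" "tgt Q = prr C (y \<cdot> p) (y \<cdot> p) \<cdot> ?N"
    by (simp_all add: Q_def)
  have sN: "ends C y R \<cdot> (?pr \<cdot> N) = ?s \<cdot> ?N" by simp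
  have "prl C y y \<cdot> (ends C y R \<cdot> (?pr \<cdot> N)) = prl C y y \<cdot> (?s \<cdot> ?N)"
    "prr C y y \<cdot> (ends C y R \<cdot> (?pr \<cdot> N)) = prr C y y \<cdot> (?s \<cdot> ?N)"
    by (simp_all only: sN)
  then have "src R \<cdot> (?pr \<cdot> N) = p \<cdot> src Q" "tgt R \<cdot> (?pr \<cdot> N) = p \<cdot> tgt Q"
    by (simp_all del: pr_simps(6,7))
  then have "fibred_path_ob y p R Q (?pr \<cdot> N)"
    unfolding fibred_path_ob_def eQ using Q N by (intro conjI bexI[of _ N]) simp_all
  then show thesis by (rule that)
qed

lemma fibred_path_ob_simps:
  assumes F: "fibred_path_ob y p R Q phi" and R: "is_path_object C y R" and p: "p \<in> fib C"
    "Cod C p = Dom C y"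
  shows "phi \<in> Arr C" "Dom C phi = Dom C (src Q)" "Cod C phi = Dom C (src R)"
    "src R \<cdot> phi = p \<cdot> src Q" "tgt R \<cdot> phi = p \<cdot> tgt Q"
    "\<And>t. t \<in> Arr C \<Longrightarrow> Cod C t = Dom C (src Q) \<Longrightarrow> src R \<cdot> (phi \<cdot> t) = p \<cdot> (src Q \<cdot> t)"
    "\<And>t. t \<in> Arr C \<Longrightarrow> Cod C t = Dom C (src Q) \<Longrightarrow> tgt R \<cdot> (phi \<cdot> t) = p \<cdot> (tgt Q \<cdot> t)"
    "is_path_object C (y \<cdot> p) Q" "path_map C Q y R p phi"
proof -
  show Q: "is_path_object C (y \<cdot> p) Q" using F unfolding fibred_path_ob_def by simp
  note [simp] = path_ob_simps[OF R] p path_ob_simps[OF Q]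
  show *: "phi \<in> Arr C" "Dom C phi = Dom C (src Q)" "Cod C phi = Dom C (src R)"
    "src R \<cdot> phi = p \<cdot> src Q" "tgt R \<cdot> phi = p \<cdot> tgt Q"
    using F unfolding fibred_path_ob_def by simp_all
  show "src R \<cdot> (phi \<cdot> t) = p \<cdot> (src Q \<cdot> t)" "tgt R \<cdot> (phi \<cdot> t) = p \<cdot> (tgt Q \<cdot> t)"
    if "t \<in> Arr C" "Cod C t = Dom C (src Q)" for t
    using cmp_eq[OF *(4), of t] cmp_eq[OF *(5), of t] * that by simp_all
  have "phi \<cdot> rfl Q = rfl R \<cdot> p" using F unfolding fibred_path_ob_def by simp
  then show "path_map C Q y R p phi"
    unfolding path_map_def hom_def using * by (simp add: homotopic_refl)
qed

text \<open>Sending a path in \<open>X\<close> to its start and its image in \<open>Y\<close> is a fibration, because it is the defining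
  fibration followed by a pullback of \<open>p\<close> at the end point. It is a weak equivalence because the start
  point alone is an acyclic fibration on both sides.\<close>

lemma fibred_path_ob_start:
  assumes F: "fibred_path_ob y p R Q phi" and R: "is_path_object C y R" and p: "p \<in> fib C"
    "Cod C p = Dom C y"
  obtains A where "A \<in> fib C" "A \<in> weq C" "Dom C A = Dom C (src Q)" "Cod C A = Dom C (prl C p (src R))"
    "prl C p (src R) \<cdot> A = src Q" "prr C p (src R) \<cdot> A = phi"
    "\<And>t. t \<in> Arr C \<Longrightarrow> Cod C t = Dom C (src Q) \<Longrightarrow> prl C p (src R) \<cdot> (A \<cdot> t) = src Q \<cdot> t"
    "\<And>t. t \<in> Arr C \<Longrightarrow> Cod C t = Dom C (src Q) \<Longrightarrow> prr C p (src R) \<cdot> (A \<cdot> t) = phi \<cdot> t"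
proof -
  have y: "y \<in> fib C" by (rule path_ob_simps(1)[OF R])
  have x: "y \<cdot> p \<in> fib C" using fib_Cmp[of p y] y p by simp
  note f = fibred_path_ob_simps[OF F R p]
  note [simp] = y p x path_ob_simps[OF R] path_ob_acyclic[OF R] square_map_simps[OF y p] f(1-7)
    path_ob_simps[OF f(8)] path_ob_acyclic[OF f(8)]
  let ?s = "square_map y p" and ?x = "y \<cdot> p"
  let ?vl = "prl C ?s (ends C y R)" and ?vr = "prr C ?s (ends C y R)"
  let ?pl = "prl C p (src R)" and ?pr = "prr C p (src R)"
  obtain N where [simp]: "N \<in> fib C" "Dom C N = Dom C (src Q)" "Cod C N = Dom C ?vl"
    "?vl \<cdot> N = ends C ?x Q" "?vr \<cdot> N = phi"
    using F unfolding fibred_path_ob_def by auto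
  have xx: "y \<cdot> (p \<cdot> (prr C ?x ?x \<cdot> t)) = y \<cdot> (p \<cdot> (prl C ?x ?x \<cdot> t))"
    if "t \<in> Arr C" "Cod C t = Dom C (prl C ?x ?x)" for t
    by (rule pr_cmp(2)) (use that in simp_all)
  have sv: "src R \<cdot> (?vr \<cdot> t) = p \<cdot> (prl C ?x ?x \<cdot> (?vl \<cdot> t))"
    "tgt R \<cdot> (?vr \<cdot> t) = p \<cdot> (prr C ?x ?x \<cdot> (?vl \<cdot> t))" if "t \<in> Arr C" "Cod C t = Dom C ?vl" for t
  proof -
    have st: "ends C y R \<cdot> (?vr \<cdot> t) = ?s \<cdot> (?vl \<cdot> t)" using that by simp
    have "prl C y y \<cdot> (ends C y R \<cdot> (?vr \<cdot> t)) = prl C y y \<cdot> (?s \<cdot> (?vl \<cdot> t))"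
      "prr C y y \<cdot> (ends C y R \<cdot> (?vr \<cdot> t)) = prr C y y \<cdot> (?s \<cdot> (?vl \<cdot> t))"
      by (simp_all only: st)
    then show "src R \<cdot> (?vr \<cdot> t) = p \<cdot> (prl C ?x ?x \<cdot> (?vl \<cdot> t))"
      "tgt R \<cdot> (?vr \<cdot> t) = p \<cdot> (prr C ?x ?x \<cdot> (?vl \<cdot> t))"
      using that by (simp_all del: pr_simps(6,7))
  qed
  have sv1: "src R \<cdot> ?vr = p \<cdot> (prl C ?x ?x \<cdot> ?vl)" "tgt R \<cdot> ?vr = p \<cdot> (prr C ?x ?x \<cdot> ?vl)"
    using sv[of "Idn C (Dom C ?vl)"] by simp_all
  obtain v where v [simp]: "v \<in> Arr C" "Dom C v = Dom C ?vl" "Cod C v = Dom C ?pl"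
    "?pl \<cdot> v = prl C ?x ?x \<cdot> ?vl" "?pr \<cdot> v = ?vr"
    "\<And>t. t \<in> Arr C \<Longrightarrow> Cod C t = Dom C ?vl \<Longrightarrow> ?pl \<cdot> (v \<cdot> t) = (prl C ?x ?x \<cdot> ?vl) \<cdot> t"
    "\<And>t. t \<in> Arr C \<Longrightarrow> Cod C t = Dom C ?vl \<Longrightarrow> ?pr \<cdot> (v \<cdot> t) = ?vr \<cdot> t"
    by (rule pb_map[of p "src R" "prl C ?x ?x \<cdot> ?vl" ?vr]) (auto simp: sv1)
  have "is_pullback C (tgt R \<cdot> ?pr) p v (prr C ?x ?x \<cdot> ?vl)"
  proof (rule is_pullbackI)
    show "(tgt R \<cdot> ?pr) \<cdot> v = p \<cdot> (prr C ?x ?x \<cdot> ?vl)" by (simp add: sv1)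
  next
    fix a b
    assume ab [simp]: "a \<in> Arr C" "b \<in> Arr C" "Dom C b = Dom C a" "Cod C a = Dom C (tgt R \<cdot> ?pr)"
      "Cod C b = Dom C p"
      and eq: "(tgt R \<cdot> ?pr) \<cdot> a = p \<cdot> b"
    have [simp]: "Cod C a = Dom C ?pl" using ab(4) by simp
    have eq': "tgt R \<cdot> (?pr \<cdot> a) = p \<cdot> b" using eq by simp
    have "y \<cdot> (p \<cdot> (?pl \<cdot> a)) = y \<cdot> (src R \<cdot> (?pr \<cdot> a))" by simp
    also have "\<dots> = y \<cdot> (tgt R \<cdot> (?pr \<cdot> a))" by (simp del: pr_simps(7))
    also have "\<dots> = y \<cdot> (p \<cdot> b)" by (simp only: eq')
    finally have yp: "y \<cdot> (p \<cdot> (?pl \<cdot> a)) = y \<cdot> (p \<cdot> b)" .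
    obtain d where d [simp]: "d \<in> Arr C" "Dom C d = Dom C a" "Cod C d = Dom C (prl C ?x ?x)"
      "prl C ?x ?x \<cdot> d = ?pl \<cdot> a" "prr C ?x ?x \<cdot> d = b"
      by (rule pb_map[of ?x ?x "?pl \<cdot> a" b]) (simp_all add: yp)
    have eq: "?s \<cdot> d = ends C y R \<cdot> (?pr \<cdot> a)"
      by (rule pb_eqI[of y y]) (simp_all add: eq')
    obtain m where m [simp]: "m \<in> Arr C" "Dom C m = Dom C a" "Cod C m = Dom C ?vl" "?vl \<cdot> m = d"
      "?vr \<cdot> m = ?pr \<cdot> a"
      by (rule pb_map[of ?s "ends C y R" d "?pr \<cdot> a"]) (simp_all add: eq)
    have "v \<cdot> m = a" by (rule pb_eqI[of p "src R"]) simp_all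
    then show "\<exists>m. m \<in> Arr C \<and> Dom C m = Dom C a \<and> Cod C m = Dom C v \<and> v \<cdot> m = a \<and>
        (prr C ?x ?x \<cdot> ?vl) \<cdot> m = b"
      by (intro exI[of _ m]) simp
  next
    fix m n
    assume mn: "m \<in> Arr C" "n \<in> Arr C" "Dom C n = Dom C m" "Cod C m = Dom C v" "Cod C n = Dom C v"
      and eq: "v \<cdot> n = v \<cdot> m" "(prr C ?x ?x \<cdot> ?vl) \<cdot> n = (prr C ?x ?x \<cdot> ?vl) \<cdot> m"
    have 1: "prr C ?x ?x \<cdot> (?vl \<cdot> n) = prr C ?x ?x \<cdot> (?vl \<cdot> m)" using eq(2) mn by simp
    have "?pl \<cdot> (v \<cdot> n) = ?pl \<cdot> (v \<cdot> m)" "?pr \<cdot> (v \<cdot> n) = ?pr \<cdot> (v \<cdot> m)" by (simp_all only: eq)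
    then have 2: "prl C ?x ?x \<cdot> (?vl \<cdot> n) = prl C ?x ?x \<cdot> (?vl \<cdot> m)" "?vr \<cdot> n = ?vr \<cdot> m" using mn
      by simp_all
    have "?vl \<cdot> m = ?vl \<cdot> n" by (rule pb_eqI[of ?x ?x]) (use 1 2 mn in simp_all)
    then show "m = n" using pb_eqI[of ?s "ends C y R" m n] 2 mn by simp
  qed simp_all
  then have vf [simp]: "v \<in> fib C" by (rule pullback_fib) simp
  have fA: "v \<cdot> N \<in> fib C" using fib_Cmp[of N v] by simp
  have wA: "v \<cdot> N \<in> weq C"
    by (rule weq_cancel_left[of ?pl]) (use pr_fib(3)[of p "src R"] in simp_all)
  have 1: "?pl \<cdot> (v \<cdot> N) = src Q" "?pr \<cdot> (v \<cdot> N) = phi" by simp_all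
  show thesis
    by (rule that[of "v \<cdot> N", OF fA wA _ _ 1]) (use cmp_eq[OF 1(1)] cmp_eq[OF 1(2)] fA in simp_all)
qed

lemma path_lifting:
  assumes F: "fibred_path_ob y p R Q phi" and R: "is_path_object C y R" and p: "p \<in> fib C"
    "Cod C p = Dom C y"
    and u: "u \<in> Arr C" "Cod C u = Dom C p" and h: "h \<in> Arr C" "Dom C h = Dom C u" "Cod C h = pob C R"
      "src R \<cdot> h = p \<cdot> u"
  obtains G where "G \<in> Arr C" "Dom C G = Dom C u" "Cod C G = Dom C (src Q)" "src Q \<cdot> G = u" "phi \<cdot> G = h"
proof -
  note f = fibred_path_ob_simps[OF F R p]
  note [simp] = p path_ob_simps[OF R] path_ob_acyclic[OF R] f(1-7) path_ob_simps[OF f(8)] u h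
  obtain A where A [simp]: "A \<in> fib C" "A \<in> weq C" "Dom C A = Dom C (src Q)"
    "Cod C A = Dom C (prl C p (src R))"
    "\<And>t. t \<in> Arr C \<Longrightarrow> Cod C t = Dom C (src Q) \<Longrightarrow> prl C p (src R) \<cdot> (A \<cdot> t) = src Q \<cdot> t"
    "\<And>t. t \<in> Arr C \<Longrightarrow> Cod C t = Dom C (src Q) \<Longrightarrow> prr C p (src R) \<cdot> (A \<cdot> t) = phi \<cdot> t"
    using fibred_path_ob_start[OF F R p] by metis
  obtain s where [simp]: "s \<in> Arr C" "Dom C s = Cod C A" "Cod C s = Dom C A"
    and s: "A \<cdot> s = Idn C (Cod C A)"
    using acyclic_fib_section[of A] by (auto simp: hom_def)
  obtain m where m [simp]: "m \<in> Arr C" "Dom C m = Dom C u" "Cod C m = Dom C (prl C p (src R))"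
    "prl C p (src R) \<cdot> m = u" "prr C p (src R) \<cdot> m = h"
    by (rule pb_map[of p "src R" u h]) simp_all
  have *: "A \<cdot> (s \<cdot> m) = m" using cmp_eq[OF s, of m] by simp
  have "prl C p (src R) \<cdot> (A \<cdot> (s \<cdot> m)) = u" "prr C p (src R) \<cdot> (A \<cdot> (s \<cdot> m)) = h"
    by (simp_all only: * m)
  then show thesis by (intro that[of "s \<cdot> m"]) simp_all
qed

text \<open>Lift the path from \<open>p v\<close> to \<open>w\<close> to a path starting at \<open>v\<close>, and take its end.\<close>

lemma homotopy_lifting:
  assumes p: "p \<in> fib C" "Cod C p = Dom C y" and v: "v \<in> Arr C" "Cod C v = Dom C p"
    and h: "homotopic C y (p \<cdot> v) w"
  obtains v' where "homotopic C (y \<cdot> p) v v'" "p \<cdot> v' = w"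
proof -
  have y: "y \<in> fib C" by (rule homotopicD(1)[OF h])
  obtain R where R: "is_path_object C y R" using path_object_ex y by blast
  obtain H where H: "H \<in> Arr C" "Dom C H = Dom C v" "Cod C H = pob C R" "src R \<cdot> H = p \<cdot> v"
    "tgt R \<cdot> H = w"
    using homotopicE[OF h R] v p by (metis cmp_dom fib_arr)
  obtain Q phi where F: "fibred_path_ob y p R Q phi" using fibred_path_ob_ex[OF y p R] by metis
  note f = fibred_path_ob_simps[OF F R p]
  obtain G where G: "G \<in> Arr C" "Dom C G = Dom C v" "Cod C G = Dom C (src Q)" "src Q \<cdot> G = v"
    "phi \<cdot> G = H"
    using path_lifting[OF F R p v H(1-4)] by metis
  have "p \<cdot> (tgt Q \<cdot> G) = w"
    using f(7)[of G] G H(5) by simp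
  moreover have "homotopic C (y \<cdot> p) v (tgt Q \<cdot> G)"
    by (rule homotopicI[OF f(8), of G]) (use G in simp_all)
  ultimately show thesis using that by blast
qed

text \<open>The homotopy lifting property of the defining fibration of \<open>Q\<close>, over pairs of points of \<open>X\<close>: a path
  in \<open>X\<close> can be moved, with fixed end points, along a homotopy of its image in \<open>Y\<close>.\<close>

lemma path_rectify:
  assumes F: "fibred_path_ob y p R Q phi" and R: "is_path_object C y R" and p: "p \<in> fib C"
    "Cod C p = Dom C y"
    and H: "H \<in> Arr C" "Cod C H = pob C Q" and h: "homotopic C (ends C y R) (phi \<cdot> H) h"
  obtains H' where "homotopic C (ends C (y \<cdot> p) Q) H H'" "phi \<cdot> H' = h"
proof -
  have y: "y \<in> fib C" by (rule path_ob_simps(1)[OF R])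
  note f = fibred_path_ob_simps[OF F R p]
  note [simp] = y p path_ob_simps[OF R] square_map_simps[OF y p] f(1-7) path_ob_simps[OF f(8)] H
  let ?s = "square_map y p" and ?x = "y \<cdot> p"
  let ?vl = "prl C ?s (ends C y R)" and ?vr = "prr C ?s (ends C y R)"
  obtain N where N [simp]: "N \<in> fib C" "Dom C N = Dom C (src Q)" "Cod C N = Dom C ?vl"
    "?vl \<cdot> N = ends C ?x Q" "?vr \<cdot> N = phi"
    using F unfolding fibred_path_ob_def by auto
  note [simp] = cmp_eq[OF N(4)] cmp_eq[OF N(5)]
  have D [simp]: "h \<in> Arr C" "Dom C h = Dom C H" "Cod C h = Dom C (src R)"
    and hD: "ends C y R \<cdot> h = ends C y R \<cdot> (phi \<cdot> H)"
    using homotopicD[OF h] by simp_all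
  have "?s \<cdot> (ends C ?x Q \<cdot> H) = ends C y R \<cdot> (phi \<cdot> H)"
    by (rule pb_eqI[of y y]) simp_all
  then have eq: "?s \<cdot> (ends C ?x Q \<cdot> H) = ends C y R \<cdot> h" using hD by simp
  obtain m where m [simp]: "m \<in> Arr C" "Dom C m = Dom C H" "Cod C m = Dom C ?vl"
    "?vl \<cdot> m = ends C ?x Q \<cdot> H" "?vr \<cdot> m = h"
    by (rule pb_map[of ?s "ends C y R" "ends C ?x Q \<cdot> H" h]) (simp_all add: eq)
  have NH: "homotopic C ?vl (N \<cdot> H) m"
    by (rule homotopic_pullback[OF pb_is_pullback[of ?s "ends C y R"]]) (use h in simp_all)
  obtain H' where 1: "homotopic C (?vl \<cdot> N) H H'" and 2: "N \<cdot> H' = m"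
    by (rule homotopy_lifting[OF _ _ _ _ NH]) simp_all
  have "phi \<cdot> H' = ?vr \<cdot> (N \<cdot> H')" using homotopicD[OF 1] by simp
  also have "\<dots> = h" by (simp add: 2)
  finally show thesis using that 1 by simp
qed

text \<open>Two paths \<open>G\<close> and \<open>H\<close> with the same start and the same image in \<open>Y\<close> differ by a path \<open>K\<close> in a
  fibre of \<open>p\<close>. By \<open>fibred_path_ob_start\<close> the object of such pairs contracts onto its diagonal,
  where \<open>K\<close> can be taken constant.\<close>

lemma path_division:
  assumes F: "fibred_path_ob y p P Q phi" and P: "is_path_object C y P" and p: "p \<in> fib C"
    "Cod C p = Dom C y"
    and R: "is_path_object C p R" and c: "is_concat Q R Q c"
    and unit: "\<And>G. G \<in> Arr C \<Longrightarrow> Cod C G = pob C Q \<Longrightarrow> homotopic C (ends C (y \<cdot> p) Q)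
        (join Q R c G (rfl R \<cdot> (tgt Q \<cdot> G))) G"
    and GH: "G \<in> Arr C" "H \<in> Arr C" "Dom C H = Dom C G" "Cod C G = pob C Q" "Cod C H = pob C Q"
      "src Q \<cdot> G = src Q \<cdot> H" "phi \<cdot> G = phi \<cdot> H"
  obtains K where "K \<in> Arr C" "Dom C K = Dom C G" "Cod C K = Dom C (src R)" "src R \<cdot> K = tgt Q \<cdot> G"
    "tgt R \<cdot> K = tgt Q \<cdot> H"
    "homotopic C (ends C (y \<cdot> p) Q) (join Q R c G K) H"
proof -
  have y: "y \<in> fib C" by (rule path_ob_simps(1)[OF P])
  note f = fibred_path_ob_simps[OF F P p]
  note [simp] = y p path_ob_simps[OF P] path_ob_acyclic[OF P] f(1-7) path_ob_simps[OF f(8)]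
    path_ob_simps[OF R] GH(1-5)
  let ?x = "y \<cdot> p"
  obtain A where A [simp]: "A \<in> fib C" "A \<in> weq C" "Dom C A = Dom C (src Q)"
    "Cod C A = Dom C (prl C p (src P))"
    "\<And>t. t \<in> Arr C \<Longrightarrow> Cod C t = Dom C (src Q) \<Longrightarrow> prl C p (src P) \<cdot> (A \<cdot> t) = src Q \<cdot> t"
    "\<And>t. t \<in> Arr C \<Longrightarrow> Cod C t = Dom C (src Q) \<Longrightarrow> prr C p (src P) \<cdot> (A \<cdot> t) = phi \<cdot> t"
    using fibred_path_ob_start[OF F P p] by metis
  let ?l = "prl C A A" and ?r = "prr C A A"
  have AE: "src Q \<cdot> ?r = src Q \<cdot> ?l" "phi \<cdot> ?r = phi \<cdot> ?l"
  proof -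
    have "prl C p (src P) \<cdot> (A \<cdot> ?r) = prl C p (src P) \<cdot> (A \<cdot> ?l)" "prr C p (src P) \<cdot> (A \<cdot> ?r) =
        prr C p (src P) \<cdot> (A \<cdot> ?l)"
      by (simp_all only: pr_simps(6)[of A A, OF fib_arr[OF A(1)] A(1) refl])
    then show "src Q \<cdot> ?r = src Q \<cdot> ?l" "phi \<cdot> ?r = phi \<cdot> ?l" by (simp_all del: pr_simps(6))
  qed
  have "tgt P \<cdot> (phi \<cdot> ?r) = tgt P \<cdot> (phi \<cdot> ?l)" by (simp only: AE)
  then have pt: "p \<cdot> (tgt Q \<cdot> ?l) = p \<cdot> (tgt Q \<cdot> ?r)" by simp
  obtain d where d [simp]: "d \<in> Arr C" "Dom C d = Dom C (src Q)" "Cod C d = Dom C ?l"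
    "?l \<cdot> d = Idn C (Dom C (src Q))" "?r \<cdot> d = Idn C (Dom C (src Q))"
    by (rule pb_map[of A A "Idn C (Dom C (src Q))" "Idn C (Dom C (src Q))"]) simp_all
  have dw: "d \<in> weq C"
    by (rule section_weq[of ?l]) (use pr_fib(3)[of A A] in simp_all)
  obtain kp where kp [simp]: "kp \<in> Arr C" "Dom C kp = Dom C ?l" "Cod C kp = Dom C (src R)"
    "src R \<cdot> kp = tgt Q \<cdot> ?l" "tgt R \<cdot> kp = tgt Q \<cdot> ?r"
    and kd: "homotopic C (ends C p R) (kp \<cdot> d) (rfl R \<cdot> tgt Q)"
    by (rule path_extension[OF dw R, of "tgt Q \<cdot> ?l" "tgt Q \<cdot> ?r" "rfl R \<cdot> tgt Q"]) (simp_all add: pt)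
  note [simp] = cmp_eq[OF kp(4)] cmp_eq[OF kp(5)]
  have dd: "Dom C ?x = Dom C p" by simp
  note j = join_simps[OF c f(8) R f(8) dd]
  note j1 = j[of ?l kp]
  have jd: "join Q R c ?l kp \<cdot> d = join Q R c (Idn C (Dom C (src Q))) (kp \<cdot> d)"
    using j1(6)[of d] by simp
  have "homotopic C (ends C ?x Q) (join Q R c (Idn C (Dom C (src Q))) (kp \<cdot> d))
      (join Q R c (Idn C (Dom C (src Q))) (rfl R \<cdot> tgt Q))"
    by (rule join_cong_right[OF c f(8) R f(8) dd _ _ _ _ kd]) simp_all
  also have "homotopic C (ends C ?x Q) (join Q R c (Idn C (Dom C (src Q))) (rfl R \<cdot> tgt Q))
      (Idn C (Dom C (src Q)))"
    using unit[of "Idn C (Dom C (src Q))"] by simp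
  finally have "homotopic C (ends C ?x Q) (join Q R c ?l kp \<cdot> d) (?r \<cdot> d)"
    unfolding jd by simp
  then have U: "homotopic C (ends C ?x Q) (join Q R c ?l kp) ?r"
    by - (rule path_unique[OF dw f(8)], simp_all add: j1(1-5) AE)
  have eq: "A \<cdot> G = A \<cdot> H"
    by (rule pb_eqI[of p "src P"]) (use GH(6,7) in simp_all)
  obtain m where m [simp]: "m \<in> Arr C" "Dom C m = Dom C G" "Cod C m = Dom C ?l" "?l \<cdot> m = G" "?r \<cdot> m = H"
    by (rule pb_map[of A A G H]) (simp_all add: eq)
  have "homotopic C (ends C ?x Q) (join Q R c G (kp \<cdot> m)) H"
    using homotopic_pre[OF U, of m] j1 by simp
  then show thesis by (intro that[of "kp \<cdot> m"]) simp_all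
qed

section \<open>Base change\<close>

lemma base_change_simps:
  assumes "g \<in> fib C" "z \<in> Arr C" "Cod C z = Cod C g" "h \<in> Arr C" "Cod C h = Dom C z" "z \<cdot> h = a"
  shows "base_change C g a z h \<in> Arr C" "Dom C (base_change C g a z h) = Dom C (prl C a g)"
    "Cod C (base_change C g a z h) = Dom C (prl C z g)"
    "prl C z g \<cdot> base_change C g a z h = h \<cdot> prl C a g" "prr C z g \<cdot> base_change C g a z h = prr C a g"
    "\<And>x. x \<in> Arr C \<Longrightarrow> Cod C x = Dom C (prl C a g) \<Longrightarrow>
       prl C z g \<cdot> (base_change C g a z h \<cdot> x) = h \<cdot> (prl C a g \<cdot> x)"
    "\<And>x. x \<in> Arr C \<Longrightarrow> Cod C x = Dom C (prl C a g) \<Longrightarrow>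
       prr C z g \<cdot> (base_change C g a z h \<cdot> x) = prr C a g \<cdot> x"
proof -
  note [simp] = assms(1-5) assms(6)[symmetric]
  note p = pair_simps[of z g "h \<cdot> prl C (z \<cdot> h) g" "prr C (z \<cdot> h) g"]
  show "base_change C g a z h \<in> Arr C" "Dom C (base_change C g a z h) = Dom C (prl C a g)"
    "Cod C (base_change C g a z h) = Dom C (prl C z g)"
    "prl C z g \<cdot> base_change C g a z h = h \<cdot> prl C a g" "prr C z g \<cdot> base_change C g a z h = prr C a g"
    unfolding base_change_def by (simp_all add: p)
  fix x assume "x \<in> Arr C" "Cod C x = Dom C (prl C a g)"
  then show "prl C z g \<cdot> (base_change C g a z h \<cdot> x) = h \<cdot> (prl C a g \<cdot> x)"
    "prr C z g \<cdot> (base_change C g a z h \<cdot> x) = prr C a g \<cdot> x"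
    unfolding base_change_def by (simp_all add: p)
qed

lemma base_change_cmp:
  assumes "g \<in> fib C" "z \<in> Arr C" "Cod C z = Cod C g" "k \<in> Arr C" "Cod C k = Dom C z" "z \<cdot> k = b"
    "h \<in> Arr C" "Cod C h = Dom C k" "b \<cdot> h = a"
  shows "base_change C g a z (k \<cdot> h) = base_change C g b z k \<cdot> base_change C g a b h"
proof -
  have b: "b \<in> Arr C" "Cod C b = Cod C g" "Dom C b = Dom C k" using assms by auto
  have a: "a \<in> Arr C" "Cod C a = Cod C g" "Dom C a = Dom C h" using assms b by auto
  have zkh: "z \<cdot> (k \<cdot> h) = a" using cmp_eq[OF assms(6), of h] assms by simp
  note 1 = base_change_simps[OF assms(1-6)]
  note 2 = base_change_simps[of g b h a, OF assms(1) b(1,2) assms(7) _ assms(9)]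
  note 3 = base_change_simps[of g z "k \<cdot> h" a, OF assms(1-3) _ _ zkh]
  show ?thesis
    by (rule pb_eqI[of z g]) (use assms a b in \<open>simp_all add: 1 2 3\<close>)
qed

text \<open>Base change sends a section of an acyclic fibration to a section of an acyclic fibration. Inclusions
  of constant paths are of this form.\<close>

lemma base_change_weq:
  assumes g: "g \<in> fib C" and a: "a \<in> Arr C" "Cod C a = Cod C g"
    and q: "q \<in> fib C" "q \<in> weq C" "Cod C q = Dom C a" "d = a \<cdot> q"
    and l: "l \<in> Arr C" "Dom C l = Cod C q" "Cod C l = Dom C q" "q \<cdot> l = Idn C (Cod C q)"
  shows "base_change C g a d l \<in> weq C"
proof -
  have d: "d \<in> Arr C" "Dom C d = Dom C q" "Cod C d = Cod C g" and dl: "d \<cdot> l = a"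
    using q l a by simp_all
  note [simp] = g a q(1-3) l(1-3) d
  note b = base_change_simps[of g a q d, OF g a fib_arr[OF q(1)] q(3) q(4)[symmetric]]
  note c = base_change_simps[of g d l a, OF g d(1,3) l(1) _ dl]
  have dx: "a \<cdot> (q \<cdot> x) = d \<cdot> x" if "x \<in> Arr C" "Cod C x = Dom C q" for x
    using that q(4) by simp
  have "is_pullback C (prl C a g) q (base_change C g d a q) (prl C d g)"
  proof (rule is_pullbackI)
    fix u v assume uv [simp]: "u \<in> Arr C" "v \<in> Arr C" "Dom C v = Dom C u" "Cod C u = Dom C (prl C a g)"
      "Cod C v = Dom C q"
      and eq: "prl C a g \<cdot> u = q \<cdot> v"
    have "d \<cdot> v = a \<cdot> (prl C a g \<cdot> u)" by (simp add: eq dx)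
    then obtain m where [simp]: "m \<in> Arr C" "Dom C m = Dom C u" "Cod C m = Dom C (prl C d g)"
      and m [simp]: "prl C d g \<cdot> m = v" "prr C d g \<cdot> m = prr C a g \<cdot> u"
      using pb_map[of d g v "prr C a g \<cdot> u"] by auto
    have "base_change C g d a q \<cdot> m = u"
      by (rule pb_eqI[of a g]) (simp_all add: b eq)
    then show "\<exists>m. m \<in> Arr C \<and> Dom C m = Dom C u \<and> Cod C m = Dom C (base_change C g d a q) \<and>
        base_change C g d a q \<cdot> m = u \<and> prl C d g \<cdot> m = v"
      by (intro exI[of _ m]) (simp add: b)
  next
    fix m m'
    assume m: "m \<in> Arr C" "m' \<in> Arr C" "Dom C m' = Dom C m" "Cod C m = Dom C (base_change C g d a q)"
      "Cod C m' = Dom C (base_change C g d a q)"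
      and eq: "base_change C g d a q \<cdot> m' = base_change C g d a q \<cdot> m" "prl C d g \<cdot> m' = prl C d g \<cdot> m"
    have "prr C a g \<cdot> (base_change C g d a q \<cdot> m') = prr C a g \<cdot> (base_change C g d a q \<cdot> m)" by
      (simp only: eq)
    then have "prr C d g \<cdot> m' = prr C d g \<cdot> m" using m by (simp add: b)
    with m eq(2) show "m = m'" using pb_eqI[of d g m m'] by (simp add: b)
  qed (simp_all add: b)
  from pullback_acyclic_fib[OF this] have w: "base_change C g d a q \<in> weq C" using q by simp
  have "base_change C g d a q \<cdot> base_change C g a d l = Idn C (Dom C (prl C a g))"
    by (rule pb_eqI[of a g]) (simp_all add: b c cmp_eq[OF l(4)])
  then show ?thesis
    by (intro section_weq[OF w]) (simp_all add: b c)
qed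

text \<open>The end points of the base changed path object form a fibration since they are a pullback of those
  of \<open>P\<close>. The pullback square also carries over homotopies relative to the end points.\<close>

lemma base_change_path_object:
  assumes g: "g \<in> fib C" and P: "is_path_object C z P" and zg: "Cod C z = Cod C g"
  shows "is_path_object C (prr C z g) (base_change_path_ob C g z P)"
    and "\<exists>k. is_pullback C k (ends C z P) (ends C (prr C z g) (base_change_path_ob C g z P))
        (prl C (z \<cdot> src P) g)"
proof -
  note [simp] = g zg path_ob_simps[OF P] path_ob_acyclic[OF P] pr_fib(2)[of z g]
  let ?d = "z \<cdot> src P" and ?y = "prr C z g" and ?B = "base_change_path_ob C g z P"
  have dr: "?d \<cdot> rfl P = z" by simp
  have B: "rfl ?B = base_change C g z ?d (rfl P)" "src ?B = base_change C g ?d z (src P)"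
    "tgt ?B = base_change C g ?d z (tgt P)"
    by (simp_all add: base_change_path_ob_def)
  note r [simp] = base_change_simps[of g ?d "rfl P" z, OF _ _ _ _ _ dr, folded B]
  note s [simp] = base_change_simps[of g z "src P" ?d, OF _ _ _ _ _ refl, folded B]
  note t [simp] = base_change_simps[of g z "tgt P" ?d, folded B]
  note e = ends_simps[of ?y ?B]
  have e' [simp]: "ends C ?y ?B \<in> Arr C" "Dom C (ends C ?y ?B) = Dom C (prl C ?d g)"
    "Cod C (ends C ?y ?B) = Dom C (prl C ?y ?y)"
    "prl C ?y ?y \<cdot> ends C ?y ?B = src ?B" "prr C ?y ?y \<cdot> ends C ?y ?B = tgt ?B"
    "\<And>x. x \<in> Arr C \<Longrightarrow> Cod C x = Dom C (prl C ?d g) \<Longrightarrow> prl C ?y ?y \<cdot> (ends C ?y ?B \<cdot> x) = src ?B \<cdot> x"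
    "\<And>x. x \<in> Arr C \<Longrightarrow> Cod C x = Dom C (prl C ?d g) \<Longrightarrow> prr C ?y ?y \<cdot> (ends C ?y ?B \<cdot> x) = tgt ?B \<cdot> x"
    by (simp_all add: e)
  have yy: "?y \<cdot> prr C ?y ?y = ?y \<cdot> prl C ?y ?y" by simp
  have zyy: "z \<cdot> (prl C z g \<cdot> prl C ?y ?y) = z \<cdot> (prl C z g \<cdot> prr C ?y ?y)"
  proof -
    have "z \<cdot> (prl C z g \<cdot> prl C ?y ?y) = g \<cdot> (?y \<cdot> prl C ?y ?y)" by simp
    also have "\<dots> = g \<cdot> (?y \<cdot> prr C ?y ?y)" by (simp only: yy)
    also have "\<dots> = z \<cdot> (prl C z g \<cdot> prr C ?y ?y)" by (rule pr_simps(7)) simp_all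
    finally show ?thesis .
  qed
  obtain k where k [simp]: "k \<in> Arr C" "Dom C k = Dom C (prl C ?y ?y)" "Cod C k = Dom C (prl C z z)"
    "prl C z z \<cdot> k = prl C z g \<cdot> prl C ?y ?y" "prr C z z \<cdot> k = prl C z g \<cdot> prr C ?y ?y"
    "\<And>x. x \<in> Arr C \<Longrightarrow> Cod C x = Dom C (prl C ?y ?y) \<Longrightarrow> prl C z z \<cdot> (k \<cdot> x) = (prl C z g \<cdot> prl C ?y ?y) \<cdot> x"
    "\<And>x. x \<in> Arr C \<Longrightarrow> Cod C x = Dom C (prl C ?y ?y) \<Longrightarrow> prr C z z \<cdot> (k \<cdot> x) = (prl C z g \<cdot> prr C ?y ?y) \<cdot> x"
    by (rule pb_map[of z z "prl C z g \<cdot> prl C ?y ?y" "prl C z g \<cdot> prr C ?y ?y"]) (simp_all add: zyy)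
  have pbk: "is_pullback C k (ends C z P) (ends C ?y ?B) (prl C ?d g)"
  proof (rule is_pullbackI)
    show "k \<cdot> ends C ?y ?B = ends C z P \<cdot> prl C ?d g"
      by (rule pb_eqI[of z z]) simp_all
  next
    fix u v assume uv [simp]: "u \<in> Arr C" "v \<in> Arr C" "Dom C v = Dom C u" "Cod C u = Dom C k"
      "Cod C v = Dom C (ends C z P)"
      and eq: "k \<cdot> u = ends C z P \<cdot> v"
    have "prl C z z \<cdot> (k \<cdot> u) = prl C z z \<cdot> (ends C z P \<cdot> v)"
      "prr C z z \<cdot> (k \<cdot> u) = prr C z z \<cdot> (ends C z P \<cdot> v)"
      by (simp_all only: eq)
    then have 1: "src P \<cdot> v = prl C z g \<cdot> (prl C ?y ?y \<cdot> u)" "tgt P \<cdot> v = prl C z g \<cdot> (prr C ?y ?y \<cdot> u)"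
      by simp_all
    have "?d \<cdot> v = z \<cdot> (prl C z g \<cdot> (prl C ?y ?y \<cdot> u))" by (simp add: 1)
    also have "\<dots> = g \<cdot> (?y \<cdot> (prl C ?y ?y \<cdot> u))" by (rule pr_simps(7)[symmetric]) simp_all
    finally have 2: "?d \<cdot> v = g \<cdot> (?y \<cdot> (prl C ?y ?y \<cdot> u))" .
    obtain m where m [simp]: "m \<in> Arr C" "Dom C m = Dom C v" "Cod C m = Dom C (prl C ?d g)"
      "prl C ?d g \<cdot> m = v" "prr C ?d g \<cdot> m = ?y \<cdot> (prl C ?y ?y \<cdot> u)"
      by (rule pb_map[of ?d g v "?y \<cdot> (prl C ?y ?y \<cdot> u)"]) (use 2 in simp_all)
    have sm: "src ?B \<cdot> m = prl C ?y ?y \<cdot> u"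
      by (rule pb_eqI[of z g]) (simp_all add: 1)
    have tm: "tgt ?B \<cdot> m = prr C ?y ?y \<cdot> u"
      by (rule pb_eqI[of z g]) (simp_all add: 1)
    have "ends C ?y ?B \<cdot> m = u"
      by (rule pb_eqI[of ?y ?y]) (simp_all add: sm tm)
    then show "\<exists>m. m \<in> Arr C \<and> Dom C m = Dom C u \<and> Cod C m = Dom C (ends C ?y ?B) \<and> ends C ?y ?B \<cdot> m = u \<and>
        prl C ?d g \<cdot> m = v"
      by (intro exI[of _ m]) simp
  next
    fix m n
    assume m: "m \<in> Arr C" "n \<in> Arr C" "Dom C n = Dom C m" "Cod C m = Dom C (ends C ?y ?B)"
      "Cod C n = Dom C (ends C ?y ?B)"
      and eq: "ends C ?y ?B \<cdot> n = ends C ?y ?B \<cdot> m" "prl C ?d g \<cdot> n = prl C ?d g \<cdot> m"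
    have "prr C z g \<cdot> (prl C ?y ?y \<cdot> (ends C ?y ?B \<cdot> n)) = prr C z g \<cdot> (prl C ?y ?y \<cdot> (ends C ?y ?B \<cdot> m))"
      by (simp only: eq)
    then have "prr C ?d g \<cdot> n = prr C ?d g \<cdot> m" using m by simp
    with m eq(2) show "m = n" using pb_eqI[of ?d g m n] by simp
  qed simp_all
  then show "\<exists>k. is_pullback C k (ends C z P) (ends C ?y ?B) (prl C ?d g)" by blast
  have ef: "ends C ?y ?B \<in> fib C" by (rule pullback_fib[OF pbk]) simp
  have w: "rfl ?B \<in> weq C"
    unfolding B by (rule base_change_weq[of g z "src P"]) simp_all
  have sr: "src ?B \<cdot> rfl ?B = Idn C (Dom C (prl C z g))"
    by (rule pb_eqI[of z g]) simp_all
  have tr: "tgt ?B \<cdot> rfl ?B = Idn C (Dom C (prl C z g))"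
    by (rule pb_eqI[of z g]) simp_all
  show "is_path_object C ?y ?B"
    unfolding is_path_object_def hom_def using ef w by (simp add: sr tr)
qed

lemma base_change_homotopic:
  assumes g: "g \<in> fib C" and P: "is_path_object C z P" and zg: "Cod C z = Cod C g"
    and HK: "homotopic C (ends C z P) H K" and a: "z \<cdot> (src P \<cdot> H) = a"
  shows "homotopic C (ends C (prr C z g) (base_change_path_ob C g z P))
    (base_change C g a (z \<cdot> src P) H) (base_change C g a (z \<cdot> src P) K)"
proof -
  let ?B = "base_change_path_ob C g z P" and ?y = "prr C z g" and ?d = "z \<cdot> src P"
  have B: "is_path_object C ?y ?B" by (rule base_change_path_object(1)[OF g P zg])
  obtain k where pbk: "is_pullback C k (ends C z P) (ends C ?y ?B) (prl C ?d g)"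
    using base_change_path_object(2)[OF g P zg] by blast
  note E = homotopic_endsD[OF HK P]
  note [simp] = g zg path_ob_simps[OF P] path_ob_simps[OF B] E
  have D [simp]: "a \<in> Arr C" "Dom C a = Dom C H" "Cod C a = Cod C g" using a by auto
  have dB: "Dom C (src ?B) = Dom C (prl C ?d g)" "src ?B = base_change C g ?d z (src P)"
    "tgt ?B = base_change C g ?d z (tgt P)"
    by (simp_all add: base_change_path_ob_def base_change_simps)
  have bcs: "src ?B \<cdot> base_change C g a ?d k = base_change C g a z (src P \<cdot> k)"
    "tgt ?B \<cdot> base_change C g a ?d k = base_change C g a z (tgt P \<cdot> k)"
    if "k \<in> Arr C" "Cod C k = Dom C (src P)" "z \<cdot> (src P \<cdot> k) = a" for k
    unfolding dB
    by (rule base_change_cmp[symmetric], use that in simp_all)+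
  note b1 = base_change_simps[of g ?d H a] and b2 = base_change_simps[of g ?d K a]
  show ?thesis
  proof (rule homotopic_pullback[OF pbk])
    show "ends C ?y ?B \<cdot> base_change C g a ?d H = ends C ?y ?B \<cdot> base_change C g a ?d K"
      by (rule ends_eqI[OF B]) (simp_all add: a b1 b2 bcs dB(1))
    show "homotopic C (ends C z P) (prl C ?d g \<cdot> base_change C g a ?d H)
        (prl C ?d g \<cdot> base_change C g a ?d K)"
      using homotopic_pre[OF HK, of "prl C a g"] by (simp add: a b1 b2)
  qed (simp_all add: a b1 b2 dB(1))
qed

section \<open>Hom-groupoids\<close>

lemma hclass_eq: "homotopic C p h k \<Longrightarrow> hclass C p h = hclass C p k"
  unfolding hclass_def using homotopic_trans homotopic_sym by blast

lemma hclass_self: "p \<in> fib C \<Longrightarrow> h \<in> Arr C \<Longrightarrow> Cod C h = Dom C p \<Longrightarrow> h \<in> hclass C p h"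
  unfolding hclass_def using homotopic_refl by blast

lemma groupoid_ends:
  assumes P: "is_path_object C z P" and H: "H \<in> Arr C" "Cod C H = pob C P"
  shows "Dom (hom_groupoid C a z P) (hclass C (ends C z P) H) = src P \<cdot> H"
    and "Cod (hom_groupoid C a z P) (hclass C (ends C z P) H) = tgt P \<cdot> H"
proof -
  have "H \<in> hclass C (ends C z P) H"
    by (rule hclass_self) (use H path_ob_simps[OF P] in simp_all)
  moreover have "src P \<cdot> K = src P \<cdot> H \<and> tgt P \<cdot> K = tgt P \<cdot> H" if "K \<in> hclass C (ends C z P) H" for K
    using that homotopic_endsD(6,7)[OF _ P] unfolding hclass_def mem_Collect_eq by blast
  ultimately have "(\<lambda>H. src P \<cdot> H) ` hclass C (ends C z P) H = {src P \<cdot> H}"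
    "(\<lambda>H. tgt P \<cdot> H) ` hclass C (ends C z P) H = {tgt P \<cdot> H}"
    by blast+
  then show "Dom (hom_groupoid C a z P) (hclass C (ends C z P) H) = src P \<cdot> H"
    "Cod (hom_groupoid C a z P) (hclass C (ends C z P) H) = tgt P \<cdot> H"
    unfolding hom_groupoid_def by simp_all
qed

lemma groupoid_hom_iff:
  assumes P: "is_path_object C z P"
  shows "F \<in> hom (hom_groupoid C a z P) u u' \<longleftrightarrow>
    (\<exists>H. H \<in> Arr C \<and> Dom C H = Dom C a \<and> Cod C H = Dom C (src P) \<and> src P \<cdot> H = u \<and> tgt P \<cdot> H = u' \<and>
      z \<cdot> u = a \<and> F = hclass C (ends C z P) H)"
proof -
  have A: "F \<in> Arr (hom_groupoid C a z P) \<longleftrightarrow>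
    (\<exists>H. H \<in> Arr C \<and> Dom C H = Dom C a \<and> Cod C H = Dom C (src P) \<and> z \<cdot> (src P \<cdot> H) = a \<and> F = hclass C
      (ends C z P) H)"
    unfolding hom_groupoid_def hom_def by auto
  show ?thesis
    unfolding hom_def using groupoid_ends[OF P, of _ a] A by auto
qed

lemma groupoid_obj_iff:
  "u \<in> Obj (hom_groupoid C a z P) \<longleftrightarrow> u \<in> Arr C \<and> Dom C u = Dom C a \<and> Cod C u = Dom C z \<and> z \<cdot> u = a"
  unfolding hom_groupoid_def hom_def by auto

lemma path_concat_is_concat:
  assumes "path_concat C z P c"
  shows "is_concat P P P c" "homotopic C (ends C z P) (join P P c (rfl P) (rfl P)) (rfl P)"
  using assms unfolding path_concat_def is_concat_def join_def hom_def by auto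

lemma path_concat_ex:
  assumes P: "is_path_object C z P"
  obtains c where "path_concat C z P c"
proof -
  note [simp] = path_ob_simps[OF P]
  obtain c where c: "is_concat P P P c"
    and u: "\<And>G. G \<in> Arr C \<Longrightarrow> Cod C G = pob C P \<Longrightarrow> homotopic C (ends C z P)
        (join P P c G (rfl P \<cdot> (tgt P \<cdot> G))) G"
    by (rule concat_ex[OF P P, of "Idn C (Cod C z)"]) auto
  have "path_concat C z P c"
    using c u[of "rfl P"] unfolding path_concat_def is_concat_def join_def hom_def by simp
  then show thesis by (rule that)
qed

text \<open>The union that defines composition ranges over a single class, by congruence of concatenation.\<close>

lemma groupoid_cmp:
  assumes P: "is_path_object C z P" and HK: "H \<in> Arr C" "K \<in> Arr C" "Dom C K = Dom C H"
    "Cod C H = pob C P" "Cod C K = pob C P" "tgt P \<cdot> H = src P \<cdot> K"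
    and L: "\<And>c. path_concat C z P c \<Longrightarrow> homotopic C (ends C z P) (join P P c H K) L"
  shows "Cmp (hom_groupoid C a z P) (hclass C (ends C z P) K) (hclass C (ends C z P) H) =
      hclass C (ends C z P) L"
proof -
  let ?e = "ends C z P"
  note [simp] = path_ob_simps[OF P]
  have all: "hclass C ?e (join P P c H' K') = hclass C ?e L"
    if H': "H' \<in> hclass C ?e H" and K': "K' \<in> hclass C ?e K" and c: "path_concat C z P c" for H' K' c
  proof -
    have h: "homotopic C ?e H H'" and k: "homotopic C ?e K K'" using H' K' by (auto simp: hclass_def)
    note hD = homotopic_endsD[OF h P] and kD = homotopic_endsD[OF k P]
    note c' = path_concat_is_concat(1)[OF c]
    have "homotopic C ?e (join P P c H' K') (join P P c H' K)"
      by (rule homotopic_sym, rule join_cong_right[OF c' P P P refl _ _ _ _ k]) (use hD kD HK in simp_all)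
    also have "homotopic C ?e (join P P c H' K) (join P P c H K)"
      by (rule homotopic_sym, rule join_cong_left[OF c' P P P refl _ _ _ _ h]) (use hD kD HK in simp_all)
    also have "homotopic C ?e (join P P c H K) L" by (rule L[OF c])
    finally show ?thesis by (rule hclass_eq)
  qed
  obtain c where c: "path_concat C z P c" using path_concat_ex[OF P] .
  have "H \<in> hclass C ?e H" "K \<in> hclass C ?e K" using HK by (simp_all add: hclass_self)
  then have "{hclass C ?e (join P P c H' K') | H' K' c. H' \<in> hclass C ?e H \<and> K' \<in> hclass C ?e K \<and>
      path_concat C z P c}
      = {hclass C ?e L}"
    using all c by blast
  then show ?thesis unfolding hom_groupoid_def join_def by simp
qed

text \<open>The inverse is the reversed path; that it is inverse to the given one is clear for constant paths
  and follows in general by path induction.\<close>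

lemma groupoid_isomorphism:
  assumes P: "is_path_object C z P" and H: "H \<in> Arr C" "Dom C H = Dom C a" "Cod C H = pob C P"
    "z \<cdot> (src P \<cdot> H) = a"
  shows "isomorphism (hom_groupoid C a z P) (hclass C (ends C z P) H)"
proof -
  note [simp] = path_ob_simps[OF P] H(1,3)
  let ?e = "ends C z P"
  obtain i where [simp]: "i \<in> Arr C" "Dom C i = Dom C (src P)" "Cod C i = Dom C (src P)"
    and i [simp]: "src P \<cdot> i = tgt P" "tgt P \<cdot> i = src P" and ir: "homotopic C ?e (i \<cdot> rfl P) (rfl P)"
    by (rule path_extension[OF path_ob_rfl_weq[OF P] P, of "tgt P" "src P" "rfl P"]) auto
  note [simp] = cmp_eq[OF i(1)] cmp_eq[OF i(2)]
  let ?id = "Idn C (Dom C (src P))"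
  have 1: "homotopic C ?e (join P P c H (i \<cdot> H)) (rfl P \<cdot> (src P \<cdot> H))" if c: "path_concat C z P c" for c
  proof -
    note c' = path_concat_is_concat[OF c]
    note j = join_simps[OF c'(1) P P P refl]
    have "homotopic C ?e (join P P c (rfl P) (i \<cdot> rfl P)) (join P P c (rfl P) (rfl P))"
      by (rule join_cong_right[OF c'(1) P P P refl _ _ _ _ ir]) simp_all
    also note c'(2)
    finally have "homotopic C ?e (join P P c ?id i) (rfl P \<cdot> src P)"
      by - (rule path_unique[OF path_ob_rfl_weq[OF P] P], simp_all add: j)
    from homotopic_pre[OF this, of H] show ?thesis by (simp add: j)
  qed
  have 2: "homotopic C ?e (join P P c (i \<cdot> H) H) (rfl P \<cdot> (tgt P \<cdot> H))" if c: "path_concat C z P c" for c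
  proof -
    note c' = path_concat_is_concat[OF c]
    note j = join_simps[OF c'(1) P P P refl]
    have "homotopic C ?e (join P P c (i \<cdot> rfl P) (rfl P)) (join P P c (rfl P) (rfl P))"
      by (rule join_cong_left[OF c'(1) P P P refl _ _ _ _ ir]) simp_all
    also note c'(2)
    finally have "homotopic C ?e (join P P c i ?id) (rfl P \<cdot> tgt P)"
      by - (rule path_unique[OF path_ob_rfl_weq[OF P] P], simp_all add: j)
    from homotopic_pre[OF this, of H] show ?thesis by (simp add: j)
  qed
  let ?E = "hom_groupoid C a z P" and ?k = "hclass C ?e (i \<cdot> H)" and ?h = "hclass C ?e H"
  have I: "Idn ?E u = hclass C ?e (rfl P \<cdot> u)" for u unfolding hom_groupoid_def by simp
  have "?h \<in> hom ?E (src P \<cdot> H) (tgt P \<cdot> H)"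
    unfolding groupoid_hom_iff[OF P] using H by (intro exI[of _ H]) simp
  moreover have "?k \<in> hom ?E (tgt P \<cdot> H) (src P \<cdot> H)"
    unfolding groupoid_hom_iff[OF P] using H by (intro exI[of _ "i \<cdot> H"]) simp
  moreover have "Cmp ?E ?k ?h = Idn ?E (src P \<cdot> H)"
    unfolding I by (rule groupoid_cmp[OF P _ _ _ _ _ _ 1]) simp_all
  moreover have "Cmp ?E ?h ?k = Idn ?E (tgt P \<cdot> H)"
    unfolding I by (rule groupoid_cmp[OF P _ _ _ _ _ _ 2]) simp_all
  ultimately show ?thesis
    unfolding isomorphism_def by (auto simp: hom_def)
qed

section \<open>Essential surjectivity and fullness as lifting properties\<close>

text \<open>What the weak and the strong \<open>\<Pi>\<close>-types have in common apart from the conditions on hom-groupoids,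
  together with the conditions on the given fibrations.\<close>

definition pi_data :: "'a \<Rightarrow> 'a \<Rightarrow> 'a \<Rightarrow> 'a \<Rightarrow> bool" where
  "pi_data f g pi e \<longleftrightarrow> f \<in> fib C \<and> g \<in> fib C \<and> Cod C f = Dom C g \<and> pi \<in> fib C \<and> Cod C pi = Cod C g \<and>
     e \<in> Arr C \<and> Dom C e = pb C pi g \<and> Cod C e = Dom C f \<and> f \<cdot> e = prr C pi g"

lemma pi_data_simps:
  assumes "pi_data f g pi e"
  shows "f \<in> fib C" "g \<in> fib C" "Cod C f = Dom C g" "pi \<in> fib C" "Cod C pi = Cod C g"
    "e \<in> Arr C" "Dom C e = Dom C (prl C pi g)" "Cod C e = Dom C f" "f \<cdot> e = prr C pi g"
    "\<And>x. x \<in> Arr C \<Longrightarrow> Cod C x = Dom C (prl C pi g) \<Longrightarrow> f \<cdot> (e \<cdot> x) = prr C pi g \<cdot> x"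
proof -
  show *: "f \<in> fib C" "g \<in> fib C" "Cod C f = Dom C g" "pi \<in> fib C" "Cod C pi = Cod C g"
    "e \<in> Arr C" "Dom C e = Dom C (prl C pi g)" "Cod C e = Dom C f" "f \<cdot> e = prr C pi g"
    using assms unfolding pi_data_def by auto
  show "\<And>x. x \<in> Arr C \<Longrightarrow> Cod C x = Dom C (prl C pi g) \<Longrightarrow> f \<cdot> (e \<cdot> x) = prr C pi g \<cdot> x"
    using cmp_eq[OF *(9)] * by simp
qed

text \<open>Essential surjectivity at \<open>a\<close>, expressed by maps and homotopies.\<close>

definition lifts_points :: "'a \<Rightarrow> 'a \<Rightarrow> 'a \<Rightarrow> 'a \<Rightarrow> 'a \<Rightarrow> bool" where
  "lifts_points f g pi e a \<longleftrightarrow>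
     (\<forall>v. v \<in> Arr C \<and> Dom C v = Dom C (prl C a g) \<and> Cod C v = Dom C f \<and> f \<cdot> v = prr C a g \<longrightarrow>
       (\<exists>u. u \<in> Arr C \<and> Dom C u = Dom C a \<and> Cod C u = Dom C pi \<and> pi \<cdot> u = a \<and>
          homotopic C f (e \<cdot> base_change C g a pi u) v))"

text \<open>Fullness at \<open>a\<close>, expressed by representatives of arrows, for a map \<open>w\<close> on paths induced by \<open>e\<close>.\<close>

definition lifts_paths ::
  "'a \<Rightarrow> 'a \<Rightarrow> 'a \<Rightarrow> 'a \<Rightarrow> 'a path_ob \<Rightarrow> 'a path_ob \<Rightarrow> 'a \<Rightarrow> 'a \<Rightarrow> bool" where
  "lifts_paths f g pi e P Q w a \<longleftrightarrow>
     (\<forall>u u' H. u \<in> Arr C \<and> Dom C u = Dom C a \<and> Cod C u = Dom C pi \<and> pi \<cdot> u = a \<and>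
        u' \<in> Arr C \<and> Dom C u' = Dom C a \<and> Cod C u' = Dom C pi \<and> pi \<cdot> u' = a \<and>
        H \<in> Arr C \<and> Dom C H = Dom C (prl C a g) \<and> Cod C H = Dom C (src Q) \<and>
        src Q \<cdot> H = e \<cdot> base_change C g a pi u \<and> tgt Q \<cdot> H = e \<cdot> base_change C g a pi u' \<longrightarrow>
       (\<exists>h. h \<in> Arr C \<and> Dom C h = Dom C a \<and> Cod C h = Dom C (src P) \<and> src P \<cdot> h = u \<and> tgt P \<cdot> h = u' \<and>
          homotopic C (ends C f Q) (w \<cdot> base_change C g a (pi \<cdot> src P) h) H))"

text \<open>Composition with a representing path map computes the functor on arrows, because base change and
  path maps respect homotopy relative to the end points.\<close>

lemma Pi_functor_arr:
  assumes D: "pi_data f g pi e" and P: "is_path_object C pi P" and Q: "is_path_object C f Q"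
    and w: "path_map C (base_change_path_ob C g pi P) f Q e w"
    and a: "a \<in> Arr C" and h: "h \<in> Arr C" "Dom C h = Dom C a" "Cod C h = Dom C (src P)"
      "pi \<cdot> (src P \<cdot> h) = a"
  shows "on_arr (Pi_functor C f g pi e a P Q) (hclass C (ends C pi P) h) =
      hclass C (ends C f Q) (w \<cdot> base_change C g a (pi \<cdot> src P) h)"
proof -
  note d [simp] = pi_data_simps[OF D]
  let ?B = "base_change_path_ob C g pi P" and ?y = "prr C pi g" and ?d = "pi \<cdot> src P"
  have B: "is_path_object C ?y ?B" by (rule base_change_path_object(1)[OF d(2) P d(5)])
  note [simp] = path_ob_simps[OF P] path_ob_simps[OF Q] path_ob_simps[OF B] a h(1-3)
  have dB: "Dom C (src ?B) = Dom C (prl C ?d g)"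
    by (simp add: base_change_path_ob_def base_change_simps)
  have hom_bc: "homotopic C (ends C ?y ?B) (base_change C g a ?d h) (base_change C g a ?d k)"
    if "homotopic C (ends C pi P) h k" for k
    by (rule base_change_homotopic[OF _ P _ that h(4)]) simp_all
  let ?h = "base_change C g a ?d h"
  have hT [simp]: "?h \<in> Arr C" "Cod C ?h = Dom C (src ?B)"
    using base_change_simps[of g ?d h a] h(4) dB by simp_all
  have 1: "on_arr (pullback_functor C g a pi P) (hclass C (ends C pi P) h) = hclass C (ends C ?y ?B) ?h"
  proof -
    have "h \<in> hclass C (ends C pi P) h" by (rule hclass_self) simp_all
    moreover have "hclass C (ends C ?y ?B) (base_change C g a ?d k) = hclass C (ends C ?y ?B) ?h"
      if "k \<in> hclass C (ends C pi P) h" for k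
      using hclass_eq[OF hom_bc[of k]] that unfolding hclass_def by simp
    ultimately have "{hclass C (ends C ?y ?B) (base_change C g a ?d k) | k. k \<in> hclass C
        (ends C pi P) h} = {hclass C (ends C ?y ?B) ?h}"
      by blast
    then show ?thesis unfolding pullback_functor_def by simp
  qed
  have 2: "on_arr (postcomp C ?B f Q e) (hclass C (ends C ?y ?B) ?h) = hclass C (ends C f Q) (w \<cdot> ?h)"
  proof -
    have "?h \<in> hclass C (ends C ?y ?B) ?h" by (rule hclass_self) simp_all
    moreover have "hclass C (ends C f Q) (w' \<cdot> k) = hclass C (ends C f Q) (w \<cdot> ?h)"
      if k: "k \<in> hclass C (ends C ?y ?B) ?h" and w': "path_map C ?B f Q e w'" for k w'
    proof -
      have hk: "homotopic C (ends C ?y ?B) ?h k" using k unfolding hclass_def by simp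
      have "homotopic C (ends C f Q) (w \<cdot> ?h) (w' \<cdot> ?h)"
        by (rule homotopic_pre[OF path_map_unique[OF B Q _ _ _ w w']])
          (use path_map_simps[OF w B Q] in simp_all)
      also have "homotopic C (ends C f Q) (w' \<cdot> ?h) (w' \<cdot> k)"
        by (rule path_map_homotopic[OF B Q _ _ _ _ _ _ _ w' hk, of "Idn C (Cod C f)"]) simp_all
      finally show ?thesis using hclass_eq by blast
    qed
    ultimately have "{hclass C (ends C f Q) (w' \<cdot> k) | k w'. k \<in> hclass C (ends C ?y ?B) ?h \<and>
        path_map C ?B f Q e w'} = {hclass C (ends C f Q) (w \<cdot> ?h)}"
      using w by blast
    then show ?thesis unfolding postcomp_def by simp
  qed
  show ?thesis unfolding Pi_functor_def funct_comp_def by (simp add: 1 2)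
qed

lemma Pi_functor_obj: "on_obj (Pi_functor C f g pi e a P Q) u = e \<cdot> base_change C g a pi u"
  unfolding Pi_functor_def funct_comp_def postcomp_def pullback_functor_def by simp

lemma Pi_functor_obj_typing:
  assumes D: "pi_data f g pi e" and u: "u \<in> Arr C" "Dom C u = Dom C a" "Cod C u = Dom C pi" "pi \<cdot> u = a"
  shows "e \<cdot> base_change C g a pi u \<in> Arr C" "Dom C (e \<cdot> base_change C g a pi u) = Dom C (prl C a g)"
    "Cod C (e \<cdot> base_change C g a pi u) = Dom C f" "f \<cdot> (e \<cdot> base_change C g a pi u) = prr C a g"
  using u base_change_simps[of g pi u a] pi_data_simps[OF D] by simp_all

text \<open>Every arrow of a hom-groupoid is invertible, so isomorphic objects are the same as homotopic maps.\<close>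

lemma essentially_surjective_iff:
  assumes D: "pi_data f g pi e" and P: "is_path_object C pi P" and Q: "is_path_object C f Q"
    and a: "a \<in> Arr C" "Cod C a = Cod C g"
  shows "essentially_surjective (hom_groupoid C a pi P) (hom_groupoid C (prr C a g) f Q)
      (Pi_functor C f g pi e a P Q)
    \<longleftrightarrow> lifts_points f g pi e a"
proof -
  note [simp] = pi_data_simps[OF D] a path_ob_simps[OF Q]
  let ?E = "hom_groupoid C (prr C a g) f Q"
  have "(\<exists>k \<in> hom ?E (e \<cdot> base_change C g a pi u) v. isomorphism ?E k) \<longleftrightarrow>
      homotopic C f (e \<cdot> base_change C g a pi u) v"
    if u: "u \<in> Arr C" "Dom C u = Dom C a" "Cod C u = Dom C pi" "pi \<cdot> u = a" for u v
  proof
    assume "\<exists>k \<in> hom ?E (e \<cdot> base_change C g a pi u) v. isomorphism ?E k"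
    then obtain k where "k \<in> hom ?E (e \<cdot> base_change C g a pi u) v" by blast
    then obtain H where "H \<in> Arr C" "Cod C H = Dom C (src Q)" "src Q \<cdot> H = e \<cdot> base_change C g a pi u"
      "tgt Q \<cdot> H = v"
      unfolding groupoid_hom_iff[OF Q] by blast
    then show "homotopic C f (e \<cdot> base_change C g a pi u) v" using homotopicI[OF Q] by simp
  next
    note t = Pi_functor_obj_typing[OF D u]
    assume "homotopic C f (e \<cdot> base_change C g a pi u) v"
    then obtain H where H: "H \<in> Arr C" "Dom C H = Dom C (e \<cdot> base_change C g a pi u)" "Cod C H = pob C Q"
        "src Q \<cdot> H = e \<cdot> base_change C g a pi u" "tgt Q \<cdot> H = v"
      using homotopicE[OF _ Q] by metis
    have DH: "Dom C H = Dom C (prr C a g)" using H(2) t(2) by simp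
    have "isomorphism ?E (hclass C (ends C f Q) H)"
      by (rule groupoid_isomorphism[OF Q H(1) DH H(3)]) (use H(4) t in simp)
    moreover have "hclass C (ends C f Q) H \<in> hom ?E (e \<cdot> base_change C g a pi u) v"
      unfolding groupoid_hom_iff[OF Q] using H DH t(4) by (intro exI[of _ H]) simp
    ultimately show "\<exists>k \<in> hom ?E (e \<cdot> base_change C g a pi u) v. isomorphism ?E k" by blast
  qed
  then have ex: "(\<exists>u \<in> Obj (hom_groupoid C a pi P). \<exists>k \<in> hom ?E (on_obj (Pi_functor C f g pi e a P Q) u)
      v. isomorphism ?E k) \<longleftrightarrow>
      (\<exists>u. u \<in> Arr C \<and> Dom C u = Dom C a \<and> Cod C u = Dom C pi \<and> pi \<cdot> u = a \<and>
         homotopic C f (e \<cdot> base_change C g a pi u) v)" for v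
    unfolding Pi_functor_obj Bex_def[of "Obj (hom_groupoid C a pi P)"] groupoid_obj_iff by blast
  show ?thesis
    unfolding essentially_surjective_def lifts_points_def Ball_def ex groupoid_obj_iff by simp
qed

text \<open>An arrow hits the class of \<open>H\<close> exactly if its representative is homotopic to \<open>H\<close> relative to the end
  points.\<close>

lemma full_iff:
  assumes D: "pi_data f g pi e" and P: "is_path_object C pi P" and Q: "is_path_object C f Q"
    and w: "path_map C (base_change_path_ob C g pi P) f Q e w"
    and a: "a \<in> Arr C" "Cod C a = Cod C g"
  shows "full (hom_groupoid C a pi P) (hom_groupoid C (prr C a g) f Q) (Pi_functor C f g pi e a P Q)
    \<longleftrightarrow> lifts_paths f g pi e P Q w a"
proof -
  note d [simp] = pi_data_simps[OF D]
  note [simp] = a path_ob_simps[OF Q] path_ob_simps[OF P]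
  let ?D = "hom_groupoid C a pi P" and ?E = "hom_groupoid C (prr C a g) f Q" and ?F =
    "Pi_functor C f g pi e a P Q"
  let ?b = "\<lambda>u. e \<cdot> base_change C g a pi u"
  have B: "is_path_object C (prr C pi g) (base_change_path_ob C g pi P)"
    by (rule base_change_path_object(1)[OF d(2) P d(5)])
  have arr: "on_arr ?F (hclass C (ends C pi P) h) = hclass C (ends C f Q) H \<longleftrightarrow>
      homotopic C (ends C f Q) (w \<cdot> base_change C g a (pi \<cdot> src P) h) H"
    if h: "h \<in> Arr C" "Dom C h = Dom C a" "Cod C h = Dom C (src P)" "pi \<cdot> (src P \<cdot> h) = a"
      and H: "H \<in> Arr C" "Cod C H = Dom C (src Q)" for h H
  proof -
    have "H \<in> hclass C (ends C f Q) H" by (rule hclass_self) (use H in simp_all)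
    then show ?thesis
      unfolding Pi_functor_arr[OF D P Q w a(1) h]
      using hclass_eq by (metis hclass_def mem_Collect_eq)
  qed
  show ?thesis
  proof
    assume full: "full ?D ?E ?F"
    show "lifts_paths f g pi e P Q w a"
      unfolding lifts_paths_def
    proof (intro allI impI, elim conjE)
      fix u u' H
      assume u: "u \<in> Arr C" "Dom C u = Dom C a" "Cod C u = Dom C pi" "pi \<cdot> u = a"
        and u': "u' \<in> Arr C" "Dom C u' = Dom C a" "Cod C u' = Dom C pi" "pi \<cdot> u' = a"
        and H: "H \<in> Arr C" "Dom C H = Dom C (prl C a g)" "Cod C H = Dom C (src Q)" "src Q \<cdot> H = ?b u"
          "tgt Q \<cdot> H = ?b u'"
      have "hclass C (ends C f Q) H \<in> hom ?E (on_obj ?F u) (on_obj ?F u')"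
        unfolding groupoid_hom_iff[OF Q] Pi_functor_obj
        using H Pi_functor_obj_typing(4)[OF D u] by (intro exI[of _ H]) simp
      moreover have "u \<in> Obj ?D" "u' \<in> Obj ?D" unfolding groupoid_obj_iff using u u' by simp_all
      ultimately obtain F where F: "F \<in> hom ?D u u'" and eq: "on_arr ?F F = hclass C (ends C f Q) H"
        using full unfolding full_def by blast
      obtain h where h: "h \<in> Arr C" "Dom C h = Dom C a" "Cod C h = Dom C (src P)" "src P \<cdot> h = u"
        "tgt P \<cdot> h = u'"
        and Fh: "F = hclass C (ends C pi P) h"
        using F unfolding groupoid_hom_iff[OF P] by blast
      have "homotopic C (ends C f Q) (w \<cdot> base_change C g a (pi \<cdot> src P) h) H"
        using arr[OF h(1-3) _ H(1,3)] eq Fh h(4) u(4) by simp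
      with h show "\<exists>h. h \<in> Arr C \<and> Dom C h = Dom C a \<and> Cod C h = Dom C (src P) \<and> src P \<cdot> h = u \<and>
          tgt P \<cdot> h = u' \<and>
          homotopic C (ends C f Q) (w \<cdot> base_change C g a (pi \<cdot> src P) h) H" by blast
    qed
  next
    assume lift: "lifts_paths f g pi e P Q w a"
    show "full ?D ?E ?F"
      unfolding full_def
    proof (intro ballI)
      fix u u' k
      assume "u \<in> Obj ?D" "u' \<in> Obj ?D" and k: "k \<in> hom ?E (on_obj ?F u) (on_obj ?F u')"
      then have u: "u \<in> Arr C" "Dom C u = Dom C a" "Cod C u = Dom C pi" "pi \<cdot> u = a"
        and u': "u' \<in> Arr C" "Dom C u' = Dom C a" "Cod C u' = Dom C pi" "pi \<cdot> u' = a"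
        unfolding groupoid_obj_iff by simp_all
      obtain H where H: "H \<in> Arr C" "Dom C H = Dom C (prl C a g)" "Cod C H = Dom C (src Q)"
        "src Q \<cdot> H = ?b u" "tgt Q \<cdot> H = ?b u'"
        and kH: "k = hclass C (ends C f Q) H"
        using k unfolding groupoid_hom_iff[OF Q] Pi_functor_obj by auto
      obtain h where h: "h \<in> Arr C" "Dom C h = Dom C a" "Cod C h = Dom C (src P)" "src P \<cdot> h = u"
        "tgt P \<cdot> h = u'"
        and hH: "homotopic C (ends C f Q) (w \<cdot> base_change C g a (pi \<cdot> src P) h) H"
        using lift u u' H unfolding lifts_paths_def by blast
      have "on_arr ?F (hclass C (ends C pi P) h) = k"
        using arr[OF h(1-3) _ H(1,3)] hH kH h(4) u(4) by simp
      moreover have "hclass C (ends C pi P) h \<in> hom ?D u u'"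
        unfolding groupoid_hom_iff[OF P] using h u by (intro exI[of _ h]) simp
      ultimately show "\<exists>h \<in> hom ?D u u'. on_arr ?F h = k" by blast
    qed
  qed
qed

lemma weak_Pi_type_iff:
  assumes "f \<in> fib C" "g \<in> fib C" "Cod C f = Dom C g"
  shows "weak_Pi_type C f g pi e \<longleftrightarrow>
    pi_data f g pi e \<and> (\<forall>a. a \<in> Arr C \<and> Cod C a = Cod C g \<longrightarrow> lifts_points f g pi e a)"
proof -
  have "weak_Pi_type C f g pi e \<longleftrightarrow> pi_data f g pi e \<and>
     (\<forall>a \<in> Arr C. Cod C a = Cod C g \<longrightarrow>
       (\<forall>P Q. is_path_object C pi P \<longrightarrow> is_path_object C f Q \<longrightarrow>
         essentially_surjective (hom_groupoid C a pi P) (hom_groupoid C (prr C a g) f Q)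
           (Pi_functor C f g pi e a P Q)))"
    using assms unfolding weak_Pi_type_def pi_data_def hom_def by auto
  also have "\<dots> \<longleftrightarrow> pi_data f g pi e \<and> (\<forall>a. a \<in> Arr C \<and> Cod C a = Cod C g \<longrightarrow> lifts_points f g pi e a)"
    using essentially_surjective_iff path_object_ex pi_data_simps(1,4) by meson
  finally show ?thesis .
qed

lemma strong_Pi_type_iff:
  assumes "f \<in> fib C" "g \<in> fib C" "Cod C f = Dom C g"
  shows "strong_Pi_type C f g pi e \<longleftrightarrow> weak_Pi_type C f g pi e \<and>
    (\<forall>P Q a. is_path_object C pi P \<longrightarrow> is_path_object C f Q \<longrightarrow> a \<in> Arr C \<longrightarrow> Cod C a = Cod C g \<longrightarrow>
      full (hom_groupoid C a pi P) (hom_groupoid C (prr C a g) f Q) (Pi_functor C f g pi e a P Q))"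
  unfolding strong_Pi_type_def weak_Pi_type_def by blast

lemma Pi_path_map_ex:
  assumes D: "pi_data f g pi e" and P: "is_path_object C pi P" and Q: "is_path_object C f Q"
  obtains w where "path_map C (base_change_path_ob C g pi P) f Q e w"
proof -
  note d [simp] = pi_data_simps[OF D]
  show thesis
    by (rule path_map_ex[OF base_change_path_object(1)[OF d(2) P d(5)] Q, of e "Idn C (Dom C g)"])
      (use that in simp_all)
qed

lemma base_change_path_map:
  assumes g: "g \<in> fib C" and P: "is_path_object C z P" and P': "is_path_object C y P'"
    and zg: "Cod C z = Cod C g" and e: "e \<in> Arr C" "Dom C e = Dom C z" "Cod C e = Dom C y" "y \<cdot> e = z"
    and w: "path_map C P y P' e w"
  shows "path_map C (base_change_path_ob C g z P) (prr C y g) (base_change_path_ob C g y P')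
    (base_change C g z y e) (base_change C g (z \<cdot> src P) (y \<cdot> src P') w)"
proof -
  note [simp] = path_ob_simps[OF P] path_ob_simps[OF P'] g zg e path_map_simps[OF w P P']
  have [simp]: "Cod C y = Cod C g" using e zg by (metis cmp_cod fib_arr path_ob_simps(1)[OF P'])
  let ?d = "z \<cdot> src P" and ?d' = "y \<cdot> src P'"
  let ?B = "base_change_path_ob C g z P" and ?B' = "base_change_path_ob C g y P'"
  let ?w = "base_change C g ?d ?d' w"
  have ye: "y \<cdot> (e \<cdot> t) = z \<cdot> t" if "t \<in> Arr C" "Cod C t = Dom C z" for t
    using cmp_eq[OF e(4), of t] that by simp
  note [simp] = ye
  have B: "rfl ?B = base_change C g z ?d (rfl P)" "src ?B = base_change C g ?d z (src P)"
    "tgt ?B = base_change C g ?d z (tgt P)"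
    "rfl ?B' = base_change C g y ?d' (rfl P')" "src ?B' = base_change C g ?d' y (src P')"
      "tgt ?B' = base_change C g ?d' y (tgt P')"
    by (simp_all add: base_change_path_ob_def)
  note b = base_change_simps
  have 1: "src ?B' \<cdot> ?w = base_change C g z y e \<cdot> src ?B"
    unfolding B base_change_cmp[symmetric, of g y "src P'" ?d' w ?d, simplified]
      base_change_cmp[symmetric, of g y e z "src P" ?d, simplified] by simp
  have 2: "tgt ?B' \<cdot> ?w = base_change C g z y e \<cdot> tgt ?B"
    unfolding B base_change_cmp[symmetric, of g y "tgt P'" ?d' w ?d, simplified]
      base_change_cmp[symmetric, of g y e z "tgt P" ?d, simplified] by simp
  have 3: "?w \<cdot> rfl ?B = base_change C g z ?d' (w \<cdot> rfl P)"
    unfolding B by (rule base_change_cmp[symmetric]) simp_all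
  have 4: "rfl ?B' \<cdot> base_change C g z y e = base_change C g z ?d' (rfl P' \<cdot> e)"
    unfolding B by (rule base_change_cmp[symmetric]) simp_all
  have 5: "homotopic C (ends C (prr C y g) ?B') (base_change C g z ?d' (w \<cdot> rfl P))
      (base_change C g z ?d' (rfl P' \<cdot> e))"
    by (rule base_change_homotopic[OF g P' _ path_map_rfl[OF w]]) simp_all
  have 6: "?w \<in> Arr C" "Dom C ?w = Dom C (src ?B)" "Cod C ?w = Dom C (src ?B')"
    unfolding B by (simp_all add: b)
  show ?thesis unfolding path_map_def hom_def 3 4 using 1 2 5 6 by simp
qed

lemma path_map_id:
  assumes P: "is_path_object C z P"
  shows "path_map C P z P (Idn C (Dom C z)) (Idn C (pob C P))"
  unfolding path_map_def hom_def using path_ob_simps[OF P] by (simp add: homotopic_refl)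

lemma base_change_id:
  assumes "g \<in> fib C" "z \<in> Arr C" "Cod C z = Cod C g"
  shows "base_change C g z z (Idn C (Dom C z)) = Idn C (Dom C (prl C z g))"
  by (rule pb_eqI[of z g]) (use assms base_change_simps[of g z "Idn C (Dom C z)" z] in simp_all)

lemma lifts_pathsD:
  assumes "lifts_paths f g pi e P Q w a"
    and "u \<in> Arr C" "Dom C u = Dom C a" "Cod C u = Dom C pi" "pi \<cdot> u = a"
    and "u' \<in> Arr C" "Dom C u' = Dom C a" "Cod C u' = Dom C pi" "pi \<cdot> u' = a"
    and "H \<in> Arr C" "Dom C H = Dom C (prl C a g)" "Cod C H = Dom C (src Q)"
    and "src Q \<cdot> H = e \<cdot> base_change C g a pi u" "tgt Q \<cdot> H = e \<cdot> base_change C g a pi u'"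
  obtains h where "h \<in> Arr C" "Dom C h = Dom C a" "Cod C h = Dom C (src P)" "src P \<cdot> h = u"
    "tgt P \<cdot> h = u'"
    "homotopic C (ends C f Q) (w \<cdot> base_change C g a (pi \<cdot> src P) h) H"
  using assms unfolding lifts_paths_def by blast

text \<open>Fullness does not depend on the path objects: path maps over the identity translate between them.\<close>

lemma lifts_paths_transfer:
  assumes D: "pi_data f g pi e" and P: "is_path_object C pi P" and P': "is_path_object C pi P'"
    and Q: "is_path_object C f Q" and Q': "is_path_object C f Q'"
    and w: "path_map C (base_change_path_ob C g pi P) f Q e w"
    and w': "path_map C (base_change_path_ob C g pi P') f Q' e w'"
    and a: "a \<in> Arr C" "Cod C a = Cod C g" and lift: "lifts_paths f g pi e P Q w a"
  shows "lifts_paths f g pi e P' Q' w' a"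
  unfolding lifts_paths_def
proof (intro allI impI, elim conjE)
  fix u u' H
  assume u: "u \<in> Arr C" "Dom C u = Dom C a" "Cod C u = Dom C pi" "pi \<cdot> u = a"
    and u': "u' \<in> Arr C" "Dom C u' = Dom C a" "Cod C u' = Dom C pi" "pi \<cdot> u' = a"
    and H: "H \<in> Arr C" "Dom C H = Dom C (prl C a g)" "Cod C H = Dom C (src Q')"
      "src Q' \<cdot> H = e \<cdot> base_change C g a pi u" "tgt Q' \<cdot> H = e \<cdot> base_change C g a pi u'"
  note d [simp] = pi_data_simps[OF D]
  let ?i = "Idn C (Dom C pi)" and ?j = "Idn C (Dom C f)"
  let ?B = "base_change_path_ob C g pi P" and ?B' = "base_change_path_ob C g pi P'" and ?z = "prr C pi g"
  have B: "is_path_object C ?z ?B" and B': "is_path_object C ?z ?B'"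
    using base_change_path_object(1)[OF d(2) _ d(5)] P P' by blast+
  note [simp] = path_ob_simps[OF P] path_ob_simps[OF P'] path_ob_simps[OF Q] path_ob_simps[OF Q'] H(1-3) a
  obtain al where al: "path_map C P pi P' ?i al"
    by (rule path_map_ex[OF P P', of ?i "Idn C (Cod C pi)"]) simp_all
  obtain be where be: "path_map C Q' f Q ?j be"
    by (rule path_map_ex[OF Q' Q, of ?j "Idn C (Cod C f)"]) simp_all
  obtain ga where ga: "path_map C Q f Q' ?j ga"
    by (rule path_map_ex[OF Q Q', of ?j "Idn C (Cod C f)"]) simp_all
  note [simp] = path_map_simps[OF al P P'] path_map_simps[OF be Q' Q] path_map_simps[OF ga Q Q']
  note wT [simp] = path_map_simps[OF w B Q]
  obtain h where h [simp]: "h \<in> Arr C" "Dom C h = Dom C a" "Cod C h = Dom C (src P)" "src P \<cdot> h = u"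
    "tgt P \<cdot> h = u'"
    and hH: "homotopic C (ends C f Q) (w \<cdot> base_change C g a (pi \<cdot> src P) h) (be \<cdot> H)"
    by (rule lifts_pathsD[OF lift u u', of "be \<cdot> H"])
      (use Pi_functor_obj_typing[OF D u] Pi_functor_obj_typing[OF D u'] H(4,5) in simp_all)
  let ?al = "base_change C g (pi \<cdot> src P) (pi \<cdot> src P') al" and ?h = "base_change C g a (pi \<cdot> src P) h"
  have "path_map C ?B ?z ?B' (base_change C g pi pi ?i) ?al"
    by (rule base_change_path_map[OF _ P P' _ _ _ _ _ al]) simp_all
  then have bal: "path_map C ?B ?z ?B' (Idn C (Dom C (prl C pi g))) ?al"
    by (simp add: base_change_id)
  have "path_map C ?B f Q' (e \<cdot> Idn C (Dom C (prl C pi g))) (w' \<cdot> ?al)"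
    by (rule path_map_cmp[OF B B' Q' _ _ _ _ _ _ _ _ _ _ bal w', of "Idn C (Dom C g)"]) simp_all
  then have 1: "path_map C ?B f Q' e (w' \<cdot> ?al)" by simp
  have "path_map C ?B f Q' (?j \<cdot> e) (ga \<cdot> w)"
    by (rule path_map_cmp[OF B Q Q' _ _ _ _ _ _ _ _ _ _ w ga, of "Idn C (Dom C g)"]) simp_all
  then have 2: "path_map C ?B f Q' e (ga \<cdot> w)" by simp
  have "path_map C Q' f Q' (?j \<cdot> ?j) (ga \<cdot> be)"
    by (rule path_map_cmp[OF Q' Q Q' _ _ _ _ _ _ _ _ _ _ be ga, of "Idn C (Dom C g)"]) simp_all
  then have 3: "path_map C Q' f Q' ?j (ga \<cdot> be)" by simp
  have hB: "?h \<in> Arr C" "Cod C ?h = Dom C (prl C (pi \<cdot> src P) g)" "Dom C ?h = Dom C (prl C a g)"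
    using base_change_simps[of g "pi \<cdot> src P" h a] u by simp_all
  have sB: "Dom C (src ?B) = Dom C (prl C (pi \<cdot> src P) g)"
    "Dom C (src ?B') = Dom C (prl C (pi \<cdot> src P') g)"
    by (simp_all add: base_change_path_ob_def base_change_simps)
  note alT = path_map_simps[OF bal B B'] and wT' = path_map_simps[OF w' B' Q']
  have "homotopic C (ends C f Q') (w' \<cdot> ?al) (ga \<cdot> w)"
    by (rule path_map_unique[OF B Q' _ _ _ 1 2]) (simp_all add: path_ob_simps[OF B])
  from homotopic_pre[OF this, of ?h] have "homotopic C (ends C f Q') (w' \<cdot> (?al \<cdot> ?h)) (ga \<cdot> (w \<cdot> ?h))"
    using hB sB alT wT' path_ob_simps[OF B] path_ob_simps[OF B'] by simp
  also have "homotopic C (ends C f Q') (ga \<cdot> (w \<cdot> ?h)) (ga \<cdot> (be \<cdot> H))"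
    by (rule path_map_homotopic[OF Q Q' _ _ _ _ _ _ _ ga hH, of "Idn C (Dom C g)"]) simp_all
  also have "homotopic C (ends C f Q') (ga \<cdot> (be \<cdot> H)) H"
    using homotopic_pre[OF path_map_unique[OF Q' Q' _ _ _ 3 path_map_id[OF Q']], of H] by simp
  finally have 4: "homotopic C (ends C f Q') (w' \<cdot> (?al \<cdot> ?h)) H" .
  have "?al \<cdot> ?h = base_change C g a (pi \<cdot> src P') (al \<cdot> h)"
    by (rule base_change_cmp[symmetric]) (use u in simp_all)
  with 4 show "\<exists>h. h \<in> Arr C \<and> Dom C h = Dom C a \<and> Cod C h = Dom C (src P') \<and> src P' \<cdot> h = u \<and>
      tgt P' \<cdot> h = u' \<and>
      homotopic C (ends C f Q') (w' \<cdot> base_change C g a (pi \<cdot> src P') h) H"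
    using u u' by (intro exI[of _ "al \<cdot> h"]) simp
qed

end

section \<open>The composite Pi-type\<close>

text \<open>Here \<open>g\<close> is the fibration from \<open>I\<close> to \<open>J\<close>. The projections of the pullback \<open>X'\<close> of \<open>p\<close> along \<open>\<epsilon>\<^sub>Y\<close> are \<open>prl C eY p\<close>, to \<open>\<Pi>Y \<times>\<^sub>J I\<close>, and \<open>prr C eY p\<close>,
  to \<open>X\<close>. The composites \<open>x\<close> and \<open>piX\<close> have names of their own, for otherwise the equations that
  recognize them would undo the bracketing of composites to the right.\<close>

locale Pi_composite = cloven_path_category C
  for C :: "('o, 'a, 'z) cloven_cat_scheme" (structure) +
  fixes g x y p piY eY q e' piX :: 'a
  assumes p: "p \<in> fib C" "Cod C p = Dom C y" "y \<cdot> p = x"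
    and Y: "pi_data y g piY eY"
    and X': "pi_data (prl C eY p) (prl C piY g) q e'"
    and piX: "piY \<cdot> q = piX"
begin

abbreviation "g' \<equiv> prl C piY g"
abbreviation "x' \<equiv> prl C eY p"

text \<open>For \<open>b : T \<rightarrow> \<Pi>Y\<close> and its composite \<open>a : T \<rightarrow> J\<close>, the isomorphism from \<open>T \<times>\<^sub>J I\<close> to the pullback of
  \<open>\<Pi>Y \<times>\<^sub>J I\<close> along \<open>b\<close>.\<close>

definition regroup :: "'a \<Rightarrow> 'a \<Rightarrow> 'a" where
  "regroup a b = pair C b g' (prl C a g) (base_change C g a piY b)"

definition eX :: 'a where
  "eX = prr C eY p \<cdot> (e' \<cdot> regroup piX q)"

lemmas Y_simps [simp] = pi_data_simps[OF Y]
lemmas X'_simps [simp] = pi_data_simps(2,4-)[OF X']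

lemma p_simps [simp]:
  "p \<in> fib C" "Cod C p = Dom C y" "y \<cdot> p = x" "x \<in> fib C" "Dom C x = Dom C p" "Cod C x = Dom C g"
  "\<And>t. t \<in> Arr C \<Longrightarrow> Cod C t = Dom C p \<Longrightarrow> y \<cdot> (p \<cdot> t) = x \<cdot> t"
proof -
  show *: "p \<in> fib C" "Cod C p = Dom C y" "y \<cdot> p = x" by (fact p)+
  show "x \<in> fib C" using fib_Cmp[of p y] p by simp
  show "Dom C x = Dom C p" "Cod C x = Dom C g" using p by auto
  show "\<And>t. t \<in> Arr C \<Longrightarrow> Cod C t = Dom C p \<Longrightarrow> y \<cdot> (p \<cdot> t) = x \<cdot> t"
    using cmp_eq[OF *(3)] p by simp
qed

lemma q_simps [simp]:
  "x' \<in> fib C" "g' \<in> fib C" "prr C piY g \<in> fib C" "Cod C q = Dom C piY"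
  "piX \<in> fib C" "Dom C piX = Dom C q" "Cod C piX = Cod C g" "piY \<cdot> q = piX"
  "\<And>t. t \<in> Arr C \<Longrightarrow> Cod C t = Dom C q \<Longrightarrow> piY \<cdot> (q \<cdot> t) = piX \<cdot> t"
proof -
  show "x' \<in> fib C" "g' \<in> fib C" "prr C piY g \<in> fib C" using pr_fib[of eY p] pr_fib[of piY g] by simp_all
  show *: "Cod C q = Dom C piY" using pi_data_simps(5)[OF X'] by simp
  show "piX \<in> fib C" using fib_Cmp[of q piY] piX * by simp
  show "Dom C piX = Dom C q" "Cod C piX = Cod C g" using piX * by auto
  show "piY \<cdot> q = piX" by (rule piX)
  show "\<And>t. t \<in> Arr C \<Longrightarrow> Cod C t = Dom C q \<Longrightarrow> piY \<cdot> (q \<cdot> t) = piX \<cdot> t"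
    using cmp_eq[OF piX] * by simp
qed

lemma regroup_simps:
  assumes "b \<in> Arr C" "Cod C b = Dom C piY" "piY \<cdot> b = a"
  shows "regroup a b \<in> Arr C" "Dom C (regroup a b) = Dom C (prl C a g)"
    "Cod C (regroup a b) = Dom C (prl C b g')"
    "prl C b g' \<cdot> regroup a b = prl C a g" "prr C b g' \<cdot> regroup a b = base_change C g a piY b"
    "\<And>t. t \<in> Arr C \<Longrightarrow> Cod C t = Dom C (prl C a g) \<Longrightarrow> prl C b g' \<cdot> (regroup a b \<cdot> t) = prl C a g \<cdot> t"
    "\<And>t. t \<in> Arr C \<Longrightarrow> Cod C t = Dom C (prl C a g) \<Longrightarrow> prr C b g' \<cdot> (regroup a b \<cdot> t) =
        base_change C g a piY b \<cdot> t"
proof -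
  have a: "a \<in> Arr C" "Dom C a = Dom C b" "Cod C a = Cod C g" using assms by auto
  note [simp] = assms(1,2) a
  note bc = base_change_simps[of g piY b a, OF _ _ _ _ _ assms(3)]
  note p = pair_simps[of b g' "prl C a g" "base_change C g a piY b"]
  show "regroup a b \<in> Arr C" "Dom C (regroup a b) = Dom C (prl C a g)"
    "Cod C (regroup a b) = Dom C (prl C b g')"
    "prl C b g' \<cdot> regroup a b = prl C a g" "prr C b g' \<cdot> regroup a b = base_change C g a piY b"
    "\<And>t. t \<in> Arr C \<Longrightarrow> Cod C t = Dom C (prl C a g) \<Longrightarrow> prl C b g' \<cdot> (regroup a b \<cdot> t) = prl C a g \<cdot> t"
    "\<And>t. t \<in> Arr C \<Longrightarrow> Cod C t = Dom C (prl C a g) \<Longrightarrow> prr C b g' \<cdot> (regroup a b \<cdot> t) =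
        base_change C g a piY b \<cdot> t"
    unfolding regroup_def by (simp_all add: p bc)
qed

lemma regroup_inverse:
  assumes b: "b \<in> Arr C" "Cod C b = Dom C piY" "piY \<cdot> b = a"
  obtains i where "i \<in> Arr C" "Dom C i = Dom C (prl C b g')" "Cod C i = Dom C (prl C a g)"
    "regroup a b \<cdot> i = Idn C (Dom C (prl C b g'))" "i \<cdot> regroup a b = Idn C (Dom C (prl C a g))"
    "prr C a g \<cdot> i = prr C piY g \<cdot> prr C b g'"
proof -
  have a: "a \<in> Arr C" "Dom C a = Dom C b" "Cod C a = Cod C g" using b by auto
  note [simp] = b(1,2) a
  note bc [simp] = base_change_simps[of g piY b a, OF _ _ _ _ _ b(3)]
  note r [simp] = regroup_simps[OF b]
  have "a \<cdot> prl C b g' = piY \<cdot> (b \<cdot> prl C b g')" using b(3) cmp_assoc[of "prl C b g'" b piY] by simp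
  also have "b \<cdot> prl C b g' = g' \<cdot> prr C b g'" by simp
  finally have 1: "a \<cdot> prl C b g' = g \<cdot> (prr C piY g \<cdot> prr C b g')" by simp
  obtain i where i [simp]: "i \<in> Arr C" "Dom C i = Dom C (prl C b g')" "Cod C i = Dom C (prl C a g)"
    "prl C a g \<cdot> i = prl C b g'" "prr C a g \<cdot> i = prr C piY g \<cdot> prr C b g'"
    "\<And>t. t \<in> Arr C \<Longrightarrow> Cod C t = Dom C (prl C b g') \<Longrightarrow> prl C a g \<cdot> (i \<cdot> t) = prl C b g' \<cdot> t"
    "\<And>t. t \<in> Arr C \<Longrightarrow> Cod C t = Dom C (prl C b g') \<Longrightarrow> prr C a g \<cdot> (i \<cdot> t) = (prr C piY g \<cdot> prr C b g') \<cdot> t"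
    by (rule pb_map[of a g "prl C b g'" "prr C piY g \<cdot> prr C b g'"]) (simp_all add: 1)
  have 2: "base_change C g a piY b \<cdot> i = prr C b g'"
    by (rule pb_eqI[of piY g]) simp_all
  have 3: "regroup a b \<cdot> i = Idn C (Dom C (prl C b g'))"
    by (rule pb_eqI[of b g']) (simp_all add: 2)
  have 4: "i \<cdot> regroup a b = Idn C (Dom C (prl C a g))"
    by (rule pb_eqI[of a g]) simp_all
  show thesis by (rule that[of i]) (simp_all add: 3 4)
qed

lemma regroup_natural:
  assumes b: "b \<in> Arr C" "Cod C b = Dom C piY" "piY \<cdot> b = a"
    and h: "h \<in> Arr C" "Cod C h = Dom C b" "b \<cdot> h = b1" "a \<cdot> h = a1"
  shows "regroup a b \<cdot> base_change C g a1 a h = base_change C g' b1 b h \<cdot> regroup a1 b1"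
proof -
  have a: "a \<in> Arr C" "Dom C a = Dom C b" "Cod C a = Cod C g" using b by auto
  have b1: "b1 \<in> Arr C" "Dom C b1 = Dom C h" "Cod C b1 = Dom C piY" using b h by auto
  have a1: "a1 \<in> Arr C" "Dom C a1 = Dom C h" "Cod C a1 = Cod C g" using a h by auto
  have ab1: "piY \<cdot> b1 = a1" using cmp_eq[OF b(3), of h] b h by simp
  note [simp] = b(1,2) h(1,2) a b1 a1
  note r [simp] = regroup_simps[OF b] regroup_simps[OF b1(1,3) ab1]
    base_change_simps[of g a h a1, OF _ _ _ _ _ h(4)] base_change_simps[of g' b h b1, OF _ _ _ _ _ h(3)]
    base_change_simps[of g piY b a, OF _ _ _ _ _ b(3)] base_change_simps[of g piY b1 a1, OF _ _ _ _ _ ab1]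
  have "base_change C g a1 piY (b \<cdot> h) = base_change C g a piY b \<cdot> base_change C g a1 a h"
    by (rule base_change_cmp) (use b(3) h(4) in simp_all)
  then have "base_change C g a piY b \<cdot> base_change C g a1 a h = base_change C g a1 piY b1" using h(3)
    by simp
  then show ?thesis
    by - (rule pb_eqI[of b g'], simp_all)
qed

lemma bcq_simps [simp]:
  "base_change C g piX piY q \<in> Arr C" "Dom C (base_change C g piX piY q) = Dom C (prl C piX g)"
  "Cod C (base_change C g piX piY q) = Dom C (prl C piY g)"
  using base_change_simps[of g piY q piX] by simp_all

lemmas regroup_q_simps [simp] = regroup_simps[of q piX, OF fib_arr[OF X'_simps(2)] q_simps(4) piX]

lemma eX_simps [simp]:
  "eX \<in> Arr C" "Dom C eX = Dom C (prl C piX g)" "Cod C eX = Dom C p"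
  "p \<cdot> eX = eY \<cdot> base_change C g piX piY q"
  "\<And>t. t \<in> Arr C \<Longrightarrow> Cod C t = Dom C (prl C piX g) \<Longrightarrow> p \<cdot> (eX \<cdot> t) = eY \<cdot> (base_change C g piX piY q \<cdot> t)"
proof -
  show 1: "eX \<in> Arr C" "Dom C eX = Dom C (prl C piX g)" "Cod C eX = Dom C p"
    and 2: "p \<cdot> eX = eY \<cdot> base_change C g piX piY q"
    unfolding eX_def by simp_all
  show "\<And>t. t \<in> Arr C \<Longrightarrow> Cod C t = Dom C (prl C piX g) \<Longrightarrow> p \<cdot> (eX \<cdot> t) =
      eY \<cdot> (base_change C g piX piY q \<cdot> t)"
    using cmp_eq[OF 2] 1 by simp
qed

lemma X: "pi_data x g piX eX"
proof -
  have "x \<cdot> eX = y \<cdot> (p \<cdot> eX)" using cmp_eq[OF p(3), of eX] by simp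
  also have "\<dots> = y \<cdot> (eY \<cdot> base_change C g piX piY q)" by simp
  also have "\<dots> = prr C piX g" using base_change_simps[of g piY q piX] by (simp del: eX_simps)
  finally show ?thesis unfolding pi_data_def by simp
qed

text \<open>Through the isomorphism \<open>regroup\<close>, the map \<open>\<epsilon>\<^sub>X (u \<times>\<^sub>J 1)\<close> is a map into the pullback \<open>X'\<close> lying over
  \<open>b \<times>\<^sub>J 1\<close>, followed by the projection to \<open>X\<close>.\<close>

lemma lift_base:
  assumes u: "u \<in> Arr C" "Cod C u = Dom C q" "q \<cdot> u = b" "piX \<cdot> u = a"
  shows "base_change C g piX piY q \<cdot> base_change C g a piX u = base_change C g a piY b"
    and "eX \<cdot> base_change C g a piX u = prr C eY p \<cdot> (e' \<cdot> (base_change C g' b q u \<cdot> regroup a b))"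
    and "x' \<cdot> (e' \<cdot> (base_change C g' b q u \<cdot> regroup a b)) = base_change C g a piY b"
proof -
  have b: "b \<in> Arr C" "Dom C b = Dom C u" "Cod C b = Dom C piY" using u by auto
  have a: "a \<in> Arr C" "Dom C a = Dom C u" "Cod C a = Cod C g" using u by auto
  have ab: "piY \<cdot> b = a" using cmp_eq[OF piX, of u] u by simp
  note [simp] = u(1,2) a b regroup_simps[OF b(1,3) ab] base_change_simps[of g piX u a, OF _ _ _ _ _ u(4)]
    base_change_simps[of g' q u b, OF _ _ _ _ _ u(3)]
  show "base_change C g piX piY q \<cdot> base_change C g a piX u = base_change C g a piY b"
    using base_change_cmp[of g piY q piX u a] u(3,4) by simp
  have n: "regroup piX q \<cdot> base_change C g a piX u = base_change C g' b q u \<cdot> regroup a b"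
    by (rule regroup_natural) (use u in simp_all)
  show "eX \<cdot> base_change C g a piX u = prr C eY p \<cdot> (e' \<cdot> (base_change C g' b q u \<cdot> regroup a b))"
    unfolding eX_def by (simp add: n)
  show "x' \<cdot> (e' \<cdot> (base_change C g' b q u \<cdot> regroup a b)) = base_change C g a piY b"
    by simp
qed

text \<open>Find \<open>b\<close> using \<open>\<Pi>Y\<close>, make \<open>v\<close> lie over it by homotopy lifting, and apply the \<open>\<Pi>\<close>-type \<open>q\<close> at \<open>b\<close>.\<close>

lemma lifts_points_composite:
  assumes Ylift: "\<And>a. a \<in> Arr C \<Longrightarrow> Cod C a = Cod C g \<Longrightarrow> lifts_points y g piY eY a"
    and X'lift: "\<And>b. b \<in> Arr C \<Longrightarrow> Cod C b = Dom C piY \<Longrightarrow> lifts_points x' g' q e' b"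
    and a: "a \<in> Arr C" "Cod C a = Cod C g"
  shows "lifts_points x g piX eX a"
  unfolding lifts_points_def
proof (intro allI impI, elim conjE)
  fix v assume v [simp]: "v \<in> Arr C" "Dom C v = Dom C (prl C a g)" "Cod C v = Dom C x"
    and xv: "x \<cdot> v = prr C a g"
  note [simp] = a
  have "y \<cdot> (p \<cdot> v) = prr C a g" using xv by simp
  then obtain b where b: "b \<in> Arr C" "Dom C b = Dom C a" "Cod C b = Dom C piY" "piY \<cdot> b = a"
    and hb: "homotopic C y (eY \<cdot> base_change C g a piY b) (p \<cdot> v)"
    using Ylift[OF a, unfolded lifts_points_def] by (metis cmp_simps p_simps fib_arr v(1,2,3))
  obtain v1 where v1: "homotopic C (y \<cdot> p) v v1" "p \<cdot> v1 = eY \<cdot> base_change C g a piY b"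
    by (rule homotopy_lifting[OF _ _ _ _ homotopic_sym[OF hb]]) simp_all
  have xv1: "homotopic C x v v1" using v1(1) p(3) by simp
  note D = homotopicD[OF xv1]
  note r = regroup_simps[OF b(1,3,4)]
  note [simp] = b(1-3) D(2-6) r base_change_simps[of g piY b a, OF _ _ _ _ _ b(4)]
  obtain i where i [simp]: "i \<in> Arr C" "Dom C i = Dom C (prl C b g')" "Cod C i = Dom C (prl C a g)"
    and ri: "regroup a b \<cdot> i = Idn C (Dom C (prl C b g'))"
      and ir: "i \<cdot> regroup a b = Idn C (Dom C (prl C a g))"
    using regroup_inverse[OF b(1,3,4)] by metis
  obtain v2 where v2 [simp]: "v2 \<in> Arr C" "Dom C v2 = Dom C (prl C a g)" "Cod C v2 = Dom C x'"
    "x' \<cdot> v2 = base_change C g a piY b" "prr C eY p \<cdot> v2 = v1"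
    by (rule pb_map[of eY p "base_change C g a piY b" v1]) (simp_all add: v1(2))
  have "x' \<cdot> (v2 \<cdot> i) = base_change C g a piY b \<cdot> i" using cmp_eq[OF v2(4), of i] by simp
  also have "\<dots> = prr C b g' \<cdot> (regroup a b \<cdot> i)" by simp
  also have "\<dots> = prr C b g'" by (simp add: ri del: r)
  finally have "x' \<cdot> (v2 \<cdot> i) = prr C b g'" .
  moreover have "v2 \<cdot> i \<in> Arr C" "Dom C (v2 \<cdot> i) = Dom C (prl C b g')" "Cod C (v2 \<cdot> i) = Dom C x'"
    by simp_all
  ultimately obtain u where u: "u \<in> Arr C" "Dom C u = Dom C b" "Cod C u = Dom C q" "q \<cdot> u = b"
    and hu: "homotopic C x' (e' \<cdot> base_change C g' b q u) (v2 \<cdot> i)"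
    using X'lift[OF b(1,3)] unfolding lifts_points_def by blast
  have piXu: "piX \<cdot> u = a" using cmp_eq[OF piX, of u] u b(4) by simp
  note [simp] = u(1-3) base_change_simps[of g' q u b, OF _ _ _ _ _ u(4)]
  have "homotopic C x' ((e' \<cdot> base_change C g' b q u) \<cdot> regroup a b) ((v2 \<cdot> i) \<cdot> regroup a b)"
    by (rule homotopic_pre[OF hu]) simp_all
  then have "homotopic C x' (e' \<cdot> (base_change C g' b q u \<cdot> regroup a b)) v2" by (simp add: ir)
  then have "homotopic C p (prr C eY p \<cdot> (e' \<cdot> (base_change C g' b q u \<cdot> regroup a b))) (prr C eY p \<cdot> v2)"
    by (rule homotopic_post[where b = eY]) simp_all
  then have "homotopic C p (eX \<cdot> base_change C g a piX u) v1"
    unfolding lift_base(2)[OF u(1,3,4) piXu] by simp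
  then have "homotopic C (y \<cdot> p) (eX \<cdot> base_change C g a piX u) v1"
    by (rule homotopic_base) simp_all
  then have "homotopic C x (eX \<cdot> base_change C g a piX u) v"
    using homotopic_trans homotopic_sym[OF xv1] p(3) by simp
  then show "\<exists>u. u \<in> Arr C \<and> Dom C u = Dom C a \<and> Cod C u = Dom C piX \<and> piX \<cdot> u = a \<and>
      homotopic C x (eX \<cdot> base_change C g a piX u) v"
    using u piXu by (intro exI[of _ u]) simp
qed

text \<open>The maps induced by \<open>\<epsilon>\<^sub>X\<close> from paths in the fibres of \<open>q\<close> to paths in the fibres of \<open>p\<close>.\<close>

definition vertical_map :: "'a path_ob \<Rightarrow> 'a path_ob \<Rightarrow> 'a \<Rightarrow> bool" where
  "vertical_map R S w \<longleftrightarrow> w \<in> Arr C \<and> Dom C w = Dom C (prl C (piX \<cdot> src S) g) \<and> Cod C w = Dom C (src R) \<and>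
     src R \<cdot> w = eX \<cdot> base_change C g (piX \<cdot> src S) piX (src S) \<and>
     tgt R \<cdot> w = eX \<cdot> base_change C g (piX \<cdot> src S) piX (tgt S) \<and>
     homotopic C (ends C p R) (w \<cdot> base_change C g piX (piX \<cdot> src S) (rfl S)) (rfl R \<cdot> eX)"

lemma vertical_mapD:
  assumes "vertical_map R S w"
  shows "w \<in> Arr C" "Dom C w = Dom C (prl C (piX \<cdot> src S) g)" "Cod C w = Dom C (src R)"
    "src R \<cdot> w = eX \<cdot> base_change C g (piX \<cdot> src S) piX (src S)"
    "tgt R \<cdot> w = eX \<cdot> base_change C g (piX \<cdot> src S) piX (tgt S)"
    "homotopic C (ends C p R) (w \<cdot> base_change C g piX (piX \<cdot> src S) (rfl S)) (rfl R \<cdot> eX)"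
  using assms unfolding vertical_map_def by blast+

text \<open>Paths within the fibres of \<open>q\<close> act on paths within the fibres of \<open>p\<close>, and fullness for \<open>X'\<close> over
  \<open>\<Pi>Y \<times>\<^sub>J I\<close> says that the action is full: a path in a fibre of \<open>p\<close> is a path in the pullback \<open>X'\<close>.\<close>

lemma vertical_action:
  assumes R: "is_path_object C p R" and S: "is_path_object C q S"
    and X'full: "\<And>P Q w b. is_path_object C q P \<Longrightarrow> is_path_object C x' Q \<Longrightarrow>
      path_map C (base_change_path_ob C g' q P) x' Q e' w \<Longrightarrow> b \<in> Arr C \<Longrightarrow> Cod C b = Dom C piY \<Longrightarrow>
      lifts_paths x' g' q e' P Q w b"
  obtains w where "vertical_map R S w"
    "\<And>a u u' K. u \<in> Arr C \<Longrightarrow> u' \<in> Arr C \<Longrightarrow> Dom C u' = Dom C u \<Longrightarrow> Cod C u = Dom C q \<Longrightarrow> Cod C u' = Dom C q \<Longrightarrow>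
      q \<cdot> u = q \<cdot> u' \<Longrightarrow> piX \<cdot> u = a \<Longrightarrow> K \<in> Arr C \<Longrightarrow> Dom C K = Dom C (prl C a g) \<Longrightarrow> Cod C K = Dom C (src R) \<Longrightarrow>
      src R \<cdot> K = eX \<cdot> base_change C g a piX u \<Longrightarrow> tgt R \<cdot> K = eX \<cdot> base_change C g a piX u' \<Longrightarrow>
      \<exists>h. h \<in> Arr C \<and> Dom C h = Dom C u \<and> Cod C h = Dom C (src S) \<and> src S \<cdot> h = u \<and> tgt S \<cdot> h = u' \<and>
        homotopic C (ends C p R) (w \<cdot> base_change C g a (piX \<cdot> src S) h) K"
proof -
  note [simp] = path_ob_simps[OF R] path_ob_simps[OF S]
  obtain R' where R': "is_path_object C x' R'" using path_object_ex q_simps(1) by blast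
  let ?B = "base_change_path_ob C g' q S" and ?k = "prr C eY p" and ?d = "piX \<cdot> src S" and ?d' =
    "q \<cdot> src S"
  obtain w' where w': "path_map C ?B x' R' e' w'"
    using Pi_path_map_ex[OF X' S R'] .
  obtain rho where rho: "path_map C R' p R ?k rho"
    by (rule path_map_ex[OF R' R, of ?k eY]) (use path_ob_simps[OF R'] in simp_all)
  have B: "is_path_object C (prr C q g') ?B"
    by (rule base_change_path_object(1)[OF _ S]) simp_all
  note [simp] = path_ob_simps[OF R'] path_map_simps[OF rho R' R]
  have pd: "piX \<cdot> tgt S = ?d" "\<And>t. t \<in> Arr C \<Longrightarrow> Cod C t = Dom C (src S) \<Longrightarrow> piX \<cdot> (tgt S \<cdot> t) =
      piX \<cdot> (src S \<cdot> t)"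
  proof -
    show *: "piX \<cdot> tgt S = ?d" using q_simps(9)[of "tgt S"] q_simps(9)[of "src S"] by simp
    show "\<And>t. t \<in> Arr C \<Longrightarrow> Cod C t = Dom C (src S) \<Longrightarrow> piX \<cdot> (tgt S \<cdot> t) = piX \<cdot> (src S \<cdot> t)"
      using cmp_eq[OF *] by simp
  qed
  have d': "?d' \<in> Arr C" "Cod C ?d' = Dom C piY" "piY \<cdot> ?d' = ?d" by simp_all
  have Bs: "rfl ?B = base_change C g' q ?d' (rfl S)" "src ?B = base_change C g' ?d' q (src S)"
    "tgt ?B = base_change C g' ?d' q (tgt S)"
    by (simp_all add: base_change_path_ob_def)
  have Bd [simp]: "Dom C (src ?B) = Dom C (prl C ?d' g')"
    unfolding Bs using base_change_simps[of g' q "src S" ?d'] by simp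
  note w'T [simp] = path_map_simps[OF w' B R']
  note r [simp] = regroup_simps[OF d']
  let ?r = "regroup ?d ?d'"
  define w where "w = rho \<cdot> (w' \<cdot> ?r)"
  have w1: "w \<in> Arr C" "Dom C w = Dom C (prl C ?d g)" "Cod C w = Dom C (src R)"
    unfolding w_def by simp_all
  have bs: "src ?B \<cdot> ?r = regroup piX q \<cdot> base_change C g ?d piX (src S)"
    unfolding Bs by (rule regroup_natural[symmetric]) simp_all
  have bt: "tgt ?B \<cdot> ?r = regroup piX q \<cdot> base_change C g ?d piX (tgt S)"
    unfolding Bs by (rule regroup_natural[symmetric]) (simp_all add: pd)
  have br: "?r \<cdot> base_change C g piX ?d (rfl S) = rfl ?B \<cdot> regroup piX q"
    unfolding Bs by (rule regroup_natural) simp_all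
  note bcT [simp] = base_change_simps[of g piX "src S" ?d] base_change_simps[of g piX "tgt S" ?d]
    base_change_simps[of g ?d "rfl S" piX]
  have [simp]: "rfl ?B \<in> Arr C" "Dom C (rfl ?B) = Dom C (prl C q g')"
    "Cod C (rfl ?B) = Dom C (prl C ?d' g')"
    "src ?B \<in> Arr C" "Cod C (src ?B) = Dom C (prl C q g')" "tgt ?B \<in> Arr C"
      "Cod C (tgt ?B) = Dom C (prl C q g')"
      "Dom C (tgt ?B) = Dom C (prl C ?d' g')"
    using path_ob_simps[OF B] by simp_all
  have w2: "src R \<cdot> w = eX \<cdot> base_change C g ?d piX (src S)"
    "tgt R \<cdot> w = eX \<cdot> base_change C g ?d piX (tgt S)"
    unfolding w_def eX_def by (simp_all add: pd bs bt)
  have rho_h: "homotopic C (ends C p R) (rho \<cdot> H) (rho \<cdot> K)" if "homotopic C (ends C x' R') H K" for H K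
    by (rule path_map_homotopic[OF R' R _ _ _ _ _ _ _ rho that, of eY]) simp_all
  have "homotopic C (ends C p R) (rho \<cdot> (w' \<cdot> rfl ?B)) (rho \<cdot> (rfl R' \<cdot> e'))"
    by (rule rho_h[OF path_map_rfl[OF w']])
  also have "homotopic C (ends C p R) (rho \<cdot> (rfl R' \<cdot> e')) (rfl R \<cdot> (?k \<cdot> e'))"
    using homotopic_pre[OF path_map_rfl[OF rho], of e'] by simp
  finally have "homotopic C (ends C p R) ((rho \<cdot> (w' \<cdot> rfl ?B)) \<cdot> regroup piX q)
      ((rfl R \<cdot> (?k \<cdot> e')) \<cdot> regroup piX q)"
    by (rule homotopic_pre) simp_all
  then have w3: "homotopic C (ends C p R) (w \<cdot> base_change C g piX ?d (rfl S)) (rfl R \<cdot> eX)"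
    unfolding w_def eX_def by (simp add: br)
  have "vertical_map R S w" unfolding vertical_map_def using w1 w2 w3 by blast
  then show thesis
  proof (rule that)
    fix a u u' K
    assume u: "u \<in> Arr C" "u' \<in> Arr C" "Dom C u' = Dom C u" "Cod C u = Dom C q" "Cod C u' = Dom C q"
      and qu: "q \<cdot> u = q \<cdot> u'" and a: "piX \<cdot> u = a"
      and K: "K \<in> Arr C" "Dom C K = Dom C (prl C a g)" "Cod C K = Dom C (src R)"
        "src R \<cdot> K = eX \<cdot> base_change C g a piX u" "tgt R \<cdot> K = eX \<cdot> base_change C g a piX u'"
    define b where "b = q \<cdot> u"
    have bu: "q \<cdot> u = b" "q \<cdot> u' = b" using qu b_def by simp_all
    have a': "piX \<cdot> u' = a" using a qu cmp_eq[OF piX, of u] cmp_eq[OF piX, of u'] u by simp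
    have b: "b \<in> Arr C" "Dom C b = Dom C u" "Cod C b = Dom C piY" "piY \<cdot> b = a"
      using u a cmp_eq[OF piX, of u] by (simp_all add: b_def)
    have aT: "a \<in> Arr C" "Dom C a = Dom C u" "Cod C a = Cod C g" using a u by auto
    note [simp] = b(1-3) aT u(1-5) K(1-3) regroup_simps[OF b(1,3,4)]
      base_change_simps[of g' q u b, OF _ _ _ _ _ bu(1)] base_change_simps[of g' q u' b, OF _ _ _ _ _
        bu(2)]
    note l = lift_base[OF u(1,4) bu(1) a] and l' = lift_base[OF u(2,5) bu(2) a']
    let ?h = "e' \<cdot> (base_change C g' b q u \<cdot> regroup a b)" and ?h' =
      "e' \<cdot> (base_change C g' b q u' \<cdot> regroup a b)"
    obtain K1 where K1 [simp]: "K1 \<in> Arr C" "Dom C K1 = Dom C (prl C a g)" "Cod C K1 = Dom C (src R')"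
      and K1e: "src R' \<cdot> K1 = ?h" "tgt R' \<cdot> K1 = ?h'"
      and K1K: "homotopic C (ends C p R) (rho \<cdot> K1) K"
    proof (rule pullback_path[OF pb_is_pullback[of eY p] R R' rho, of ?h ?h' K])
      show "x' \<cdot> ?h = x' \<cdot> ?h'" by (simp only: l(3) l'(3))
      show "src R \<cdot> K = ?k \<cdot> ?h" "tgt R \<cdot> K = ?k \<cdot> ?h'" using K(4,5) l(2) l'(2) by simp_all
    qed simp_all
    obtain i where i [simp]: "i \<in> Arr C" "Dom C i = Dom C (prl C b g')" "Cod C i = Dom C (prl C a g)"
      and ri: "regroup a b \<cdot> i = Idn C (Dom C (prl C b g'))"
        and ir: "i \<cdot> regroup a b = Idn C (Dom C (prl C a g))"
      using regroup_inverse[OF b(1,3,4)] by metis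
    obtain h where h: "h \<in> Arr C" "Dom C h = Dom C b" "Cod C h = Dom C (src S)" "src S \<cdot> h = u"
      "tgt S \<cdot> h = u'"
      and hh: "homotopic C (ends C x' R') (w' \<cdot> base_change C g' b ?d' h) (K1 \<cdot> i)"
    proof (rule lifts_pathsD[OF X'full[OF S R' w' b(1,3)], of u u' "K1 \<cdot> i"])
      show "src R' \<cdot> (K1 \<cdot> i) = e' \<cdot> base_change C g' b q u"
        using cmp_eq[OF K1e(1), of i] by (simp add: ri)
      show "tgt R' \<cdot> (K1 \<cdot> i) = e' \<cdot> base_change C g' b q u'"
        using cmp_eq[OF K1e(2), of i] by (simp add: ri)
    qed (simp_all add: bu)
    have dh: "?d' \<cdot> h = b" "?d \<cdot> h = a" using h bu a by simp_all
    note [simp] = h(1-3) base_change_simps[of g' ?d' h b, OF _ _ _ _ _ dh(1)] base_change_simps[of g ?d h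
      a, OF _ _ _ _ _ dh(2)]
    have n: "?r \<cdot> base_change C g a ?d h = base_change C g' b ?d' h \<cdot> regroup a b"
      by (rule regroup_natural[OF d']) (use dh in simp_all)
    have "homotopic C (ends C x' R') ((w' \<cdot> base_change C g' b ?d' h) \<cdot> regroup a b)
        ((K1 \<cdot> i) \<cdot> regroup a b)"
      by (rule homotopic_pre[OF hh]) simp_all
    then have "homotopic C (ends C x' R') (w' \<cdot> (base_change C g' b ?d' h \<cdot> regroup a b)) K1"
      by (simp add: ir)
    from homotopic_trans[OF rho_h[OF this] K1K]
    have "homotopic C (ends C p R) (w \<cdot> base_change C g a ?d h) K"
      unfolding w_def by (simp add: n)
    with h show "\<exists>h. h \<in> Arr C \<and> Dom C h = Dom C u \<and> Cod C h = Dom C (src S) \<and> src S \<cdot> h = u \<and> tgt S \<cdot> h =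
        u' \<and>
        homotopic C (ends C p R) (w \<cdot> base_change C g a (piX \<cdot> src S) h) K"
      using b by (intro exI[of _ h]) simp
  qed
qed

text \<open>Both sides are maps on composable pairs of a path of \<open>\<Pi>X\<close> and a path in a fibre of \<open>q\<close>. They agree
  up to homotopy when the second path is constant, hence in general by path induction.\<close>

lemma action_join:
  assumes P: "is_path_object C piX P" and Q: "is_path_object C x Q"
    and R: "is_path_object C p R" and S: "is_path_object C q S"
    and w: "path_map C (base_change_path_ob C g piX P) x Q eX w"
    and v: "vertical_map R S v"
    and c: "is_concat P S P c"
    and cunit: "\<And>G. G \<in> Arr C \<Longrightarrow> Cod C G = pob C P \<Longrightarrow> homotopic C (ends C piX P)
        (join P S c G (rfl S \<cdot> (tgt P \<cdot> G))) G"
    and d: "is_concat Q R Q d"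
    and dunit: "\<And>G. G \<in> Arr C \<Longrightarrow> Cod C G = pob C Q \<Longrightarrow> homotopic C (ends C x Q)
        (join Q R d G (rfl R \<cdot> (tgt Q \<cdot> G))) G"
    and GK: "G \<in> Arr C" "K \<in> Arr C" "Dom C K = Dom C G" "Cod C G = Dom C (src P)"
      "Cod C K = Dom C (src S)"
      "tgt P \<cdot> G = src S \<cdot> K" "piX \<cdot> (src P \<cdot> G) = a"
  shows "homotopic C (ends C x Q) (w \<cdot> base_change C g a (piX \<cdot> src P) (join P S c G K))
    (join Q R d (w \<cdot> base_change C g a (piX \<cdot> src P) G) (v \<cdot> base_change C g a (piX \<cdot> src S) K))"
proof -
  note v = vertical_mapD[OF v]
  note [simp] = path_ob_simps[OF P] path_ob_acyclic[OF P] path_ob_simps[OF Q] path_ob_simps[OF R]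
    path_ob_simps[OF S] path_ob_acyclic[OF S] v(1-3) GK(1-5)
  let ?B = "base_change_path_ob C g piX P" and ?dP = "piX \<cdot> src P" and ?dS = "piX \<cdot> src S"
  let ?l = "prl C (tgt P) (src S)" and ?r = "prr C (tgt P) (src S)"
  let ?dU = "piX \<cdot> (src P \<cdot> ?l)"
  have B: "is_path_object C (prr C piX g) ?B"
    by (rule base_change_path_object(1)[OF _ P]) simp_all
  have Bs: "src ?B = base_change C g ?dP piX (src P)" "tgt ?B = base_change C g ?dP piX (tgt P)"
    by (simp_all add: base_change_path_ob_def)
  have Bd: "Dom C (src ?B) = Dom C (prl C ?dP g)"
    unfolding Bs using base_change_simps[of g piX "src P" ?dP] by simp
  note wT = path_map_simps[OF w B Q, simplified Bs Bd, simplified]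
  note [simp] = wT
  have Sd: "piX \<cdot> (src S \<cdot> t) = piX \<cdot> (tgt S \<cdot> t)" if "t \<in> Arr C" "Cod C t = Dom C (src S)" for t
    using that q_simps(9)[of "src S \<cdot> t"] q_simps(9)[of "tgt S \<cdot> t"] by simp
  have Sd1: "piX \<cdot> tgt S = ?dS" using Sd[of "Idn C (Dom C (src S))"] by simp
  have lr: "piX \<cdot> (src S \<cdot> ?r) = ?dU" by simp
  note vx = cmp_eq[OF v(4)] cmp_eq[OF v(5)]
  note jc = join_simps[OF c P S P] and jd = join_simps[OF d Q R Q]
  note bT = base_change_simps
  \<comment> \<open>The two sides as maps on the object of composable pairs.\<close>
  have jU: "join P S c ?l ?r \<in> Arr C" "Dom C (join P S c ?l ?r) = Dom C ?l"
    "Cod C (join P S c ?l ?r) = Dom C (src P)"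
    "src P \<cdot> join P S c ?l ?r = src P \<cdot> ?l" "tgt P \<cdot> join P S c ?l ?r = tgt S \<cdot> ?r"
    by (simp_all add: jc(1-5))
  let ?C = "base_change C g ?dU ?dP (join P S c ?l ?r)"
  let ?L = "base_change C g ?dU ?dP ?l" and ?R = "base_change C g ?dU ?dS ?r"
  have CT [simp]: "?C \<in> Arr C" "Dom C ?C = Dom C (prl C ?dU g)" "Cod C ?C = Dom C (prl C ?dP g)"
    using bT[of g ?dP "join P S c ?l ?r" ?dU] jU by simp_all
  have LT [simp]: "?L \<in> Arr C" "Dom C ?L = Dom C (prl C ?dU g)" "Cod C ?L = Dom C (prl C ?dP g)"
    using bT[of g ?dP ?l ?dU] by simp_all
  have RT [simp]: "?R \<in> Arr C" "Dom C ?R = Dom C (prl C ?dU g)" "Cod C ?R = Dom C (prl C ?dS g)"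
    using bT[of g ?dS ?r ?dU] lr by simp_all
  have sP: "base_change C g ?dP piX (src P) \<cdot> base_change C g t ?dP h = base_change C g t piX (src P \<cdot> h)"
    "base_change C g ?dP piX (tgt P) \<cdot> base_change C g t ?dP h = base_change C g t piX (tgt P \<cdot> h)"
    if "h \<in> Arr C" "Cod C h = Dom C (src P)" "piX \<cdot> (src P \<cdot> h) = t" for h t
    by (rule base_change_cmp[symmetric]; use that in simp)+
  have sS: "base_change C g ?dS piX (src S) \<cdot> base_change C g t ?dS h = base_change C g t piX (src S \<cdot> h)"
    "base_change C g ?dS piX (tgt S) \<cdot> base_change C g t ?dS h = base_change C g t piX (tgt S \<cdot> h)"
    if "h \<in> Arr C" "Cod C h = Dom C (src S)" "piX \<cdot> (src S \<cdot> h) = t" for h t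
    by (rule base_change_cmp[symmetric]; use that Sd1 in simp)+
  have bd [simp]: "base_change C g ?dS piX (src S) \<in> Arr C" "Dom C (base_change C g ?dS piX (src S)) =
      Dom C (prl C ?dS g)"
    "Cod C (base_change C g ?dS piX (src S)) = Dom C (prl C piX g)"
    "base_change C g ?dS piX (tgt S) \<in> Arr C" "Dom C (base_change C g ?dS piX (tgt S)) =
        Dom C (prl C ?dS g)"
    "Cod C (base_change C g ?dS piX (tgt S)) = Dom C (prl C piX g)"
    "base_change C g ?dP piX (src P) \<in> Arr C" "Dom C (base_change C g ?dP piX (src P)) =
        Dom C (prl C ?dP g)"
    "Cod C (base_change C g ?dP piX (src P)) = Dom C (prl C piX g)"
    "base_change C g ?dP piX (tgt P) \<in> Arr C" "Dom C (base_change C g ?dP piX (tgt P)) =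
        Dom C (prl C ?dP g)"
    "Cod C (base_change C g ?dP piX (tgt P)) = Dom C (prl C piX g)"
    using bT[of g piX "src S" ?dS] bT[of g piX "tgt S" ?dS] bT[of g piX "src P" ?dP] bT[of g piX
      "tgt P" ?dP] Sd1 by simp_all
  have mid: "tgt Q \<cdot> (w \<cdot> ?L) = src R \<cdot> (v \<cdot> ?R)"
    using sP[of ?l ?dU] sS[of ?r ?dU] lr by (simp add: vx)
  note jLR = jd[of "w \<cdot> ?L" "v \<cdot> ?R", OF _ _ _ _ _ _ mid]
  \<comment> \<open>Pairs with a constant second component.\<close>
  obtain n where n [simp]: "n \<in> Arr C" "Dom C n = Dom C (src P)" "Cod C n = Dom C ?l"
    "?l \<cdot> n = Idn C (Dom C (src P))" "?r \<cdot> n = rfl S \<cdot> tgt P"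
    by (rule pb_map[of "tgt P" "src S" "Idn C (Dom C (src P))" "rfl S \<cdot> tgt P"]) simp_all
  have dUn: "?dU \<cdot> n = ?dP" by simp
  let ?n = "base_change C g ?dP ?dU n"
  have nw: "?n \<in> weq C"
    by (rule base_change_weq[of g ?dP ?l]) (use pr_fib[of "tgt P" "src S"] in simp_all)
  have nT [simp]: "?n \<in> Arr C" "Dom C ?n = Dom C (prl C ?dP g)" "Cod C ?n = Dom C (prl C ?dU g)"
    using bT[of g ?dU n ?dP] by simp_all
  have "?C \<cdot> ?n = base_change C g ?dP ?dP (join P S c ?l ?r \<cdot> n)"
    by (rule base_change_cmp[symmetric]) (use jU in simp_all)
  also have "join P S c ?l ?r \<cdot> n = join P S c (Idn C (Dom C (src P))) (rfl S \<cdot> tgt P)"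
    by (simp add: jc)
  finally have Cn: "?C \<cdot> ?n = base_change C g ?dP ?dP
      (join P S c (Idn C (Dom C (src P))) (rfl S \<cdot> tgt P))" .
  have "homotopic C (ends C piX P) (join P S c (Idn C (Dom C (src P))) (rfl S \<cdot> tgt P))
      (Idn C (Dom C (src P)))"
    using cunit[of "Idn C (Dom C (src P))"] by simp
  then have "homotopic C (ends C (prr C piX g) ?B) (?C \<cdot> ?n)
      (base_change C g ?dP ?dP (Idn C (Dom C (src P))))"
    unfolding Cn by (rule base_change_homotopic[OF _ P, rotated 2]) (simp_all add: jc)
  then have "homotopic C (ends C (prr C piX g) ?B) (?C \<cdot> ?n) (Idn C (Dom C (prl C ?dP g)))"
    using base_change_id[of g ?dP] by simp
  then have "homotopic C (ends C x Q) (w \<cdot> (?C \<cdot> ?n)) (w \<cdot> Idn C (Dom C (prl C ?dP g)))"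
    by (rule path_map_homotopic[OF B Q _ _ _ _ _ _ _ w, of "Idn C (Dom C g)", rotated -1])
      (use pi_data_simps[OF X] in simp_all)
  then have 1: "homotopic C (ends C x Q) (w \<cdot> (?C \<cdot> ?n)) w" by simp
  have Ln: "?L \<cdot> ?n = Idn C (Dom C (prl C ?dP g))"
    using base_change_cmp[of g ?dP ?l ?dU n ?dP] base_change_id[of g ?dP] by simp
  let ?rS = "base_change C g piX ?dS (rfl S)" and ?tP = "base_change C g ?dP piX (tgt P)"
  have "?R \<cdot> ?n = base_change C g ?dP ?dS (?r \<cdot> n)"
    by (rule base_change_cmp[symmetric]) (use lr in simp_all)
  also have "\<dots> = ?rS \<cdot> ?tP"
    unfolding n(5) by (rule base_change_cmp) simp_all
  finally have Rn: "?R \<cdot> ?n = ?rS \<cdot> ?tP" .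
  have rST [simp]: "?rS \<in> Arr C" "Dom C ?rS = Dom C (prl C piX g)" "Cod C ?rS = Dom C (prl C ?dS g)"
    using bT[of g ?dS "rfl S" piX] by simp_all
  have "homotopic C (ends C p R) ((v \<cdot> ?rS) \<cdot> ?tP) ((rfl R \<cdot> eX) \<cdot> ?tP)"
    by (rule homotopic_pre[OF v(6)]) simp_all
  then have vn: "homotopic C (ends C p R) (v \<cdot> (?R \<cdot> ?n)) (rfl R \<cdot> (tgt Q \<cdot> w))"
    by (simp add: Rn)
  have jn: "join Q R d (w \<cdot> ?L) (v \<cdot> ?R) \<cdot> ?n = join Q R d w (v \<cdot> (?R \<cdot> ?n))"
    using jLR(6)[of ?n] by (simp add: Ln)
  have midn: "tgt Q \<cdot> w = src R \<cdot> (v \<cdot> (?R \<cdot> ?n))"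
    using cmp_eq[OF mid, of ?n] by (simp add: Ln)
  have "homotopic C (ends C x Q) (join Q R d w (v \<cdot> (?R \<cdot> ?n))) (join Q R d w (rfl R \<cdot> (tgt Q \<cdot> w)))"
    by (rule join_cong_right[OF d Q R Q _ _ _ _ midn vn]) simp_all
  also have "homotopic C (ends C x Q) (join Q R d w (rfl R \<cdot> (tgt Q \<cdot> w))) w"
    by (rule dunit) simp_all
  finally have "homotopic C (ends C x Q) ((w \<cdot> ?C) \<cdot> ?n) (join Q R d (w \<cdot> ?L) (v \<cdot> ?R) \<cdot> ?n)"
    unfolding jn using homotopic_trans[OF 1] homotopic_sym by simp
  then have 2: "homotopic C (ends C x Q) (w \<cdot> ?C) (join Q R d (w \<cdot> ?L) (v \<cdot> ?R))"
  proof (rule path_unique[OF nw Q, rotated -1])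
    show "src Q \<cdot> (w \<cdot> ?C) = src Q \<cdot> join Q R d (w \<cdot> ?L) (v \<cdot> ?R)"
      using sP(1)[of "join P S c ?l ?r" ?dU] sP(1)[of ?l ?dU] jU by (simp add: jLR(4))
    show "tgt Q \<cdot> (w \<cdot> ?C) = tgt Q \<cdot> join Q R d (w \<cdot> ?L) (v \<cdot> ?R)"
      using sP(2)[of "join P S c ?l ?r" ?dU] sS(2)[of ?r ?dU] jU lr by (simp add: jLR(5) vx)
  qed (simp_all add: jLR(1-3))
  obtain m where m [simp]: "m \<in> Arr C" "Dom C m = Dom C G" "Cod C m = Dom C ?l" "?l \<cdot> m = G" "?r \<cdot> m = K"
    by (rule pb_map[of "tgt P" "src S" G K]) (simp_all add: GK(6))
  let ?m = "base_change C g a ?dU m"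
  have dUm: "?dU \<cdot> m = a" using GK(7) by simp
  have mT [simp]: "?m \<in> Arr C" "Dom C ?m = Dom C (prl C a g)" "Cod C ?m = Dom C (prl C ?dU g)"
    using bT[of g ?dU m a, OF _ _ _ _ _ dUm] by simp_all
  have "join P S c ?l ?r \<cdot> m = join P S c G K" by (simp add: jc)
  then have Cm: "?C \<cdot> ?m = base_change C g a ?dP (join P S c G K)"
    using base_change_cmp[of g ?dP "join P S c ?l ?r" ?dU m a] jU dUm by simp
  have Lm: "?L \<cdot> ?m = base_change C g a ?dP G"
    using base_change_cmp[of g ?dP ?l ?dU m a] dUm by simp
  have Rm: "?R \<cdot> ?m = base_change C g a ?dS K"
    using base_change_cmp[of g ?dS ?r ?dU m a] dUm lr by simp
  have "homotopic C (ends C x Q) ((w \<cdot> ?C) \<cdot> ?m) (join Q R d (w \<cdot> ?L) (v \<cdot> ?R) \<cdot> ?m)"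
    by (rule homotopic_pre[OF 2]) simp_all
  then show ?thesis using jLR(6)[of ?m] by (simp add: Cm Lm Rm)
qed

text \<open>Path objects of \<open>\<Pi>X\<close> and \<open>X\<close> that are fibred over path objects of \<open>\<Pi>Y\<close> and \<open>Y\<close> let paths be lifted
  and divided strictly; \<open>lifts_paths_transfer\<close> then passes to arbitrary path objects.\<close>

lemma lifts_paths_composite:
  assumes Yfull: "\<And>P Q w a. is_path_object C piY P \<Longrightarrow> is_path_object C y Q \<Longrightarrow>
      path_map C (base_change_path_ob C g piY P) y Q eY w \<Longrightarrow> a \<in> Arr C \<Longrightarrow> Cod C a = Cod C g \<Longrightarrow>
      lifts_paths y g piY eY P Q w a"
    and X'full: "\<And>P Q w b. is_path_object C q P \<Longrightarrow> is_path_object C x' Q \<Longrightarrow>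
      path_map C (base_change_path_ob C g' q P) x' Q e' w \<Longrightarrow> b \<in> Arr C \<Longrightarrow> Cod C b = Dom C piY \<Longrightarrow>
      lifts_paths x' g' q e' P Q w b"
    and P': "is_path_object C piX P'" and Q': "is_path_object C x Q'"
    and w': "path_map C (base_change_path_ob C g piX P') x Q' eX w'" and a: "a \<in> Arr C"
      "Cod C a = Cod C g"
  shows "lifts_paths x g piX eX P' Q' w' a"
proof -
  obtain PY where PY: "is_path_object C piY PY" using path_object_ex Y_simps(4) by blast
  obtain QY where QY: "is_path_object C y QY" using path_object_ex Y_simps(1) by blast
  obtain wY where wY: "path_map C (base_change_path_ob C g piY PY) y QY eY wY"
    using Pi_path_map_ex[OF Y PY QY] .
  obtain P psi where PF: "fibred_path_ob piY q PY P psi"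
    using fibred_path_ob_ex[of piY q PY] PY by auto
  obtain Q phi where QF: "fibred_path_ob y p QY Q phi"
    using fibred_path_ob_ex[of y p QY] QY by auto
  note pf = fibred_path_ob_simps[OF PF PY, simplified] and qf = fibred_path_ob_simps[OF QF QY, simplified]
  have P: "is_path_object C piX P" and psi: "path_map C P piY PY q psi" by (fact pf)+
  have Q: "is_path_object C x Q" and phi: "path_map C Q y QY p phi" by (fact qf)+
  obtain R where R: "is_path_object C p R" using path_object_ex p_simps(1) by blast
  obtain S where S: "is_path_object C q S" using path_object_ex X'_simps(2) by blast
  obtain w where w: "path_map C (base_change_path_ob C g piX P) x Q eX w"
    using Pi_path_map_ex[OF X P Q] .
  obtain v where v: "vertical_map R S v"
    and vlift: "\<And>a u u' K. u \<in> Arr C \<Longrightarrow> u' \<in> Arr C \<Longrightarrow> Dom C u' = Dom C u \<Longrightarrow> Cod C u = Dom C q \<Longrightarrow> Cod C u' =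
        Dom C q \<Longrightarrow>
      q \<cdot> u = q \<cdot> u' \<Longrightarrow> piX \<cdot> u = a \<Longrightarrow> K \<in> Arr C \<Longrightarrow> Dom C K = Dom C (prl C a g) \<Longrightarrow> Cod C K = Dom C (src R) \<Longrightarrow>
      src R \<cdot> K = eX \<cdot> base_change C g a piX u \<Longrightarrow> tgt R \<cdot> K = eX \<cdot> base_change C g a piX u' \<Longrightarrow>
      \<exists>h. h \<in> Arr C \<and> Dom C h = Dom C u \<and> Cod C h = Dom C (src S) \<and> src S \<cdot> h = u \<and> tgt S \<cdot> h = u' \<and>
        homotopic C (ends C p R) (v \<cdot> base_change C g a (piX \<cdot> src S) h) K"
    by (rule vertical_action[OF R S X'full]; (assumption | (rule that; assumption)))
  have Y_arr: "piY \<in> Arr C" "y \<in> Arr C" by simp_all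
  obtain c where c: "is_concat P S P c"
    and cunit: "\<And>G. G \<in> Arr C \<Longrightarrow> Cod C G = pob C P \<Longrightarrow> homotopic C (ends C piX P)
        (join P S c G (rfl S \<cdot> (tgt P \<cdot> G))) G"
    using concat_ex[OF P S piX[symmetric] Y_arr(1) q_simps(4)] by metis
  obtain d where d: "is_concat Q R Q d"
    and dunit: "\<And>G. G \<in> Arr C \<Longrightarrow> Cod C G = pob C Q \<Longrightarrow> homotopic C (ends C x Q)
        (join Q R d G (rfl R \<cdot> (tgt Q \<cdot> G))) G"
    using concat_ex[OF Q R p(3)[symmetric] Y_arr(2) p(2)] by metis
  let ?BX = "base_change_path_ob C g piX P" and ?BY = "base_change_path_ob C g piY PY"
  have BX: "is_path_object C (prr C piX g) ?BX" by (rule base_change_path_object(1)[OF _ P]) simp_all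
  have BY: "is_path_object C (prr C piY g) ?BY" by (rule base_change_path_object(1)[OF _ PY]) simp_all
  note [simp] = path_ob_simps[OF PY] path_ob_simps[OF QY] path_ob_simps[OF P] path_ob_simps[OF Q]
    path_ob_simps[OF R] path_ob_simps[OF S] pf(1-7) qf(1-7) a
  let ?dX = "piX \<cdot> src P" and ?dY = "piY \<cdot> src PY"
  let ?psi = "base_change C g ?dX ?dY psi"
  have Bs: "src ?BX = base_change C g ?dX piX (src P)" "tgt ?BX = base_change C g ?dX piX (tgt P)"
    "src ?BY = base_change C g ?dY piY (src PY)"
    by (simp_all add: base_change_path_ob_def)
  have Bd: "Dom C (src ?BX) = Dom C (prl C ?dX g)" "Dom C (src ?BY) = Dom C (prl C ?dY g)"
    unfolding Bs using base_change_simps[of g piX "src P" ?dX] base_change_simps[of g piY "src PY" ?dY]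
      by simp_all
  have bpsi: "path_map C ?BX (prr C piY g) ?BY (base_change C g piX piY q) ?psi"
    by (rule base_change_path_map[OF _ P PY _ _ _ _ _ psi]) simp_all
  have wT [simp]: "w \<in> Arr C" "Dom C w = Dom C (prl C ?dX g)" "Cod C w = Dom C (src Q)"
    "src Q \<cdot> w = eX \<cdot> base_change C g ?dX piX (src P)" "tgt Q \<cdot> w = eX \<cdot> base_change C g ?dX piX (tgt P)"
    using path_map_simps[OF w BX Q] Bd Bs by simp_all
  have psiT [simp]: "?psi \<in> Arr C" "Dom C ?psi = Dom C (prl C ?dX g)" "Cod C ?psi = Dom C (prl C ?dY g)"
    using path_map_simps[OF bpsi BX BY] Bd by simp_all
  have wYT [simp]: "wY \<in> Arr C" "Dom C wY = Dom C (prl C ?dY g)" "Cod C wY = Dom C (src QY)"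
    using path_map_simps[OF wY BY QY] Bd by simp_all
  have 1: "path_map C ?BX y QY (p \<cdot> eX) (phi \<cdot> w)"
    by (rule path_map_cmp[OF BX Q QY _ _ _ _ _ _ _ _ _ _ w phi, of "Idn C (Dom C g)"]) simp_all
  have 2: "path_map C ?BX y QY (p \<cdot> eX) (wY \<cdot> ?psi)"
    unfolding eX_simps(4)
    by (rule path_map_cmp[OF BX BY QY _ _ _ _ _ _ _ _ _ _ bpsi wY, of "Idn C (Dom C g)"]) simp_all
  have phiw: "homotopic C (ends C y QY) (phi \<cdot> w) (wY \<cdot> ?psi)"
    by (rule path_map_unique[OF BX QY _ _ _ 1 2]) simp_all
  have "lifts_paths x g piX eX P Q w a"
    unfolding lifts_paths_def
  proof (intro allI impI, elim conjE)
    fix u u' H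
    assume u: "u \<in> Arr C" "Dom C u = Dom C a" "Cod C u = Dom C piX" "piX \<cdot> u = a"
      and u': "u' \<in> Arr C" "Dom C u' = Dom C a" "Cod C u' = Dom C piX" "piX \<cdot> u' = a"
      and H: "H \<in> Arr C" "Dom C H = Dom C (prl C a g)" "Cod C H = Dom C (src Q)"
        "src Q \<cdot> H = eX \<cdot> base_change C g a piX u" "tgt Q \<cdot> H = eX \<cdot> base_change C g a piX u'"
    note [simp] = u u' H
    have bu [simp]: "base_change C g a piX t \<in> Arr C" "Dom C (base_change C g a piX t) =
        Dom C (prl C a g)"
      "Cod C (base_change C g a piX t) = Dom C (prl C piX g)"
      if "t \<in> Arr C" "Cod C t = Dom C piX" "piX \<cdot> t = a" for t
      using base_change_simps[of g piX t a] that by simp_all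
    have lb: "base_change C g piX piY q \<cdot> base_change C g a piX t = base_change C g a piY (q \<cdot> t)"
      if "t \<in> Arr C" "Cod C t = Dom C piX" "piX \<cdot> t = a" for t
      by (rule lift_base(1)) (use that in simp_all)
    \<comment> \<open>A path in \<open>\<Pi>Y\<close> for the image of \<open>H\<close> in \<open>Y\<close>, and its lift \<open>G\<close> to \<open>\<Pi>X\<close> starting at \<open>u\<close>.\<close>
    obtain h0 where h0 [simp]: "h0 \<in> Arr C" "Dom C h0 = Dom C a" "Cod C h0 = Dom C (src PY)"
      "src PY \<cdot> h0 = q \<cdot> u" "tgt PY \<cdot> h0 = q \<cdot> u'"
      and h0H: "homotopic C (ends C y QY) (wY \<cdot> base_change C g a ?dY h0) (phi \<cdot> H)"
      by (rule lifts_pathsD[OF Yfull[OF PY QY wY a], of "q \<cdot> u" "q \<cdot> u'" "phi \<cdot> H"])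
        (simp_all add: lb)
    obtain G where G [simp]: "G \<in> Arr C" "Dom C G = Dom C u" "Cod C G = Dom C (src P)" "src P \<cdot> G = u"
      "psi \<cdot> G = h0"
      by (rule path_lifting[OF PF PY _ _ _ _ h0(1), of u]) simp_all
    let ?u = "tgt P \<cdot> G"
    have "q \<cdot> ?u = tgt PY \<cdot> (psi \<cdot> G)" using pf(7)[of G] by simp
    then have qu: "q \<cdot> ?u = q \<cdot> u'" by simp
    have pu: "piX \<cdot> ?u = a" by simp
    let ?G = "base_change C g a ?dX G"
    have GT [simp]: "?G \<in> Arr C" "Dom C ?G = Dom C (prl C a g)" "Cod C ?G = Dom C (prl C ?dX g)"
      using base_change_simps[of g ?dX G a] by simp_all
    have sP: "base_change C g ?dX piX (src P) \<cdot> ?G = base_change C g a piX u"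
      "base_change C g ?dX piX (tgt P) \<cdot> ?G = base_change C g a piX ?u"
      using base_change_cmp[of g piX "src P" ?dX G a] base_change_cmp[of g piX "tgt P" ?dX G a]
        by simp_all
    have bsT [simp]: "base_change C g ?dX piX (src P) \<in> Arr C" "Dom C (base_change C g ?dX piX (src P)) =
        Dom C (prl C ?dX g)"
      "Cod C (base_change C g ?dX piX (src P)) = Dom C (prl C piX g)"
      "base_change C g ?dX piX (tgt P) \<in> Arr C" "Dom C (base_change C g ?dX piX (tgt P)) =
          Dom C (prl C ?dX g)"
      "Cod C (base_change C g ?dX piX (tgt P)) = Dom C (prl C piX g)"
      using base_change_simps[of g piX "src P" ?dX] base_change_simps[of g piX "tgt P" ?dX] by simp_all
    have sw: "src Q \<cdot> (w \<cdot> ?G) = eX \<cdot> base_change C g a piX u"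
      "tgt Q \<cdot> (w \<cdot> ?G) = eX \<cdot> base_change C g a piX ?u"
      using cmp_eq[OF wT(4), of ?G] cmp_eq[OF wT(5), of ?G] sP by simp_all
    \<comment> \<open>\<open>w \<cdot> ?G\<close> and \<open>H\<close> have homotopic images in \<open>Y\<close>, so \<open>H\<close> can be moved to have the same image.\<close>
    have psiG: "?psi \<cdot> ?G = base_change C g a ?dY h0"
      using base_change_cmp[of g ?dY psi ?dX G a] by simp
    have "homotopic C (ends C y QY) (phi \<cdot> (w \<cdot> ?G)) (wY \<cdot> (?psi \<cdot> ?G))"
      using homotopic_pre[OF phiw, of ?G] by simp
    then have "homotopic C (ends C y QY) (phi \<cdot> (w \<cdot> ?G)) (phi \<cdot> H)"
      unfolding psiG using homotopic_trans h0H by blast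
    from homotopic_sym[OF this] obtain H1 where H1: "homotopic C (ends C x Q) H H1"
      "phi \<cdot> H1 = phi \<cdot> (w \<cdot> ?G)"
      using path_rectify[OF QF QY, of H "phi \<cdot> (w \<cdot> ?G)"] by auto
    note E = homotopic_endsD[OF H1(1) Q]
    obtain K where K: "K \<in> Arr C" "Dom C K = Dom C (w \<cdot> ?G)" "Cod C K = Dom C (src R)"
      "src R \<cdot> K = tgt Q \<cdot> (w \<cdot> ?G)" "tgt R \<cdot> K = tgt Q \<cdot> H1"
      and KH: "homotopic C (ends C x Q) (join Q R d (w \<cdot> ?G) K) H1"
    proof (rule path_division[OF QF QY _ _ R d, of "w \<cdot> ?G" H1, unfolded p_simps(3)])
      show "homotopic C (ends C x Q) (join Q R d G (rfl R \<cdot> (tgt Q \<cdot> G))) G"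
        if "G \<in> Arr C" "Cod C G = pob C Q" for G by (rule dunit[OF that])
      show "src Q \<cdot> (w \<cdot> ?G) = src Q \<cdot> H1" using E(6) sw by simp
    qed (use E H1(2) in simp_all)
    \<comment> \<open>The remaining fibre path comes from a path \<open>h\<close> over a constant path in \<open>\<Pi>Y\<close>.\<close>
    obtain h where h: "h \<in> Arr C" "Dom C h = Dom C ?u" "Cod C h = Dom C (src S)" "src S \<cdot> h = ?u"
      "tgt S \<cdot> h = u'"
      and hK: "homotopic C (ends C p R) (v \<cdot> base_change C g a (piX \<cdot> src S) h) K"
      using vlift[of ?u u' a K] K sw(2) E(7) qu pu by auto
    have hD: "Dom C h = Dom C G" using h(2) by simp
    note j = join_simps[OF c P S P _ G(1) h(1) hD G(3) h(3) h(4)[symmetric]]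
    have "homotopic C (ends C x Q) (w \<cdot> base_change C g a ?dX (join P S c G h))
      (join Q R d (w \<cdot> ?G) (v \<cdot> base_change C g a (piX \<cdot> src S) h))"
      by (rule action_join[OF P Q R S w v c cunit d dunit G(1) h(1) hD G(3) h(3)
        h(4)[symmetric]]) simp_all
    also have "homotopic C (ends C x Q) (join Q R d (w \<cdot> ?G) (v \<cdot> base_change C g a (piX \<cdot> src S) h))
        (join Q R d (w \<cdot> ?G) K)"
      by (rule homotopic_sym, rule join_cong_right[OF d Q R Q _ _ _ _ _ homotopic_sym[OF hK]])
        (use K in simp_all)
    also note KH
    also have "homotopic C (ends C x Q) H1 H" by (rule homotopic_sym[OF H1(1)])
    finally show "\<exists>h. h \<in> Arr C \<and> Dom C h = Dom C a \<and> Cod C h = Dom C (src P) \<and> src P \<cdot> h = u \<and>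
        tgt P \<cdot> h = u' \<and>
        homotopic C (ends C x Q) (w \<cdot> base_change C g a (piX \<cdot> src P) h) H"
      by (intro exI[of _ "join P S c G h"]) (use h(5) in \<open>simp add: j\<close>)
  qed
  then show ?thesis by (rule lifts_paths_transfer[OF X P P' Q Q' w w' a])
qed

lemma weak_Pi_type_composite:
  assumes "weak_Pi_type C y g piY eY" "weak_Pi_type C x' g' q e'"
  shows "weak_Pi_type C x g piX eX"
proof -
  have "Cod C x' = Dom C g'" by simp
  with assms have "lifts_points y g piY eY a" if "a \<in> Arr C" "Cod C a = Cod C g" for a
    using that weak_Pi_type_iff[of y g] by simp
  moreover have "lifts_points x' g' q e' b" if "b \<in> Arr C" "Cod C b = Dom C piY" for b
    using that assms(2) weak_Pi_type_iff[of x' g'] by simp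
  ultimately show ?thesis
    using weak_Pi_type_iff[of x g] X lifts_points_composite by simp
qed

lemma strong_Pi_type_composite:
  assumes sY: "strong_Pi_type C y g piY eY" and sX': "strong_Pi_type C x' g' q e'"
  shows "strong_Pi_type C x g piX eX"
proof -
  have Yfull: "lifts_paths y g piY eY P Q w a"
    if "is_path_object C piY P" "is_path_object C y Q"
      "path_map C (base_change_path_ob C g piY P) y Q eY w"
      "a \<in> Arr C" "Cod C a = Cod C g" for P Q w a
    using that sY strong_Pi_type_iff[of y g] full_iff[OF Y] by simp
  have X'full: "lifts_paths x' g' q e' P Q w b"
    if "is_path_object C q P" "is_path_object C x' Q"
      "path_map C (base_change_path_ob C g' q P) x' Q e' w"
      "b \<in> Arr C" "Cod C b = Dom C piY" for P Q w b
    using that sX' strong_Pi_type_iff[of x' g'] full_iff[OF X'] by simp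
  have "weak_Pi_type C x g piX eX"
    using weak_Pi_type_composite sY sX' strong_Pi_type_iff[of y g] strong_Pi_type_iff[of x' g'] by simp
  moreover have "full (hom_groupoid C a piX P) (hom_groupoid C (prr C a g) x Q)
      (Pi_functor C x g piX eX a P Q)"
    if P: "is_path_object C piX P" and Q: "is_path_object C x Q" and a: "a \<in> Arr C"
      "Cod C a = Cod C g" for P Q a
  proof -
    obtain w where w: "path_map C (base_change_path_ob C g piX P) x Q eX w"
      using Pi_path_map_ex[OF X P Q] .
    show ?thesis
      unfolding full_iff[OF X P Q w a] by (rule lifts_paths_composite[OF Yfull X'full P Q w a])
  qed
  ultimately show ?thesis using strong_Pi_type_iff[of x g] by simp
qed

end

theorem proposition5p2:
  fixes C :: "('o, 'a, 'z) cloven_cat_scheme" and f x y p :: 'a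
  assumes "path_category C" and "chosen_pullbacks C"
    and "f \<in> fib C"
    and "x \<in> fib C" and "Cod C x = Dom C f"
    and "y \<in> fib C" and "Cod C y = Dom C f"
    and "p \<in> fib C" and "p \<in> hom C (Dom C x) (Dom C y)" and "y \<cdot>\<^bsub>C\<^esub> p = x"
  shows "(\<forall>piY eY. has_weak_Pi_types C \<longrightarrow> weak_Pi_type C y f piY eY \<longrightarrow>
            (\<exists>piX eX q. weak_Pi_type C x f piX eX \<and>
               q \<in> fib C \<and> q \<in> hom C (Dom C piX) (Dom C piY) \<and> piY \<cdot>\<^bsub>C\<^esub> q = piX \<and>
               p \<cdot>\<^bsub>C\<^esub> eX = eY \<cdot>\<^bsub>C\<^esub> base_change C f piX piY q)) \<and>
         (\<forall>piY eY. has_strong_Pi_types C \<longrightarrow> strong_Pi_type C y f piY eY \<longrightarrow>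
            (\<exists>piX eX q. strong_Pi_type C x f piX eX \<and>
               q \<in> fib C \<and> q \<in> hom C (Dom C piX) (Dom C piY) \<and> piY \<cdot>\<^bsub>C\<^esub> q = piX \<and>
               p \<cdot>\<^bsub>C\<^esub> eX = eY \<cdot>\<^bsub>C\<^esub> base_change C f piX piY q))"
proof -
  interpret cloven_path_category C
    using assms(1,2) by (simp add: cloven_path_category_def cloven_path_category_axioms_def)
  have p: "p \<in> fib C" "Cod C p = Dom C y" "y \<cdot>\<^bsub>C\<^esub> p = x" using assms by (auto simp: hom_def)
  have PX: "Pi_composite C f x y p piY eY q e' piX"
    if "pi_data y f piY eY" "pi_data (prl C eY p) (prl C piY f) q e'"
      "piY \<cdot>\<^bsub>C\<^esub> q = piX" for piY eY q e' piX
    using that p cloven_path_category_axioms by (simp add: Pi_composite_def Pi_composite_axioms_def)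
  have x': "prl C eY p \<in> fib C" "prl C piY f \<in> fib C" "Cod C (prl C eY p) = Dom C (prl C piY f)"
    if "pi_data y f piY eY" for piY eY
    using pi_data_simps[OF that] pr_fib[of eY p] pr_fib[of piY f] p by simp_all
  show ?thesis
  proof (intro conjI allI impI)
    fix piY eY
    assume has: "has_weak_Pi_types C" and hY: "weak_Pi_type C y f piY eY"
    have dY: "pi_data y f piY eY" using hY weak_Pi_type_iff[of y f] assms by simp
    note x' = x'[OF dY]
    obtain q e' where hX': "weak_Pi_type C (prl C eY p) (prl C piY f) q e'"
      using has x' unfolding has_weak_Pi_types_def by blast
    then have "pi_data (prl C eY p) (prl C piY f) q e'" using weak_Pi_type_iff x' by simp
    moreover obtain piX where piX: "piY \<cdot>\<^bsub>C\<^esub> q = piX" by blast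
    ultimately interpret Pi_composite C f x y p piY eY q e' piX by (rule PX[OF dY])
    show "\<exists>piX eX q. weak_Pi_type C x f piX eX \<and>
               q \<in> fib C \<and> q \<in> hom C (Dom C piX) (Dom C piY) \<and> piY \<cdot>\<^bsub>C\<^esub> q = piX \<and>
               p \<cdot>\<^bsub>C\<^esub> eX = eY \<cdot>\<^bsub>C\<^esub> base_change C f piX piY q"
      using weak_Pi_type_composite[OF hY hX'] by (intro exI[of _ piX] exI[of _ eX] exI[of _ q])
        (simp add: hom_def)
  next
    fix piY eY
    assume has: "has_strong_Pi_types C" and hY: "strong_Pi_type C y f piY eY"
    have dY: "pi_data y f piY eY" using hY strong_Pi_type_iff[of y f] weak_Pi_type_iff[of y f] assms
      by simp
    note x' = x'[OF dY]
    obtain q e' where hX': "strong_Pi_type C (prl C eY p) (prl C piY f) q e'"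
      using has x' unfolding has_strong_Pi_types_def by blast
    then have "pi_data (prl C eY p) (prl C piY f) q e'" using strong_Pi_type_iff weak_Pi_type_iff x'
      by simp
    moreover obtain piX where piX: "piY \<cdot>\<^bsub>C\<^esub> q = piX" by blast
    ultimately interpret Pi_composite C f x y p piY eY q e' piX by (rule PX[OF dY])
    show "\<exists>piX eX q. strong_Pi_type C x f piX eX \<and>
               q \<in> fib C \<and> q \<in> hom C (Dom C piX) (Dom C piY) \<and> piY \<cdot>\<^bsub>C\<^esub> q = piX \<and>
               p \<cdot>\<^bsub>C\<^esub> eX = eY \<cdot>\<^bsub>C\<^esub> base_change C f piX piY q"
      using strong_Pi_type_composite[OF hY hX'] by (intro exI[of _ piX] exI[of _ eX] exI[of _ q])
        (simp add: hom_def)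
  qed
qed

end
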